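(* Let $\alpha$ be a strictly positive finite measure on $\mathbb{X}$ with total mass $a>0$ and let $n\ge1$ be a fixed integer. Let $\{P_m^{(n)},m\ge0\}$ be the measure-valued Markov chain on $\mathcal{P}_{\mathbb{X}}$ defined by the recursive identity $$P_m^{(n)}=\theta_m\sum_{i=1}^n q_{m,i}^{(n)}\,\delta_{Y_{m,i}}+(1-\theta_m)\,P_{m-1}^{(n)},\qquad m\ge1,$$ with $P_0^{(n)}\in\mathcal{P}_{\mathbb{X}}$ arbitrary. Then $\{P_m^{(n)},m\ge0\}$ has a unique invariant measure $\Pi$, which is the law of a Dirichlet process $P$ with parameter $\alpha$.
   Context: $\mathbb{X}$ is a Polish space with Borel $\sigma$-field $\mathscr{X}$, and $\mathcal{P}_{\mathbb{X}}$ is the space of probability measures on $\mathbb{X}$ with the $\sigma$-field generated by the topology of weak convergence. $\{\theta_m,m\ge1\}$ is a sequence of independent random variables with Beta distribution with parameter $(n,a)$; $\{(q_{m,1}^{(n)},\ldots,q_{m,n}^{(n)}),m\ge1\}$ is a sequence of independent random vectors identically distributed according to the Dirichlet distribution with parameter $(1,\ldots,1)$ (so $\sum_{i=1}^n q_{m,i}^{(n)}=1$); $\{(Y_{m,1},\ldots,Y_{m,n}),m\ge1\}$ is a sequence of independent random vectors, each distributed as the first $n$ terms of a P\'olya sequence with parameter $\alpha$. These three sequences are mutually independent. A P\'olya sequence with parameter $\alpha$ is a sequence $\{Y_j,j\ge1\}$ of $\mathbb{X}$-valued random variables with $\mathbb{P}(Y_1\in A)=\alpha(A)/a$ and $\mathbb{P}(Y_{j+1}\in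 A\mid Y_1,\ldots,Y_j)=\frac{1}{a+j}\alpha(A)+\frac{1}{a+j}\sum_{i=1}^j\delta_{Y_i}(A)$ for $j\ge1$, $A\in\mathscr{X}$. A Dirichlet process on $\mathbb{X}$ with parameter $\alpha$ is a random probability measure $P$ such that, for every finite measurable partition $B_1,\ldots,B_k$ of $\mathbb{X}$, $(P(B_1),\ldots,P(B_k))$ has Dirichlet distribution with parameter $(\alpha(B_1),\ldots,\alpha(B_k))$. *)

theory Defs
  imports "HOL-Probability.Probability"
begin

text \<open>The coarsest topology on the Borel probability measures that makes
  \<open>p \<mapsto> \<integral> f dp\<close> continuous for every bounded continuous real function \<open>f\<close>.
  Only the carrier of \<^const>\<open>prob_algebra\<close> is used here, not its \<open>\<sigma>\<close>-algebra.\<close>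

definition weak_topology :: "'a::polish_space measure topology" where
  "weak_topology = topology_generated_by
     {{p \<in> space (prob_algebra borel). (\<integral>x. f x \<partial>p) \<in> U} | f U.
        continuous_on UNIV (f :: 'a \<Rightarrow> real) \<and> bounded (range f) \<and> open U}"

definition prob_measures :: "'a::polish_space measure measure" where
  "prob_measures = sigma (space (prob_algebra borel)) {V. openin weak_topology V}"

definition beta_dist :: "real \<Rightarrow> real \<Rightarrow> real measure" where
  "beta_dist b c = density lborel
     (\<lambda>x. ennreal (if 0 < x \<and> x < 1
        then x powr (b - 1) * (1 - x) powr (c - 1) / Beta b c else 0))"

text \<open>Unit scale; the shape \<open>0\<close> is the point mass at \<open>0\<close>.\<close>

definition gamma_dist :: "real \<Rightarrow> real measure" where
  "gamma_dist c = (if c = 0 then return borel 0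
     else density lborel
       (\<lambda>x. ennreal (if 0 < x then x powr (c - 1) * exp (- x) / Gamma c else 0)))"

text \<open>The law of normalised independent gamma variables (Ferguson's definition). Some, but not
  all, of the parameters may be \<open>0\<close>, in which case the corresponding coordinates vanish; this is
  needed because blocks of a partition may be null sets of the parameter measure.\<close>

definition dirichlet_dist :: "'i set \<Rightarrow> ('i \<Rightarrow> real) \<Rightarrow> ('i \<Rightarrow> real) measure" where
  "dirichlet_dist I c =
     distr (\<Pi>\<^sub>M i\<in>I. gamma_dist (c i)) (\<Pi>\<^sub>M i\<in>I. borel) (\<lambda>z. \<lambda>i\<in>I. z i / (\<Sum>j\<in>I. z j))"

definition generated_algebra ::
    "'w measure \<Rightarrow> nat set \<Rightarrow> 's measure \<Rightarrow> (nat \<Rightarrow> 'w \<Rightarrow> 's) \<Rightarrow> 'w measure" where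
  "generated_algebra M I S X =
     vimage_algebra (space M) (\<lambda>\<omega>. \<lambda>i\<in>I. X i \<omega>) (\<Pi>\<^sub>M i\<in>I. S)"

text \<open>Terms are indexed from \<open>1\<close>; the value at index \<open>0\<close> is irrelevant.\<close>

definition polya_sequence ::
    "'w measure \<Rightarrow> 'a::polish_space measure \<Rightarrow> (nat \<Rightarrow> 'w \<Rightarrow> 'a) \<Rightarrow> bool" where
  "polya_sequence M \<alpha> Y \<longleftrightarrow>
     prob_space M \<and>
     (\<forall>j\<ge>1. Y j \<in> borel_measurable M) \<and>
     (\<forall>A\<in>sets borel. measure M {\<omega> \<in> space M. Y 1 \<omega> \<in> A} = measure \<alpha> A / measure \<alpha> UNIV) \<and>
     (\<forall>j\<ge>1. \<forall>A\<in>sets borel. AE \<omega> in M.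
        real_cond_exp M (generated_algebra M {1..j} borel Y)
          (\<lambda>\<omega>. indicator A (Y (Suc j) \<omega>)) \<omega>
        = 1 / (measure \<alpha> UNIV + real j) * measure \<alpha> A
          + 1 / (measure \<alpha> UNIV + real j) * (\<Sum>i=1..j. measure (return borel (Y i \<omega>)) A))"

definition dirichlet_process ::
    "'w measure \<Rightarrow> 'a::polish_space measure \<Rightarrow> ('w \<Rightarrow> 'a measure) \<Rightarrow> bool" where
  "dirichlet_process M \<alpha> P \<longleftrightarrow>
     prob_space M \<and>
     P \<in> M \<rightarrow>\<^sub>M prob_measures \<and>
     (\<forall>(k::nat) B. (\<forall>i\<in>{1..k}. B i \<in> sets borel) \<and> disjoint_family_on B {1..k} \<and>
        (\<Union>i\<in>{1..k}. B i) = UNIV \<longrightarrow>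
        distr M (\<Pi>\<^sub>M i\<in>{1..k}. borel) (\<lambda>\<omega>. \<lambda>i\<in>{1..k}. measure (P \<omega>) (B i))
        = dirichlet_dist {1..k} (\<lambda>i. measure \<alpha> (B i)))"

text \<open>The underlying probability space may be taken on the type of measures on \<open>'a\<close> without loss
  of generality: the identity on the space of probability measures, equipped with the law of any
  Dirichlet process, is again a Dirichlet process with that law.\<close>

definition dirichlet_process_law ::
    "'a::polish_space measure \<Rightarrow> 'a measure measure \<Rightarrow> bool" where
  "dirichlet_process_law \<alpha> Q \<longleftrightarrow>
     (\<exists>(N :: 'a measure measure) P. dirichlet_process N \<alpha> P \<and> Q = distr N prob_measures P)"

definition markov_chain ::
    "'w measure \<Rightarrow> 's measure \<Rightarrow> ('s \<Rightarrow> 's measure) \<Rightarrow> (nat \<Rightarrow> 'w \<Rightarrow> 's) \<Rightarrow> bool" where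
  "markov_chain M S K X \<longleftrightarrow>
     prob_space M \<and>
     K \<in> S \<rightarrow>\<^sub>M prob_algebra S \<and>
     (\<forall>m. X m \<in> M \<rightarrow>\<^sub>M S) \<and>
     (\<forall>m. \<forall>A\<in>sets S. AE \<omega> in M.
        real_cond_exp M (generated_algebra M {..m} S X) (\<lambda>\<omega>. indicator A (X (Suc m) \<omega>)) \<omega>
        = measure (K (X m \<omega>)) A)"

definition invariant_measure :: "'s measure \<Rightarrow> ('s \<Rightarrow> 's measure) \<Rightarrow> 's measure \<Rightarrow> bool" where
  "invariant_measure S K Q \<longleftrightarrow>
     prob_space Q \<and> sets Q = sets S \<and>
     (\<forall>A\<in>sets S. (\<integral>\<^sup>+ x. emeasure (K x) A \<partial>Q) = emeasure Q A)"

definition chain_step ::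
    "nat \<Rightarrow> real \<Rightarrow> (nat \<Rightarrow> real) \<Rightarrow> (nat \<Rightarrow> 'a::polish_space) \<Rightarrow> 'a measure \<Rightarrow> 'a measure" where
  "chain_step n t w y p = measure_of UNIV (sets borel)
     (\<lambda>A. ennreal t * (\<Sum>i=1..n. ennreal (w i) * emeasure (return borel (y i)) A)
          + ennreal (1 - t) * emeasure p A)"

primrec measure_chain ::
    "nat \<Rightarrow> (nat \<Rightarrow> 'w \<Rightarrow> real) \<Rightarrow> (nat \<Rightarrow> nat \<Rightarrow> 'w \<Rightarrow> real) \<Rightarrow> (nat \<Rightarrow> nat \<Rightarrow> 'w \<Rightarrow> 'a::polish_space) \<Rightarrow>
      'a measure \<Rightarrow> nat \<Rightarrow> 'w \<Rightarrow> 'a measure" where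
  "measure_chain n \<theta> q Y p 0 = (\<lambda>\<omega>. p)"
| "measure_chain n \<theta> q Y p (Suc m) =
     (\<lambda>\<omega>. chain_step n (\<theta> (Suc m) \<omega>) (\<lambda>i. q (Suc m) i \<omega>) (\<lambda>i. Y (Suc m) i \<omega>)
        (measure_chain n \<theta> q Y p m \<omega>))"

text \<open>The law of the first step from the point \<open>p\<close>. The innovations are identically distributed over
  time, so this is the transition kernel of every step.\<close>

definition chain_kernel ::
    "'w measure \<Rightarrow> nat \<Rightarrow> (nat \<Rightarrow> 'w \<Rightarrow> real) \<Rightarrow> (nat \<Rightarrow> nat \<Rightarrow> 'w \<Rightarrow> real) \<Rightarrow>
      (nat \<Rightarrow> nat \<Rightarrow> 'w \<Rightarrow> 'a::polish_space) \<Rightarrow> 'a measure \<Rightarrow> 'a measure measure" where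
  "chain_kernel M n \<theta> q Y p = distr M prob_measures (measure_chain n \<theta> q Y p 1)"

end

theory Submission imports Defs begin

text \<open>
  The step \<open>p \<mapsto> t D + (1 - t) p\<close> is a random affine contraction with \<open>(t, D)\<close> independent of \<open>p\<close>. An
  invariant law exists: it is the law of the stick-breaking series with independent copies of \<open>(t, D)\<close>.
  Expanding the joint moments of \<open>p(B\<^sub>1), ..., p(B\<^sub>k)\<close> after one step expresses each moment by moments of
  lower degree and by itself with coefficient \<open>E (1 - t)^d < 1\<close>; so all moments, and hence the invariant
  law, are unique.

  To identify the law it remains to see that the Dirichlet moments solve the same recursion. This rests
  on the size-bias identity \<open>E\<^sub>c [v\<^sub>i f(v)] = (c\<^sub>i / \<bar>c\<bar>) E [f(v)]\<close>, where the right expectation is under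
  \<open>Dir(c + e\<^sub>i)\<close>, and its beta analogue: by induction on the degree, \<open>\<theta> \<Sum> q\<^sub>i e\<^sub>y\<^sub>i + (1 - \<theta>) v\<close> has the
  moments of \<open>Dir(c + \<Sum> e\<^sub>y\<^sub>i)\<close>, and averaging over the P\'olya sequence \<open>y\<close> returns \<open>Dir(c)\<close>.
\<close>

section \<open>The weak topology generates the evaluation algebra\<close>

text \<open>The invariant law has to be constructed before it can be recognised: the Dirichlet laws
  of all finite partitions do not by themselves yield a random probability measure. The almost
  surely convergent series supplies one for any pair \<open>(t, D)\<close>, the moment equations
  only identify it, and existence of the Dirichlet process is a by-product.

  The moment argument sees a random measure only through its masses, whereas the state space carries
  the sigma-algebra of the weak topology, given by uncountably many generators. Equality with the
  sigma-algebra of the evaluations \<open>p(B)\<close> is where separability enters. Moments suffice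
  because masses lie in the unit interval, and \<open>E (1 - t)^d = 1\<close> is excluded by
  \<open>E t = n / (n + a) > 0\<close>.

  The parameters fit exactly: \<open>n\<close> is the total of the weight parameter
  \<open>(1, ..., 1)\<close> and the first beta parameter, \<open>a\<close> is the total mass of
  \<open>\<alpha>\<close> and the second one. Every size-bias step preserves this matching, which is
  what the induction on the degree lives on.\<close>

lemma generate_topology_on_countable_base_sets:
  assumes C: "countable S" "\<And>B. B \<in> S \<Longrightarrow> B \<in> sets M"
    and base: "\<And>B x. B \<in> G \<Longrightarrow> x \<in> B \<Longrightarrow> \<exists>F. finite F \<and> F \<noteq> {} \<and> F \<subseteq> S \<and> x \<in> \<Inter>F \<and> \<Inter>F \<subseteq> B"
    and U: "generate_topology_on G U"
  shows "U \<in> sets M"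
proof -
  \<comment> \<open>\<open>nb x V\<close> says that a finite intersection of members of
    \<open>S\<close> fits between \<open>x\<close> and \<open>V\<close>; the property passes from
    the generators to all open sets. The family must be nonempty because \<open>\<Inter>{}\<close>
    is the whole type, which need not lie in \<open>sets M\<close>.\<close>
  define nb where "nb x V \<longleftrightarrow> (\<exists>F. finite F \<and> F \<noteq> {} \<and> F \<subseteq> S \<and> x \<in> \<Inter>F \<and> \<Inter>F \<subseteq> V)" for x V
  have nb_mono: "nb x V \<Longrightarrow> V \<subseteq> W \<Longrightarrow> nb x W" for x V W
    unfolding nb_def by (meson order_trans)
  have nb_Int: "nb x (V \<inter> W)" if V: "nb x V" and W: "nb x W" for x V W
  proof -
    obtain F1 where F1: "finite F1" "F1 \<noteq> {}" "F1 \<subseteq> S" "x \<in> \<Inter>F1" "\<Inter>F1 \<subseteq> V"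
      using V unfolding nb_def by (elim exE conjE)
    obtain F2 where F2: "finite F2" "F2 \<noteq> {}" "F2 \<subseteq> S" "x \<in> \<Inter>F2" "\<Inter>F2 \<subseteq> W"
      using W unfolding nb_def by (elim exE conjE)
    have "\<Inter>(F1 \<union> F2) = \<Inter>F1 \<inter> \<Inter>F2" by auto
    with F1 F2 show ?thesis
      unfolding nb_def by (intro exI[of _ "F1 \<union> F2"]) (simp add: le_infI1 le_infI2)
  qed
  have nb: "\<forall>x\<in>U. nb x U"
    using U
  proof induction
    case (Int a b)
    then show ?case using nb_Int by simp
  next
    case (UN K)
    then show ?case using nb_mono by (meson Union_iff Union_upper)
  next
    case (Basis s)
    then show ?case using base unfolding nb_def by simp
  qed simp
  \<comment> \<open>\<open>S\<close> has only countably many finite subsets; the open set is the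
    union of those intersections that it contains, however many points it has.\<close>
  define D where "D = Inter ` {F. finite F \<and> F \<noteq> {} \<and> F \<subseteq> S \<and> \<Inter>F \<subseteq> U}"
  have "U = \<Union>D"
  proof
    show "U \<subseteq> \<Union>D"
    proof
      fix x assume "x \<in> U"
      then have "nb x U" using nb by simp
      then obtain F where "finite F" "F \<noteq> {}" "F \<subseteq> S" "x \<in> \<Inter>F" "\<Inter>F \<subseteq> U"
        unfolding nb_def by (elim exE conjE)
      then show "x \<in> \<Union>D" unfolding D_def by (intro UnionI[of "\<Inter>F"] imageI) auto
    qed
  qed (auto simp: D_def)
  moreover have "countable D"
    unfolding D_def
    by (rule countable_image, rule countable_subset[OF _ countable_Collect_finite_subset[OF C(1)]]) auto
  moreover have "d \<in> sets M" if "d \<in> D" for d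
    using that C(2) unfolding D_def by (auto intro!: sets.finite_INT[where A="\<lambda>x. x", simplified])
  ultimately show ?thesis
    by (metis sets.countable_Union subsetI)
qed

section \<open>Lower bounds on masses of open sets as countable neighbourhoods\<close>

lemma card_less_real_bounds:
  fixes y :: real
  assumes "0 \<le> y" "y \<le> real k"
  shows "(\<Sum>i=1..k. if real i < y then 1 else 0 :: real) \<le> y"
    and "y \<le> 1 + (\<Sum>i=1..k. if real i < y then 1 else 0 :: real)"
proof -
  \<comment> \<open>The count is the ceiling of \<open>y\<close> minus one; the truncated
    subtraction covers \<open>y = 0\<close>.\<close>
  have "{i\<in>{1..k}. real i < y} = {1..nat \<lceil>y\<rceil> - 1}"
    using assms by (auto; linarith)
  then have eq: "(\<Sum>i=1..k. if real i < y then 1 else 0 :: real) = real (nat \<lceil>y\<rceil> - 1)"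
    by (simp add: sum.If_cases Int_def)
  show "(\<Sum>i=1..k. if real i < y then 1 else 0 :: real) \<le> y"
    unfolding eq using assms by linarith
  show "y \<le> 1 + (\<Sum>i=1..k. if real i < y then 1 else 0 :: real)"
    unfolding eq using assms by linarith
qed

text \<open>Counting the thresholds \<open>i / k\<close> below \<open>g x\<close> recovers
  \<open>k * g x\<close> up to one, and integrating the count gives masses of level sets. These are
  open for continuous \<open>g\<close>, so integrals are traded for masses of open sets at the cost
  \<open>1 / k\<close>.\<close>

lemma integral_level_sets_bounds:
  fixes g :: "'a::topological_space \<Rightarrow> real" and k :: nat
  assumes p: "p \<in> space (prob_algebra borel)" and g: "continuous_on UNIV g" "\<And>x. 0 \<le> g x \<and> g x \<le> 1"
    and k: "k > 0"
  shows "(\<Sum>i=1..k. measure p {x. g x > real i / real k}) / real k \<le> (\<integral>x. g x \<partial>p)"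
    and "(\<integral>x. g x \<partial>p) \<le> 1 / real k + (\<Sum>i=1..k. measure p {x. g x > real i / real k}) / real k"
proof -
  interpret p: prob_space p using p by (simp add: space_prob_algebra)
  have sp[simp, measurable_cong]: "sets p = sets borel" "space p = UNIV"
    using p sets_eq_imp_space_eq[of p borel] by (auto simp: space_prob_algebra)
  have [measurable]: "g \<in> borel_measurable p"
    using borel_measurable_continuous_onI[OF g(1)] by measurable
  have ig: "integrable p g"
    using g(2) by (intro p.integrable_const_bound[of _ 1]) auto
  let ?h = "\<lambda>x. \<Sum>i=1..k. if real i < real k * g x then 1 else 0 :: real"
  have "{x \<in> space p. real i / real k < g x} \<in> sets p" for i
    by measurable
  then have op: "{x. real i / real k < g x} \<in> sets p" for i
    by simp
  have h: "?h = (\<lambda>x. \<Sum>i=1..k. indicat_real {x. g x > real i / real k} x)"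
    using k by (intro ext sum.cong refl) (simp add: field_simps indicator_def)
  have ih: "integrable p ?h" and eh: "(\<integral>x. ?h x \<partial>p) = (\<Sum>i=1..k. measure p {x. g x > real i / real k})"
    unfolding h using op
    by (auto intro!: Bochner_Integration.integrable_sum integrable_real_indicator simp: p.emeasure_finite less_top[symmetric])
  have b: "?h x \<le> real k * g x" "real k * g x \<le> 1 + ?h x" for x
    using card_less_real_bounds[of "real k * g x" k] g(2)[of x] k
    by (auto simp: mult_left_le)
  have "(\<integral>x. ?h x \<partial>p) \<le> (\<integral>x. real k * g x \<partial>p)"
    by (intro integral_mono ih ig integrable_mult_right b)
  then show "(\<Sum>i=1..k. measure p {x. g x > real i / real k}) / real k \<le> (\<integral>x. g x \<partial>p)"
    unfolding eh using k by (simp add: pos_divide_le_eq mult.commute)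
  have "(\<integral>x. real k * g x \<partial>p) \<le> (\<integral>x. 1 + ?h x \<partial>p)"
    by (intro integral_mono ih ig integrable_mult_right Bochner_Integration.integrable_add b) auto
  also have "\<dots> = 1 + (\<integral>x. ?h x \<partial>p)"
    using ih by (simp add: p.prob_space[simplified])
  finally show "(\<integral>x. g x \<partial>p) \<le> 1 / real k + (\<Sum>i=1..k. measure p {x. g x > real i / real k}) / real k"
    unfolding eh add_divide_distrib[symmetric] using k by (simp add: pos_le_divide_eq mult.commute)
qed

text \<open>The finite unions of basis elements inside an open set can be arranged to increase to
  it, and the measure is continuous along them. This is how countably many sets come to control the
  masses of all open sets.\<close>

lemma measure_open_inner_approx:
  fixes G :: "'a::second_countable_topology set"
  assumes B: "countable B" "topological_basis B" and G: "open G"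
    and p: "finite_measure p" "sets p = sets borel" and r: "r < measure p G"
  shows "\<exists>F. finite F \<and> F \<subseteq> B \<and> \<Union>F \<subseteq> G \<and> r < measure p (\<Union>F)"
proof (cases "G = {}")
  case True
  then show ?thesis using r by (intro exI[of _ "{}"]) auto
next
  case False
  interpret finite_measure p by fact
  define B' where "B' = {b\<in>B. b \<subseteq> G}"
  have G_eq: "G = \<Union>B'"
    using topological_basisE[OF B(2) G] unfolding B'_def by blast
  have B'ne: "B' \<noteq> {}" "countable B'"
    using False B(1) G_eq unfolding B'_def by auto
  define U where "U n = (\<Union>i\<le>n. from_nat_into B' i)" for n :: nat
  have "incseq U" unfolding U_def incseq_def by (intro allI impI UN_mono) auto
  moreover have "range U \<subseteq> sets p"
  proof -
    have "from_nat_into B' i \<in> sets p" for i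
      using from_nat_into[OF B'ne(1), of i] topological_basis_open[OF B(2)] unfolding B'_def p(2) by (auto intro: borel_open)
    then show ?thesis unfolding U_def by auto
  qed
  moreover have "(\<Union>n. U n) = (\<Union>i. from_nat_into B' i)"
    unfolding U_def by auto
  then have "(\<Union>n. U n) = G"
    unfolding G_eq range_from_nat_into[OF B'ne] .
  ultimately have "(\<lambda>n. measure p (U n)) \<longlonglongrightarrow> measure p G"
    using finite_Lim_measure_incseq by blast
  then have "\<forall>\<^sub>F n in sequentially. r < measure p (U n)"
    using r by (rule order_tendstoD)
  then obtain n where n: "r < measure p (U n)" by (auto simp: eventually_sequentially)
  have "from_nat_into B' i \<in> B'" for i
    using from_nat_into[OF B'ne(1)] .
  then show ?thesis
    using n by (intro exI[of _ "from_nat_into B' ` {..n}"]) (auto simp: U_def B'_def)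
qed

text \<open>Masses of open sets are weakly lower semicontinuous (portmanteau), so strict lower
  bounds on them are the natural neighbourhoods. Finite unions from a countable basis and rational
  bounds leave only countably many of them.\<close>

definition weak_subbase :: "'a set set \<Rightarrow> 'a::topological_space measure set set" where
  "weak_subbase B = (\<lambda>(F, r). {p \<in> space (prob_algebra borel). r < measure p (\<Union>F)}) `
     ({F. finite F \<and> F \<subseteq> B} \<times> \<rat>)"

lemma weak_subbase_lsc_unit:
  fixes g :: "'a::polish_space \<Rightarrow> real"
  assumes B: "countable B" "topological_basis B"
    and p: "p \<in> space (prob_algebra borel)" and g: "continuous_on UNIV g" "\<And>x. 0 \<le> g x \<and> g x \<le> 1"
    and c: "c < (\<integral>x. g x \<partial>p)"
  shows "\<exists>F. finite F \<and> F \<noteq> {} \<and> F \<subseteq> weak_subbase B \<and> p \<in> \<Inter>F \<and>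
           \<Inter>F \<subseteq> {p \<in> space (prob_algebra borel). c < (\<integral>x. g x \<partial>p)}"
proof -
  \<comment> \<open>\<open>1 / k\<close> is the discretisation error of the level sets; it has to
    stay below the gap between the integral and \<open>c\<close>.\<close>
  obtain k :: nat where k: "k > 0" "1 / k < (\<integral>x. g x \<partial>p) - c"
    using c by (metis diff_gt_0_iff_gt gr0I nat_approx_posE of_nat_0_less_iff zero_less_Suc)
  define G where "G i = {x. g x > real i / k}" for i :: nat
  have oG: "open (G i)" for i
    unfolding G_def using g(1) by (intro open_Collect_less continuous_on_const)
  have fp: "finite_measure p" "sets p = sets borel"
    using p by (auto simp: space_prob_algebra prob_space.finite_measure)
  \<comment> \<open>\<open>e\<close> is the part of the gap left after discretisation. Each of the
    \<open>k\<close> masses may lose \<open>e\<close>, since the losses are averaged as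
    well.\<close>
  define e where "e = (\<Sum>i=1..k. measure p (G i)) / k - c"
  have e: "e > 0"
    using integral_level_sets_bounds(2)[OF p g k(1)] k(2) unfolding e_def G_def by linarith
  have "\<exists>F r. finite F \<and> F \<subseteq> B \<and> \<Union>F \<subseteq> G i \<and> r \<in> \<rat> \<and> r < measure p (\<Union>F) \<and> measure p (G i) - e \<le> r" for i
  proof -
    obtain F where F: "finite F" "F \<subseteq> B" "\<Union>F \<subseteq> G i" "measure p (G i) - e < measure p (\<Union>F)"
      using measure_open_inner_approx[OF B oG fp, of "measure p (G i) - e" i] e by auto
    obtain r where "r \<in> \<rat>" "measure p (G i) - e < r" "r < measure p (\<Union>F)"
      using Rats_dense_in_real[OF F(4)] by auto
    with F show ?thesis by (intro exI[of _ F] exI[of _ r]) auto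
  qed
  then obtain F r where Fr: "\<And>i. finite (F i)" "\<And>i. F i \<subseteq> B" "\<And>i. \<Union>(F i) \<subseteq> G i" "\<And>i. r i \<in> \<rat>"
      "\<And>i. r i < measure p (\<Union>(F i))" "\<And>i. measure p (G i) - e \<le> r i"
    by metis
  define W where "W i = {p \<in> space (prob_algebra borel). r i < measure p (\<Union>(F i))}" for i
  have "\<Inter>(W ` {1..k}) \<subseteq> {p \<in> space (prob_algebra borel). c < (\<integral>x. g x \<partial>p)}"
  proof
    fix p' assume p': "p' \<in> \<Inter>(W ` {1..k})"
    then have p'W: "p' \<in> W i" if "i \<in> {1..k}" for i using that by auto
    have p's: "p' \<in> space (prob_algebra borel)"
      using p'W[of 1] k(1) by (auto simp: W_def)
    then interpret p': prob_space p' by (simp add: space_prob_algebra)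
    have s: "sets p' = sets borel" using p's by (simp add: space_prob_algebra)
    have lt: "r i < measure p' (G i)" if "i \<in> {1..k}" for i
      using p'W[OF that] p'.finite_measure_mono[OF Fr(3)[of i]] oG[of i] s by (auto simp: W_def)
    have "k * c = (\<Sum>i=1..k. measure p (G i) - e)"
      using k(1) unfolding sum_subtractf by (simp add: e_def right_diff_distrib)
    also have "\<dots> \<le> (\<Sum>i=1..k. r i)"
      by (intro sum_mono Fr)
    also have "\<dots> < (\<Sum>i=1..k. measure p' (G i))"
      using k(1) lt by (intro sum_strict_mono) auto
    finally have "c < (\<Sum>i=1..k. measure p' (G i)) / k"
      using k(1) by (simp add: field_simps)
    with integral_level_sets_bounds(1)[OF p's g k(1)] p's
    show "p' \<in> {p \<in> space (prob_algebra borel). c < (\<integral>x. g x \<partial>p)}"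
      unfolding G_def by auto
  qed
  moreover have "p \<in> \<Inter>(W ` {1..k})"
    using p Fr(5) by (auto simp: W_def)
  moreover have "W i \<in> weak_subbase B" for i
    unfolding W_def weak_subbase_def by (rule image_eqI[of _ _ "(F i, r i)"]) (use Fr(1,2,4)[of i] in auto)
  then have "W ` {1..k} \<subseteq> weak_subbase B" by blast
  ultimately show ?thesis
    using k(1) by (intro exI[of _ "W ` {1..k}"]) auto
qed

lemma weak_subbase_lsc:
  fixes f :: "'a::polish_space \<Rightarrow> real"
  assumes B: "countable B" "topological_basis B"
    and p: "p \<in> space (prob_algebra borel)" and f: "continuous_on UNIV f" "\<And>x. \<bar>f x\<bar> \<le> b"
    and c: "c < (\<integral>x. f x \<partial>p)"
  shows "\<exists>F. finite F \<and> F \<noteq> {} \<and> F \<subseteq> weak_subbase B \<and> p \<in> \<Inter>F \<and>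
           \<Inter>F \<subseteq> {p \<in> space (prob_algebra borel). c < (\<integral>x. f x \<partial>p)}"
proof -
  \<comment> \<open>The affine map of \<open>[-b', b']\<close> onto the unit interval commutes with
    integration because the measures have mass one; the added \<open>1\<close> keeps
    \<open>b'\<close> positive even if \<open>b = 0\<close>.\<close>
  define b' where "b' = b + 1"
  have b': "b' > 0" "\<bar>f x\<bar> \<le> b'" for x
    using f(2)[of x] f(2)[of undefined] by (auto simp: b'_def)
  define g where "g x = (f x + b') / (2 * b')" for x
  have g: "continuous_on UNIV g" "0 \<le> g x \<and> g x \<le> 1" for x
    using f(1) b'(2)[of x] b'(1) unfolding g_def
    by (auto intro!: continuous_intros simp: field_simps abs_le_iff)
  have int: "(\<integral>x. g x \<partial>q) = ((\<integral>x. f x \<partial>q) + b') / (2 * b')" if q: "q \<in> space (prob_algebra borel)" for q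
  proof -
    interpret q: prob_space q using q by (simp add: space_prob_algebra)
    have "sets q = sets borel" using q by (simp add: space_prob_algebra)
    then have "f \<in> borel_measurable q"
      using borel_measurable_continuous_onI[OF f(1)] by (simp cong: measurable_cong_sets)
    then have "integrable q f"
      using f(2) by (intro q.integrable_const_bound[of _ b]) auto
    then show ?thesis
      unfolding g_def by (simp add: q.prob_space)
  qed
  have "(c + b') / (2 * b') < (\<integral>x. g x \<partial>p)"
    using c b'(1) by (simp add: int[OF p] divide_strict_right_mono)
  from weak_subbase_lsc_unit[OF B p g this]
  obtain F where F: "finite F" "F \<noteq> {}" "F \<subseteq> weak_subbase B" "p \<in> \<Inter>F"
      "\<Inter>F \<subseteq> {p \<in> space (prob_algebra borel). (c + b') / (2 * b') < (\<integral>x. g x \<partial>p)}"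
    by (elim exE conjE)
  moreover have "{p \<in> space (prob_algebra borel). (c + b') / (2 * b') < (\<integral>x. g x \<partial>p)}
      \<subseteq> {p \<in> space (prob_algebra borel). c < (\<integral>x. f x \<partial>p)}"
  proof safe
    fix q :: "'a measure" assume q: "q \<in> space (prob_algebra borel)" "(c + b') / (2 * b') < (\<integral>x. g x \<partial>q)"
    then have "(c + b') / (2 * b') * (2 * b') < ((\<integral>x. f x \<partial>q) + b') / (2 * b') * (2 * b')"
      unfolding int[OF q(1)] using b'(1) by (intro mult_strict_right_mono) auto
    then show "c < (\<integral>x. f x \<partial>q)"
      using b'(1) by simp
  qed
  ultimately show ?thesis
    by (intro exI[of _ F] conjI) (assumption | rule order_trans[of "\<Inter>F"])+
qed

text \<open>A topology with uncountably many generators may have open sets outside the sigma-algebra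
  of the generators. Here the countable family \<open>weak_subbase\<close> refines the generators at
  every point, and its members are measurable because they are described by evaluations.\<close>

lemma weak_topology_open_measurable:
  assumes "openin (weak_topology :: 'a::polish_space measure topology) U"
  shows "U \<in> sets (prob_algebra borel)"
proof -
  obtain B :: "'a set set" where B: "countable B" "topological_basis B"
    using ex_countable_basis by blast
  have "generate_topology_on {{p \<in> space (prob_algebra borel). (\<integral>x. f x \<partial>p) \<in> U} | f U.
        continuous_on UNIV (f :: 'a \<Rightarrow> real) \<and> bounded (range f) \<and> open U} U"
    using assms by (simp add: weak_topology_def openin_topology_generated_by_iff)
  then show ?thesis
  proof (rule generate_topology_on_countable_base_sets[rotated -1])
    show "countable (weak_subbase B)"
      unfolding weak_subbase_def
      by (intro countable_image countable_SIGMA countable_Collect_finite_subset B(1) countable_rat)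
    show "S \<in> sets (prob_algebra borel)" if S': "S \<in> weak_subbase B" for S
    proof -
      obtain F r where F: "finite F" "F \<subseteq> B"
        and S: "S = {p \<in> space (prob_algebra borel). r < measure p (\<Union>F)}"
        using S' by (auto simp: weak_subbase_def)
      have "open (\<Union>F)"
        using F topological_basis_open[OF B(2)] by blast
      then have [measurable]: "\<Union>F \<in> sets borel" by simp
      have [measurable]: "(\<lambda>p. measure p (\<Union>F)) \<in> borel_measurable (prob_algebra borel)"
        unfolding prob_algebra_def by (intro measurable_restrict_space1) measurable
      show ?thesis unfolding S by measurable
    qed
    show "\<exists>F. finite F \<and> F \<noteq> {} \<and> F \<subseteq> weak_subbase B \<and> p \<in> \<Inter>F \<and> \<Inter>F \<subseteq> V"
      if V: "V \<in> {{p \<in> space (prob_algebra borel). (\<integral>x. f x \<partial>p) \<in> U} | f U.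
        continuous_on UNIV (f :: 'a \<Rightarrow> real) \<and> bounded (range f) \<and> open U}" and p: "p \<in> V" for V p
    proof -
      from V obtain f U where f: "continuous_on UNIV (f :: 'a \<Rightarrow> real)" "bounded (range f)" "open U"
        and V_eq: "V = {p \<in> space (prob_algebra borel). (\<integral>x. f x \<partial>p) \<in> U}" by blast
      have p': "p \<in> space (prob_algebra borel)" and fU: "(\<integral>x. f x \<partial>p) \<in> U"
        using p V_eq by auto
      obtain b where b: "\<And>x. \<bar>f x\<bar> \<le> b"
        using f(2) by (auto simp: bounded_iff)
      obtain e where e: "e > 0" "\<And>y. \<bar>y - (\<integral>x. f x \<partial>p)\<bar> < e \<Longrightarrow> y \<in> U"
        using f(3) fU by (auto simp: open_dist dist_real_def)
      \<comment> \<open>Lower bounds for the integrals of \<open>f\<close> and of \<open>- f\<close>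
        together confine the integral of \<open>f\<close> to an interval of radius
        \<open>e\<close>.\<close>
      obtain F1 where F1: "finite F1" "F1 \<noteq> {}" "F1 \<subseteq> weak_subbase B" "p \<in> \<Inter>F1"
         "\<Inter>F1 \<subseteq> {q \<in> space (prob_algebra borel). (\<integral>x. f x \<partial>p) - e < (\<integral>x. f x \<partial>q)}"
        using weak_subbase_lsc[OF B p' f(1) b, of "(\<integral>x. f x \<partial>p) - e"] e(1) by auto
      obtain F2 where F2: "finite F2" "F2 \<noteq> {}" "F2 \<subseteq> weak_subbase B" "p \<in> \<Inter>F2"
         "\<Inter>F2 \<subseteq> {q \<in> space (prob_algebra borel). - (\<integral>x. f x \<partial>p) - e < (\<integral>x. - f x \<partial>q)}"
        using weak_subbase_lsc[OF B p' continuous_on_minus[OF f(1)], of b "- (\<integral>x. f x \<partial>p) - e"] e(1) b by auto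
      have "\<Inter>(F1 \<union> F2) \<subseteq> V"
      proof
        fix q assume "q \<in> \<Inter>(F1 \<union> F2)"
        then have "q \<in> \<Inter>F1" "q \<in> \<Inter>F2" by auto
        then have "q \<in> space (prob_algebra borel)" "(\<integral>x. f x \<partial>p) - e < (\<integral>x. f x \<partial>q)"
          "- (\<integral>x. f x \<partial>p) - e < - (\<integral>x. f x \<partial>q)"
          using F1(5) F2(5) by auto
        then show "q \<in> V" unfolding V_eq using e(2)[of "\<integral>x. f x \<partial>q"] by auto
      qed
      then show ?thesis using F1 F2 by (intro exI[of _ "F1 \<union> F2"]) auto
    qed
  qed
qed

section \<open>Masses of Borel sets are measurable for the weak topology\<close>

lemma openin_weak_topology_integral:
  assumes "continuous_on UNIV (f :: 'a::polish_space \<Rightarrow> real)" "bounded (range f)" "open U"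
  shows "openin weak_topology {p \<in> space (prob_algebra borel). (\<integral>x. f x \<partial>p) \<in> U}"
  unfolding weak_topology_def by (rule topology_generated_by_Basis) (use assms in blast)

lemma weak_topology_subset_Pow:
  "{V. openin (weak_topology :: 'a::polish_space measure topology) V} \<subseteq> Pow (space (prob_algebra borel))"
  using sets.sets_into_space[OF weak_topology_open_measurable] by blast

lemma space_prob_measures: "space (prob_measures :: 'a::polish_space measure measure) = space (prob_algebra borel)"
  unfolding prob_measures_def by (rule space_measure_of[OF weak_topology_subset_Pow])

lemma measurable_integral_prob_measures:
  assumes "continuous_on UNIV (f :: 'a::polish_space \<Rightarrow> real)" "bounded (range f)"
  shows "(\<lambda>p. \<integral>x. f x \<partial>p) \<in> borel_measurable prob_measures"
proof (rule borel_measurableI)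
  fix U :: "real set" assume "open U"
  have "{p \<in> space (prob_algebra borel). (\<integral>x. f x \<partial>p) \<in> U} \<in> sets prob_measures"
    unfolding prob_measures_def sets_measure_of[OF weak_topology_subset_Pow]
    using openin_weak_topology_integral[OF assms \<open>open U\<close>] by auto
  moreover have "(\<lambda>p. \<integral>x. f x \<partial>p) -` U \<inter> space prob_measures = {p \<in> space (prob_algebra borel). (\<integral>x. f x \<partial>p) \<in> U}"
    by (auto simp: space_prob_measures)
  ultimately show "(\<lambda>p. \<integral>x. f x \<partial>p) -` U \<inter> space prob_measures \<in> sets prob_measures"
    by simp
qed

text \<open>The functions \<open>f k\<close> are continuous, bounded and decrease to the indicator
  of the closed set, so dominated convergence gives the mass as a limit of integrals. The empty set
  is separate because the distance to it is \<open>0\<close> by convention.\<close>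

lemma measurable_measure_closed_prob_measures:
  assumes "closed (C :: 'a::polish_space set)"
  shows "(\<lambda>p. measure p C) \<in> borel_measurable prob_measures"
proof (cases "C = {}")
  case False
  define f where "f k x = max 0 (1 - real k * infdist x C)" for k x
  have f: "continuous_on UNIV (f k)" "\<And>x. 0 \<le> f k x \<and> f k x \<le> 1" for k
    unfolding f_def by (auto intro!: continuous_intros simp: infdist_nonneg)
  have lim: "(\<lambda>k. f k x) \<longlonglongrightarrow> indicator C x" for x
  proof (cases "x \<in> C")
    case True
    then show ?thesis by (simp add: f_def)
  next
    case F: False
    then have pos: "infdist x C > 0"
      using assms False infdist_pos_not_in_closed by blast
    then obtain n :: nat where n: "real n * infdist x C > 1"
      using reals_Archimedean3 by blast
    have "f k x = 0" if "k \<ge> n" for k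
    proof -
      have "real n * infdist x C \<le> real k * infdist x C"
        using that pos by (intro mult_right_mono) auto
      with n show ?thesis unfolding f_def by auto
    qed
    then have "\<forall>\<^sub>F k in sequentially. f k x = indicator C x"
      using F by (auto simp: eventually_sequentially)
    then show ?thesis by (rule tendsto_eventually)
  qed
  show ?thesis
  proof (rule borel_measurable_LIMSEQ_real)
    fix p :: "'a measure" assume "p \<in> space prob_measures"
    then interpret p: prob_space p by (simp add: space_prob_measures space_prob_algebra)
    have s[simp, measurable_cong]: "sets p = sets borel" "space p = UNIV"
      using \<open>p \<in> space prob_measures\<close> sets_eq_imp_space_eq[of p borel]
      by (auto simp: space_prob_measures space_prob_algebra)
    have [measurable]: "C \<in> sets borel" using assms by auto
    have m: "f k \<in> borel_measurable p" for k
      using borel_measurable_continuous_onI[OF f(1)] by measurable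
    have "(\<lambda>k. \<integral>x. f k x \<partial>p) \<longlonglongrightarrow> (\<integral>x. indicator C x \<partial>p)"
      using f(2) m by (intro integral_dominated_convergence[where w="\<lambda>_. 1"]) (auto intro: lim)
    then show "(\<lambda>k. \<integral>x. f k x \<partial>p) \<longlonglongrightarrow> measure p C"
      by simp
  next
    fix k show "(\<lambda>p. \<integral>x. f k x \<partial>p) \<in> borel_measurable prob_measures"
      using f by (intro measurable_integral_prob_measures boundedI[of _ 1]) auto
  qed
qed simp

lemma sets_prob_measures [measurable_cong]:
  "sets (prob_measures :: 'a::polish_space measure measure) = sets (prob_algebra borel)"
proof (rule antisym)
  show "sets (prob_measures :: 'a measure measure) \<subseteq> sets (prob_algebra borel)"
    unfolding prob_measures_def sets_measure_of[OF weak_topology_subset_Pow] space_prob_algebra[symmetric]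
    by (rule sets.sigma_sets_subset) (auto intro: weak_topology_open_measurable)
  \<comment> \<open>Measurability of the identity amounts to the inclusion of the sigma-algebras.
    Closed sets are stable under intersection and generate the Borel sets, so evaluations at closed
    sets are enough.\<close>
  have "(\<lambda>p. p) \<in> prob_measures \<rightarrow>\<^sub>M (subprob_algebra borel :: 'a measure measure)"
  proof (rule measurable_subprob_algebra_generated[where G="{C. closed C}" and \<Omega>=UNIV])
    show "sets (borel::'a measure) = sigma_sets UNIV {C. closed C}"
      by (simp add: borel_eq_closed)
    show "Int_stable {C::'a set. closed C}"
      by (auto simp: Int_stable_def)
    fix p :: "'a measure" assume p: "p \<in> space prob_measures"
    then show "subprob_space p" "sets p = sets borel"
      by (auto simp: space_prob_measures space_prob_algebra prob_space_imp_subprob_space)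
  next
    fix A :: "'a set" assume "A \<in> {C. closed C}"
    then have "closed A" by simp
    then have "(\<lambda>p. ennreal (measure p A)) \<in> borel_measurable prob_measures"
      using measurable_measure_closed_prob_measures[of A] by measurable
    also have "?this \<longleftrightarrow> (\<lambda>p. emeasure p A) \<in> borel_measurable prob_measures"
      by (intro measurable_cong)
         (auto simp: space_prob_measures space_prob_algebra finite_measure.emeasure_eq_measure prob_space.finite_measure)
    finally show "(\<lambda>p. emeasure p A) \<in> borel_measurable prob_measures" .
  next
    have "(\<lambda>p. 1::ennreal) \<in> borel_measurable (prob_measures :: 'a measure measure)" by simp
    also have "?this \<longleftrightarrow> (\<lambda>p. emeasure p (UNIV::'a set)) \<in> borel_measurable prob_measures"
    proof (intro measurable_cong)
      fix p :: "'a measure" assume "p \<in> space prob_measures"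
      then have "prob_space p" "space p = UNIV"
        using sets_eq_imp_space_eq[of p borel] by (auto simp: space_prob_measures space_prob_algebra)
      then show "1 = emeasure p (UNIV::'a set)"
        using prob_space.emeasure_space_1 by metis
    qed
    finally show "(\<lambda>p. emeasure p (UNIV::'a set)) \<in> borel_measurable prob_measures" .
  qed auto
  then have "(\<lambda>p. p) \<in> prob_measures \<rightarrow>\<^sub>M (prob_algebra borel :: 'a measure measure)"
    unfolding prob_algebra_def
    by (rule measurable_restrict_space2[rotated]) (auto simp: space_prob_measures space_prob_algebra)
  then show "sets (prob_algebra borel) \<subseteq> sets (prob_measures :: 'a measure measure)"
    by (auto dest!: measurable_sets simp: space_prob_measures Int_absorb2 sets.sets_into_space)
qed

section \<open>Determination by moments\<close>

text \<open>On the unit interval all moments are at most \<open>1\<close>, so the Taylor polynomials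
  of the characteristic function, whose coefficients are the moments, converge at every
  \<open>t\<close>. Equal moments thus give equal characteristic functions.\<close>

lemma real_distribution_eqI_moments:
  assumes M1: "real_distribution M1" "AE x in M1. x \<in> {0..1}"
    and M2: "real_distribution M2" "AE x in M2. x \<in> {0..1}"
    and eq: "\<And>k. (\<integral>x. x ^ k \<partial>M1) = (\<integral>x. x ^ k \<partial>M2)"
  shows "M1 = M2"
proof (rule Levy_uniqueness[OF M1(1) M2(1)], rule ext)
  fix t
  have approx: "integrable M (\<lambda>x. x ^ k)"
      "cmod (char M t - (\<Sum>k \<le> n. ((\<i> * t)^k / fact k) * (\<integral>x. x ^ k \<partial>M))) \<le> 2*\<bar>t\<bar>^n / fact n"
    if M: "real_distribution M" "AE x in M. x \<in> {0..1}" for M k n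
  proof -
    interpret real_distribution M by fact
    have int: "integrable M (\<lambda>x. x ^ k)" for k
      using M(2) by (intro integrable_const_bound[of _ 1]) (auto simp: power_le_one)
    then show "integrable M (\<lambda>x. x ^ k)" .
    have "expectation (\<lambda>x. \<bar>x\<bar> ^ n) \<le> expectation (\<lambda>x. 1)"
      using M(2) int[of n] by (intro integral_mono_AE integrable_abs[of M "\<lambda>x. x^n", unfolded power_abs]) (auto simp: power_le_one)
    then have "expectation (\<lambda>x. \<bar>x\<bar> ^ n) \<le> 1" using prob_space by simp
    then have "(2*\<bar>t\<bar>^n / fact n) * expectation (\<lambda>x. \<bar>x\<bar>^n) \<le> (2*\<bar>t\<bar>^n / fact n) * 1"
      by (intro mult_left_mono) auto
    with char_approx1[of n t, OF int]
    show "cmod (char M t - (\<Sum>k \<le> n. ((\<i> * t)^k / fact k) * (\<integral>x. x ^ k \<partial>M))) \<le> 2*\<bar>t\<bar>^n / fact n"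
      by simp
  qed
  have "cmod (char M1 t - char M2 t) \<le> 4*\<bar>t\<bar>^n / fact n" for n
  proof -
    let ?S = "\<lambda>M. \<Sum>k \<le> n. ((\<i> * t)^k / fact k) * complex_of_real (\<integral>x. x ^ k \<partial>M)"
    have "cmod (char M1 t - char M2 t) \<le> cmod (char M1 t - ?S M1) + cmod (char M2 t - ?S M2)"
      unfolding eq using norm_triangle_ineq4[of "char M1 t - ?S M2" "char M2 t - ?S M2"] by simp
    with approx(2)[OF M1, of n] approx(2)[OF M2, of n] show ?thesis by simp
  qed
  moreover have "(\<lambda>n. 4*\<bar>t\<bar>^n / fact n) \<longlonglongrightarrow> 0"
    using tendsto_mult_left[OF summable_LIMSEQ_zero[OF summable_exp[of "\<bar>t\<bar>"]], of 4] by (simp add: field_simps)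
  ultimately have "cmod (char M1 t - char M2 t) \<le> 0"
    by (intro tendsto_lowerbound[where f="\<lambda>n. 4*\<bar>t\<bar>^n / fact n"]) auto
  then show "char M1 t = char M2 t" by simp
qed

text \<open>A weight \<open>H\<close> with mean \<open>c\<close> is absorbed into the measure by the
  density \<open>H / c\<close>. Weighted moments of \<open>X\<close> become, up to the factor
  \<open>c\<close>, ordinary moments of a law on the unit interval, to which one-dimensional
  uniqueness applies.\<close>

lemma real_distribution_weighted:
  fixes X H :: "'a \<Rightarrow> real"
  assumes P: "prob_space P" and m[measurable]: "X \<in> borel_measurable P" "H \<in> borel_measurable P"
    and ae: "AE x in P. X x \<in> {0..1} \<and> H x \<in> {0..1}"
    and c: "c = (\<integral>x. H x \<partial>P)" "c > 0"
  defines "D \<equiv> distr (density P (\<lambda>x. ennreal (H x / c))) borel X"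
  shows "real_distribution D" and "AE x in D. x \<in> {0..1}"
    and "f \<in> borel_measurable borel \<Longrightarrow> (\<integral>x. f x \<partial>D) = (\<integral>x. H x * f (X x) \<partial>P) / (c::real)"
proof -
  interpret prob_space P by fact
  have ae0: "AE x in P. 0 \<le> H x / c" using ae c by auto
  have iH: "integrable P H" using ae by (intro integrable_const_bound[of _ 1]) auto
  have "emeasure (density P (\<lambda>x. ennreal (H x / c))) (space P) = (\<integral>\<^sup>+x. ennreal (H x / c) \<partial>P)"
    by (subst emeasure_density) (auto intro!: nn_integral_cong simp: indicator_def)
  also have "\<dots> = ennreal (\<integral>x. H x / c \<partial>P)"
    using iH ae0 by (intro nn_integral_eq_integral) auto
  also have "\<dots> = 1" using c by simp
  finally have 1: "prob_space (density P (\<lambda>x. ennreal (H x / c)))"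
    by (intro prob_spaceI) simp
  then interpret D: prob_space D unfolding D_def by (rule prob_space.prob_space_distr) simp
  show "real_distribution D" by unfold_locales (auto simp: D_def)
  show "AE x in D. x \<in> {0..1}"
    unfolding D_def using ae by (subst AE_distr_iff) (auto simp: AE_density)
  show "(\<integral>x. f x \<partial>D) = (\<integral>x. H x * f (X x) \<partial>P) / c" if [measurable]: "f \<in> borel_measurable borel"
    unfolding D_def using ae0 by (subst integral_distr) (auto simp: integral_density)
qed

lemma weighted_indicator_integral_eqI:
  fixes X1 H1 :: "'a \<Rightarrow> real" and X2 H2 :: "'b \<Rightarrow> real"
  assumes P1: "prob_space P1" "X1 \<in> borel_measurable P1" "H1 \<in> borel_measurable P1"
      "AE x in P1. X1 x \<in> {0..1} \<and> H1 x \<in> {0..1}"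
    and P2: "prob_space P2" "X2 \<in> borel_measurable P2" "H2 \<in> borel_measurable P2"
      "AE x in P2. X2 x \<in> {0..1} \<and> H2 x \<in> {0..1}"
    and eq: "\<And>k. (\<integral>x. H1 x * X1 x ^ k \<partial>P1) = (\<integral>x. H2 x * X2 x ^ k \<partial>P2)"
    and B: "B \<in> sets borel"
  shows "(\<integral>x. H1 x * indicator B (X1 x) \<partial>P1) = (\<integral>x. H2 x * indicator B (X2 x) \<partial>P2)"
proof -
  define c where "c = (\<integral>x. H1 x \<partial>P1)"
  have c2: "c = (\<integral>x. H2 x \<partial>P2)" using eq[of 0] by (simp add: c_def)
  show ?thesis
  proof (cases "c = 0")
    case True
    have z: "(\<integral>x. H x * indicator B (X x) \<partial>P) = 0"
      if P: "prob_space P" and m[measurable]: "X \<in> borel_measurable P" "H \<in> borel_measurable P"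
        and ae: "AE x in P. X x \<in> {0..1} \<and> H x \<in> {0..1}"
        and c: "(\<integral>x. H x \<partial>P) = 0" for P :: "'c measure" and X H :: "'c \<Rightarrow> real"
    proof -
      interpret prob_space P by fact
      have "integrable P H" using ae by (intro integrable_const_bound[of _ 1]) auto
      then have "AE x in P. H x = 0"
        using c ae by (subst (asm) integral_nonneg_eq_0_iff_AE) auto
      then have "AE x in P. H x * indicator B (X x) = 0" by auto
      then show ?thesis by (subst integral_cong_AE[where g="\<lambda>_. 0"]) (use B in auto)
    qed
    show ?thesis
      using z[OF P1] z[OF P2] True c2 unfolding c_def by simp
  next
    case False
    have "c \<ge> 0" unfolding c_def using P1(4) by (intro integral_nonneg_AE) auto
    with False have c: "c > 0" by simp
    note m1 = real_distribution_weighted[OF P1 c_def c] and m2 = real_distribution_weighted[OF P2 c2 c]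
    have "distr (density P1 (\<lambda>x. ennreal (H1 x / c))) borel X1 = distr (density P2 (\<lambda>x. ennreal (H2 x / c))) borel X2"
      by (rule real_distribution_eqI_moments[OF m1(1,2) m2(1,2)]) (simp add: m1(3) m2(3) eq)
    then show ?thesis
      using m1(3)[of "indicator B"] m2(3)[of "indicator B"] B c by simp
  qed
qed

text \<open>Coordinates are changed from powers to indicators one at a time. For coordinate
  \<open>j\<close> all other factors form the weight \<open>H\<close>, and the one-dimensional
  result with this weight passes from powers of \<open>v j\<close> to indicators.\<close>

lemma prob_PiM_moments_indicator_eq:
  fixes P1 P2 :: "('i \<Rightarrow> real) measure"
  assumes P1: "prob_space P1" "sets P1 = sets (\<Pi>\<^sub>M i\<in>I. borel)" "\<And>i. i \<in> I \<Longrightarrow> AE v in P1. v i \<in> {0..1}"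
    and P2: "prob_space P2" "sets P2 = sets (\<Pi>\<^sub>M i\<in>I. borel)" "\<And>i. i \<in> I \<Longrightarrow> AE v in P2. v i \<in> {0..1}"
    and eq: "\<And>J r. finite J \<Longrightarrow> J \<subseteq> I \<Longrightarrow> (\<integral>v. (\<Prod>i\<in>J. v i ^ r i) \<partial>P1) = (\<integral>v. (\<Prod>i\<in>J. v i ^ r i) \<partial>P2)"
    and J: "finite J" "J \<subseteq> I" and K: "finite K" "K \<subseteq> I" "J \<inter> K = {}"
    and A: "\<And>i. i \<in> J \<Longrightarrow> A i \<in> sets borel"
  shows "(\<integral>v. (\<Prod>i\<in>J. indicator (A i) (v i)) * (\<Prod>i\<in>K. v i ^ r i) \<partial>P1)
       = (\<integral>v. (\<Prod>i\<in>J. indicator (A i) (v i)) * (\<Prod>i\<in>K. v i ^ r i) \<partial>P2)"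
  using J K A
proof (induction J arbitrary: K r rule: finite_induct)
  case empty
  then show ?case using eq[of K r] by simp
next
  case (insert j J)
  note sets_cong[measurable_cong] = P1(2) P2(2)
  have A': "A i \<in> sets borel" if "i \<in> J" for i using insert.prems that by auto
  have JK: "finite J" "J \<subseteq> I" "j \<in> I" "finite K" "K \<subseteq> I" "j \<notin> K" "j \<notin> J" "J \<inter> K = {}"
    using insert by auto
  let ?H = "\<lambda>v. (\<Prod>i\<in>J. indicator (A i) (v i)) * (\<Prod>i\<in>K. v i ^ r i) :: real"
  have m1: "(\<lambda>v. v i) \<in> borel_measurable P1" "(\<lambda>v. v i) \<in> borel_measurable P2" if "i \<in> I" for i
    using measurable_component_singleton[OF that, of "\<lambda>_. borel"] by (auto cong: measurable_cong_sets simp: P1(2) P2(2))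
  have mi: "(\<lambda>v. indicator (A i) (v i) :: real) \<in> borel_measurable P1"
     "(\<lambda>v. indicator (A i) (v i) :: real) \<in> borel_measurable P2" if "i \<in> J" for i
    using m1[of i] A'[OF that] that JK(2) by (auto intro!: measurable_compose[OF _ borel_measurable_indicator])
  have mH: "?H \<in> borel_measurable P1" "?H \<in> borel_measurable P2"
    using m1 mi JK by (auto intro!: borel_measurable_times borel_measurable_prod borel_measurable_power)
  have aeH: "AE v in P. v j \<in> {0..1} \<and> ?H v \<in> {0..1}"
    if "\<And>i. i \<in> I \<Longrightarrow> AE v in P. v i \<in> {0..1}" for P :: "('i \<Rightarrow> real) measure"
  proof -
    have "AE v in P. \<forall>i\<in>insert j K. v i \<in> {0..1}"
      using that JK by (intro AE_finite_allI) auto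
    then show ?thesis
    proof eventually_elim
      case (elim v)
      have "0 \<le> (\<Prod>i\<in>J. indicator (A i) (v i) :: real)" "(\<Prod>i\<in>J. indicator (A i) (v i) :: real) \<le> 1"
        by (auto intro!: prod_nonneg prod_le_1)
      moreover have "0 \<le> (\<Prod>i\<in>K. v i ^ r i)" "(\<Prod>i\<in>K. v i ^ r i) \<le> 1"
        using elim by (auto intro!: prod_nonneg prod_le_1 simp: power_le_one)
      ultimately show ?case using elim by (auto simp: mult_le_one)
    qed
  qed
  \<comment> \<open>The moments in coordinate \<open>j\<close> come from the induction hypothesis
    with \<open>j\<close> moved among the power coordinates, with exponent \<open>k\<close>; hence
    \<open>K\<close> and \<open>r\<close> are arbitrary in the induction.\<close>
  have mom: "(\<integral>v. ?H v * v j ^ k \<partial>P1) = (\<integral>v. ?H v * v j ^ k \<partial>P2)" for k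
  proof -
    have "(\<lambda>v. ?H v * v j ^ k) = (\<lambda>v. (\<Prod>i\<in>J. indicator (A i) (v i)) * (\<Prod>i\<in>insert j K. v i ^ (r(j := k)) i))"
    proof
      fix v :: "'i \<Rightarrow> real"
      have "(\<Prod>i\<in>K. v i ^ (r(j := k)) i) = (\<Prod>i\<in>K. v i ^ r i)"
        using JK by (intro prod.cong) auto
      then show "?H v * v j ^ k = (\<Prod>i\<in>J. indicator (A i) (v i)) * (\<Prod>i\<in>insert j K. v i ^ (r(j := k)) i)"
        using JK by simp
    qed
    then show ?thesis
      using insert.IH[of "insert j K" "r(j := k)"] JK A' by (simp only:) auto
  qed
  have "(\<integral>v. ?H v * indicator (A j) (v j) \<partial>P1) = (\<integral>v. ?H v * indicator (A j) (v j) \<partial>P2)"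
    using insert.prems
    by (intro weighted_indicator_integral_eqI P1(1) P2(1) m1 mH aeH P1(3) P2(3) mom JK) auto
  then show ?case
    using JK by (simp add: mult_ac)
qed

text \<open>Monomials are indexed by finite subsets of \<open>I \<times> \<nat>\<close>: the second component only serves to
  repeat a coordinate. A product of sums then expands over subsets of the index set.\<close>

lemma prob_PiM_eqI_moments:
  fixes P1 P2 :: "('i \<Rightarrow> real) measure"
  assumes P1: "prob_space P1" "sets P1 = sets (\<Pi>\<^sub>M i\<in>I. borel)" "\<And>i. i \<in> I \<Longrightarrow> AE v in P1. v i \<in> {0..1}"
    and P2: "prob_space P2" "sets P2 = sets (\<Pi>\<^sub>M i\<in>I. borel)" "\<And>i. i \<in> I \<Longrightarrow> AE v in P2. v i \<in> {0..1}"
    and eq: "\<And>A :: ('i \<times> nat) set. finite A \<Longrightarrow> fst ` A \<subseteq> I \<Longrightarrow>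
       (\<integral>v. (\<Prod>x\<in>A. v (fst x)) \<partial>P1) = (\<integral>v. (\<Prod>x\<in>A. v (fst x)) \<partial>P2)"
  shows "P1 = P2"
proof (rule measure_eqI_PiM_infinite[OF P1(2) P2(2)])
  interpret P1: prob_space P1 by fact
  interpret P2: prob_space P2 by fact
  show "finite_measure P1" by unfold_locales
  fix A :: "'i \<Rightarrow> real set" and J
  assume J: "finite J" "J \<subseteq> I" and A: "\<And>i. i \<in> J \<Longrightarrow> A i \<in> sets borel"
  have eq': "(\<integral>v. (\<Prod>i\<in>J. v i ^ r i) \<partial>P1) = (\<integral>v. (\<Prod>i\<in>J. v i ^ r i) \<partial>P2)" if J: "finite J" "J \<subseteq> I" for J r
  proof -
    have "(\<Prod>i\<in>J. v i ^ r i) = (\<Prod>x\<in>(SIGMA i:J. {..<r i}). v (fst x))" for v :: "'i \<Rightarrow> real"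
      using J by (subst prod.Sigma[symmetric, where g="\<lambda>i _. v i", unfolded case_prod_unfold, simplified]) auto
    then show ?thesis
      using eq[of "SIGMA i:J. {..<r i}"] J by (auto intro!: eq)
  qed
  let ?E = "prod_emb I (\<lambda>_. borel) J (Pi\<^sub>E J A)"
  have E: "?E \<in> sets (\<Pi>\<^sub>M i\<in>I. borel)"
    using J A by (intro sets_PiM_I) auto
  have ind: "indicator ?E v = (\<Prod>i\<in>J. indicator (A i) (v i) :: real)" if "v \<in> space (\<Pi>\<^sub>M i\<in>I. borel)" for v
  proof -
    have "v \<in> ?E \<longleftrightarrow> (\<forall>i\<in>J. v i \<in> A i)"
      using that J by (auto simp: prod_emb_iff space_PiM PiE_iff)
    then show ?thesis
      using J by (auto simp: indicator_def intro!: prod.neutral prod_zero[symmetric])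
  qed
  have "measure P ?E = (\<integral>v. (\<Prod>i\<in>J. indicator (A i) (v i)) \<partial>P)"
    if "sets P = sets (\<Pi>\<^sub>M i\<in>I. borel)" for P
  proof -
    have "measure P ?E = (\<integral>v. indicator ?E v \<partial>P)"
      using sets_eq_imp_space_eq[OF that] sets.sets_into_space[OF E] by (simp add: Int_absorb2)
    also have "\<dots> = (\<integral>v. (\<Prod>i\<in>J. indicator (A i) (v i)) \<partial>P)"
      using ind sets_eq_imp_space_eq[OF that] by (intro Bochner_Integration.integral_cong) auto
    finally show ?thesis .
  qed
  then have "measure P1 ?E = measure P2 ?E"
    using prob_PiM_moments_indicator_eq[OF P1 P2 eq' J, of "{}" A] A P1(2) P2(2) by simp
  then show "emeasure P1 ?E = emeasure P2 ?E"
    by (simp add: P1.emeasure_eq_measure P2.emeasure_eq_measure)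
qed

section \<open>Gamma, beta and Dirichlet distributions\<close>

lemma sets_gamma_dist [simp, measurable_cong]: "sets (gamma_dist c) = sets borel"
  by (simp add: gamma_dist_def)

lemma space_gamma_dist [simp]: "space (gamma_dist c) = UNIV"
  by (simp add: gamma_dist_def)

lemma nn_integral_gamma_dist:
  assumes "c > 0" and [measurable]: "f \<in> borel_measurable borel"
  shows "(\<integral>\<^sup>+x. f x \<partial>gamma_dist c) = (\<integral>\<^sup>+x. ennreal (if 0 < x then x powr (c - 1) * exp (- x) / Gamma c else 0) * f x \<partial>lborel)"
  using assms(1) by (simp add: gamma_dist_def nn_integral_density)

lemma prob_space_gamma_dist: 
  assumes "c \<ge> 0" shows "prob_space (gamma_dist c)"
proof (cases "c = 0")
  case True
  then show ?thesis by (simp add: gamma_dist_def prob_space_return)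
next
  case False
  with assms have c: "c > 0" by simp
  have "((\<lambda>t. t powr (c - 1) / exp t) has_integral Gamma c) {0..}"
    by (rule Gamma_integral_real[OF c])
  then have "((\<lambda>t. t powr (c - 1) * exp (- t)) has_integral Gamma c) {0..}"
    by (simp add: exp_minus divide_inverse)
  then have "((\<lambda>t. t powr (c - 1) * exp (- t) / Gamma c) has_integral Gamma c / Gamma c) {0..}"
    by (rule has_integral_divide)
  then have I: "((\<lambda>t. t powr (c - 1) * exp (- t) / Gamma c) has_integral 1) {0..}"
    using Gamma_real_pos[OF c] by simp
  have "(\<integral>\<^sup>+t. ennreal (indicator {0..} t * (t powr (c - 1) * exp (- t) / Gamma c)) \<partial>lborel) = ennreal 1"
    using I Gamma_real_pos[OF c] by (intro nn_integral_has_integral_lebesgue) auto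
  also have "(\<integral>\<^sup>+t. ennreal (indicator {0..} t * (t powr (c - 1) * exp (- t) / Gamma c)) \<partial>lborel)
     = (\<integral>\<^sup>+x. ennreal (if 0 < x then x powr (c - 1) * exp (- x) / Gamma c else 0) * 1 \<partial>lborel)"
    using AE_lborel_singleton[of "0::real"] by (intro nn_integral_cong_AE) (auto simp: indicator_def)
  finally show ?thesis
    using nn_integral_gamma_dist[OF c, of "\<lambda>_. 1"] by (intro prob_spaceI) simp
qed

lemma ennreal_mult_regroup:
  assumes "0 \<le> A" "0 \<le> k" "A * x = k * B"
  shows "ennreal A * (ennreal x * F) = ennreal k * (ennreal B * F)"
  using assms by (simp add: mult.assoc[symmetric] ennreal_mult'[symmetric])

text \<open>Multiplying the density by \<open>x\<close> raises the exponent by one, and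
  \<open>Gamma (c + 1) = c * Gamma c\<close> supplies the factor. For \<open>c = 0\<close> the point
  mass at \<open>0\<close> makes both sides vanish.\<close>

lemma gamma_dist_size_bias:
  assumes c: "c \<ge> 0" and [measurable]: "f \<in> borel_measurable borel"
  shows "(\<integral>\<^sup>+x. ennreal x * f x \<partial>gamma_dist c) = ennreal c * (\<integral>\<^sup>+x. f x \<partial>gamma_dist (c + 1))"
proof (cases "c = 0")
  case True
  then show ?thesis by (simp add: gamma_dist_def nn_integral_return)
next
  case False
  with c have c: "c > 0" by simp
  have G: "Gamma (c + 1) = c * Gamma c" "Gamma c > 0"
    using c Gamma_plus1[of c] nonpos_Ints_nonpos[of c] by force+
  have "ennreal (if 0 < x then x powr (c - 1) * exp (- x) / Gamma c else 0) * (ennreal x * f x)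
     = ennreal c * (ennreal (if 0 < x then x powr (c + 1 - 1) * exp (- x) / Gamma (c + 1) else 0) * f x)" for x
  proof (cases "x > 0")
    case True
    have p: "x powr (c - 1) * x = x powr (c + 1 - 1)"
      using True by (simp add: powr_diff)
    have "x powr (c - 1) * exp (- x) / Gamma c * x = (x powr (c - 1) * x) * exp (- x) / Gamma c"
      by simp
    also have "\<dots> = c * (x powr (c + 1 - 1) * exp (- x) / Gamma (c + 1))"
      unfolding p using c G by simp
    finally show ?thesis
      using True c G by (simp only: if_True) (rule ennreal_mult_regroup, auto)
  qed simp
  then show ?thesis
    using c by (simp add: nn_integral_gamma_dist nn_integral_cmult)
qed

text \<open>The factor \<open>exp (- l x)\<close> turns the rate \<open>1\<close> into
  \<open>1 + l\<close>; the substitution of \<open>x / (1 + l)\<close> for \<open>x\<close> restores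
  the rate and leaves the Laplace transform \<open>(1 + l) powr (- c)\<close> in front.\<close>

lemma gamma_dist_exp_tilt:
  assumes c: "c \<ge> 0" and l: "l \<ge> 0" and [measurable]: "f \<in> borel_measurable borel"
  shows "(\<integral>\<^sup>+x. ennreal (exp (- (l * x))) * f x \<partial>gamma_dist c)
    = ennreal ((1 + l) powr (- c)) * (\<integral>\<^sup>+x. f (x / (1 + l)) \<partial>gamma_dist c)"
proof (cases "c = 0")
  case True
  then show ?thesis using l by (simp add: gamma_dist_def nn_integral_return)
next
  case False
  with c have c: "c > 0" by simp
  let ?g = "\<lambda>x. ennreal (if 0 < x then x powr (c - 1) * exp (- x) / Gamma c else 0) * (ennreal (exp (- (l * x))) * f x)"
  have l1: "1 / (1 + l) \<noteq> 0" "1 + l > 0" using l by auto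
  have "(\<integral>\<^sup>+x. ?g x \<partial>lborel) = ennreal \<bar>1 / (1 + l)\<bar> * (\<integral>\<^sup>+x. ?g (0 + 1 / (1 + l) * x) \<partial>lborel)"
    by (rule nn_integral_real_affine[OF _ l1(1)]) measurable
  also have "(\<integral>\<^sup>+x. ?g (0 + 1 / (1 + l) * x) \<partial>lborel) = (\<integral>\<^sup>+x. ennreal ((1 + l) powr (1 - c)) *
      (ennreal (if 0 < x then x powr (c - 1) * exp (- x) / Gamma c else 0) * f (x / (1 + l))) \<partial>lborel)"
  proof (intro nn_integral_cong)
    fix x :: real
    show "?g (0 + 1 / (1 + l) * x) = ennreal ((1 + l) powr (1 - c)) *
      (ennreal (if 0 < x then x powr (c - 1) * exp (- x) / Gamma c else 0) * f (x / (1 + l)))"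
    proof (cases "x > 0")
      case True
      have e: "exp (- (x / (1 + l))) * exp (- (l * (x / (1 + l)))) = exp (- x)"
      proof -
        have "x / (1 + l) + l * (x / (1 + l)) = (1 + l) * (x / (1 + l))" by (simp add: distrib_right add_divide_distrib)
        also have "\<dots> = x" using l1(2) by simp
        finally show ?thesis by (simp add: exp_add[symmetric])
      qed
      have "(x / (1 + l)) powr (c - 1) = (1 + l) powr (1 - c) * x powr (c - 1)"
        using True l1 by (simp add: powr_divide powr_diff field_simps)
      with e have "(x / (1 + l)) powr (c - 1) * exp (- (x / (1 + l))) / Gamma c * exp (- (l * (x / (1 + l))))
         = (1 + l) powr (1 - c) * (x powr (c - 1) * exp (- x) / Gamma c)"
        by (simp add: mult_ac)
      then show ?thesis
        using True l1 Gamma_real_pos[OF c] by (simp add: mult.assoc[symmetric] ennreal_mult[symmetric])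
    next
      case False
      then have "\<not> 0 < x / (1 + l)" using l1 by (simp add: zero_less_divide_iff)
      with False show ?thesis by simp
    qed
  qed
  also have "ennreal \<bar>1 / (1 + l)\<bar> * \<dots> = ennreal \<bar>1 / (1 + l)\<bar> * (ennreal ((1 + l) powr (1 - c)) * (\<integral>\<^sup>+x. f (x / (1 + l)) \<partial>gamma_dist c))"
    using c by (simp add: nn_integral_cmult nn_integral_gamma_dist)
  also have "\<dots> = ennreal ((1 + l) powr (- c)) * (\<integral>\<^sup>+x. f (x / (1 + l)) \<partial>gamma_dist c)"
  proof -
    have "\<bar>1 / (1 + l)\<bar> * (1 + l) powr (1 - c) = (1 + l) powr (- c)"
      using l1 by (simp add: powr_diff powr_minus field_simps)
    then show ?thesis by (simp add: mult.assoc[symmetric] ennreal_mult[symmetric])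
  qed
  finally show ?thesis
    using c by (simp add: nn_integral_gamma_dist)
qed

lemma AE_gamma_dist_nonneg: "AE x in gamma_dist c. 0 \<le> x"
proof (cases "c = 0")
  case False
  then show ?thesis unfolding gamma_dist_def by (simp, subst AE_density) auto
next
  case True
  then show ?thesis unfolding gamma_dist_def by (simp, subst AE_return) auto
qed

lemma AE_gamma_dist_pos: "c > 0 \<Longrightarrow> AE x in gamma_dist c. 0 < x"
  unfolding gamma_dist_def by (simp, subst AE_density) auto

section \<open>Products of gamma distributions\<close>

definition gamma_prod :: "'i set \<Rightarrow> ('i \<Rightarrow> real) \<Rightarrow> ('i \<Rightarrow> real) measure" where
  "gamma_prod I c = (\<Pi>\<^sub>M i\<in>I. gamma_dist (c i))"

lemma sets_gamma_prod [simp, measurable_cong]: "sets (gamma_prod I c) = sets (\<Pi>\<^sub>M i\<in>I. borel)"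
  unfolding gamma_prod_def by (intro sets_PiM_cong) auto

lemma space_gamma_prod: "space (gamma_prod I c) = space (\<Pi>\<^sub>M i\<in>I. borel)"
  by (rule sets_eq_imp_space_eq) simp

lemma prob_space_gamma_prod:
  assumes "\<And>i. i \<in> I \<Longrightarrow> 0 \<le> c i"
  shows "prob_space (gamma_prod I c)"
  unfolding gamma_prod_def by (intro prob_space_PiM prob_space_gamma_dist assms)

lemma gamma_prod_insert:
  assumes I: "finite I" "i \<notin> I" and c: "\<And>j. j \<in> insert i I \<Longrightarrow> 0 \<le> c j"
    and f: "f \<in> borel_measurable (\<Pi>\<^sub>M i\<in>insert i I. borel)"
  shows "(\<integral>\<^sup>+z. f z \<partial>gamma_prod (insert i I) c) = (\<integral>\<^sup>+z. (\<integral>\<^sup>+y. f (z(i := y)) \<partial>gamma_dist (c i)) \<partial>gamma_prod I c)"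
proof -
  \<comment> \<open>\<open>product_sigma_finite\<close> asks for all indices, while \<open>c\<close>
    is controlled only on \<open>insert i I\<close>; the shape \<open>0\<close> outside gives a
    probability measure everywhere.\<close>
  define c' where "c' j = (if j \<in> insert i I then c j else 0)" for j
  interpret product_sigma_finite "\<lambda>j. gamma_dist (c' j)"
    unfolding product_sigma_finite_def
    by (intro allI prob_space_imp_sigma_finite prob_space_gamma_dist) (use c in \<open>auto simp: c'_def\<close>)
  have eq: "gamma_prod (insert i I) c = gamma_prod (insert i I) c'" "gamma_prod I c = gamma_prod I c'"
    unfolding gamma_prod_def by (auto intro!: PiM_cong simp: c'_def)
  have "f \<in> borel_measurable (Pi\<^sub>M (insert i I) (\<lambda>j. gamma_dist (c' j)))"
    using f by (simp cong: measurable_cong_sets add: sets_gamma_prod[unfolded gamma_prod_def])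
  from product_nn_integral_insert[OF I this]
  have "(\<integral>\<^sup>+z. f z \<partial>gamma_prod (insert i I) c') = (\<integral>\<^sup>+z. (\<integral>\<^sup>+y. f (z(i := y)) \<partial>gamma_dist (c' i)) \<partial>gamma_prod I c')"
    unfolding gamma_prod_def .
  then show ?thesis unfolding eq by (simp add: c'_def)
qed

text \<open>Fubini isolates the coordinate \<open>i\<close>; raising its shape leaves the product
  over the other coordinates as it is.\<close>

lemma gamma_prod_size_bias:
  assumes I: "finite I" "i \<in> I" and c: "\<And>j. j \<in> I \<Longrightarrow> 0 \<le> c j"
    and f: "f \<in> borel_measurable (\<Pi>\<^sub>M i\<in>I. borel)"
  shows "(\<integral>\<^sup>+z. ennreal (z i) * f z \<partial>gamma_prod I c) = ennreal (c i) * (\<integral>\<^sup>+z. f z \<partial>gamma_prod I (c(i := c i + 1)))"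
proof -
  define J where "J = I - {i}"
  have J: "I = insert i J" "i \<notin> J" "finite J" using I by (auto simp: J_def)
  have eq: "gamma_prod J (c(i := c i + 1)) = gamma_prod J c"
    unfolding gamma_prod_def using J by (intro PiM_cong) auto
  have [measurable]: "f \<in> borel_measurable (\<Pi>\<^sub>M i\<in>insert i J. borel)"
    using f J by simp
  have m: "(\<lambda>y. f (z(i := y))) \<in> borel_measurable borel" if "z \<in> space (\<Pi>\<^sub>M i\<in>J. borel)" for z
    using measurable_compose[OF measurable_component_update[of _ _ "\<lambda>_. borel", OF that J(2)] , of f borel] J(1) f by simp
  have "(\<integral>\<^sup>+z. ennreal (z i) * f z \<partial>gamma_prod I c)
     = (\<integral>\<^sup>+z. (\<integral>\<^sup>+y. ennreal y * f (z(i := y)) \<partial>gamma_dist (c i)) \<partial>gamma_prod J c)"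
    unfolding J(1) using J c by (subst gamma_prod_insert) auto
  also have "\<dots> = (\<integral>\<^sup>+z. ennreal (c i) * (\<integral>\<^sup>+y. f (z(i := y)) \<partial>gamma_dist (c i + 1)) \<partial>gamma_prod J c)"
    using m c I by (intro nn_integral_cong gamma_dist_size_bias) (auto simp: space_gamma_prod)
  also have "\<dots> = ennreal (c i) * (\<integral>\<^sup>+z. (\<integral>\<^sup>+y. f (z(i := y)) \<partial>gamma_dist (c i + 1)) \<partial>gamma_prod J c)"
  proof (rule nn_integral_cmult)
    interpret prob_space "gamma_dist (c i + 1)" using c[OF I(2)] by (intro prob_space_gamma_dist) simp
    show "(\<lambda>z. \<integral>\<^sup>+y. f (z(i := y)) \<partial>gamma_dist (c i + 1)) \<in> borel_measurable (gamma_prod J c)"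
      by measurable
  qed
  also have "(\<integral>\<^sup>+z. (\<integral>\<^sup>+y. f (z(i := y)) \<partial>gamma_dist (c i + 1)) \<partial>gamma_prod J c)
     = (\<integral>\<^sup>+z. f z \<partial>gamma_prod I (c(i := c i + 1)))"
    unfolding J(1) using J c by (subst gamma_prod_insert) (auto simp: eq)
  finally show ?thesis .
qed

text \<open>The tilt by the total factors over the coordinates, and each is rescaled by the same
  \<open>1 / (1 + l)\<close>: the whole vector is rescaled, which its normalisation cannot notice.
  \<open>f\<close> is arbitrary in the induction since integrating out one coordinate changes
  it.\<close>

lemma gamma_prod_exp_tilt:
  assumes I: "finite I" and c: "\<And>j. j \<in> I \<Longrightarrow> 0 \<le> c j" and l: "l \<ge> 0"
    and f: "f \<in> borel_measurable (\<Pi>\<^sub>M i\<in>I. borel)"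
  shows "(\<integral>\<^sup>+z. ennreal (exp (- (l * (\<Sum>i\<in>I. z i)))) * f z \<partial>gamma_prod I c)
     = ennreal ((1 + l) powr (- (\<Sum>i\<in>I. c i))) * (\<integral>\<^sup>+z. f (\<lambda>i\<in>I. z i / (1 + l)) \<partial>gamma_prod I c)"
  using I c f
proof (induction I arbitrary: f rule: finite_induct)
  case empty
  have "(\<integral>\<^sup>+z. g z \<partial>gamma_prod {} c) = g (\<lambda>_. undefined)" for g
    unfolding gamma_prod_def PiM_empty by (subst nn_integral_count_space_finite) auto
  note this[of f] this[of "\<lambda>z. f (\<lambda>i\<in>{}. z i / (1 + l))"]
  then show ?case using l by (simp add: restrict_def)
next
  case (insert i J)
  have [measurable]: "f \<in> borel_measurable (\<Pi>\<^sub>M i\<in>insert i J. borel)" by fact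
  interpret prob_space "gamma_dist (c i)" using insert.prems by (intro prob_space_gamma_dist) simp
  have m: "(\<lambda>y. f (z(i := y))) \<in> borel_measurable borel" if "z \<in> space (\<Pi>\<^sub>M i\<in>J. borel)" for z
    by (rule measurable_compose[OF measurable_component_update[of _ _ "\<lambda>_. borel", OF that insert(2)] insert.prems(2)])
  have J: "finite J" "i \<notin> J" "\<And>j. j \<in> J \<Longrightarrow> 0 \<le> c j" "0 \<le> c i" using insert by auto
  have "(\<integral>\<^sup>+z. ennreal (exp (- (l * (\<Sum>i\<in>insert i J. z i)))) * f z \<partial>gamma_prod (insert i J) c)
     = (\<integral>\<^sup>+z. (\<integral>\<^sup>+y. ennreal (exp (- (l * (\<Sum>j\<in>insert i J. (z(i := y)) j)))) * f (z(i := y)) \<partial>gamma_dist (c i)) \<partial>gamma_prod J c)"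
    using J insert.prems(1) by (intro gamma_prod_insert) auto
  also have "\<dots> = (\<integral>\<^sup>+z. ennreal (exp (- (l * (\<Sum>j\<in>J. z j)))) *
       (\<integral>\<^sup>+y. ennreal (exp (- (l * y))) * f (z(i := y)) \<partial>gamma_dist (c i)) \<partial>gamma_prod J c)"
  proof (intro nn_integral_cong)
    fix z assume z: "z \<in> space (gamma_prod J c)"
    have "(\<Sum>j\<in>J. (z(i := y)) j) = (\<Sum>j\<in>J. z j)" for y
      using J by (intro sum.cong) auto
    moreover have "exp (- (l * (y + S))) = exp (- (l * S)) * exp (- (l * y))" for y S :: real
      by (simp add: exp_add[symmetric] algebra_simps)
    ultimately have "ennreal (exp (- (l * (\<Sum>j\<in>insert i J. (z(i := y)) j)))) * f (z(i := y))
       = ennreal (exp (- (l * (\<Sum>j\<in>J. z j)))) * (ennreal (exp (- (l * y))) * f (z(i := y)))" for y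
      using J by (simp add: ennreal_mult mult.assoc)
    then show "(\<integral>\<^sup>+y. ennreal (exp (- (l * (\<Sum>j\<in>insert i J. (z(i := y)) j)))) * f (z(i := y)) \<partial>gamma_dist (c i))
      = ennreal (exp (- (l * (\<Sum>j\<in>J. z j)))) * (\<integral>\<^sup>+y. ennreal (exp (- (l * y))) * f (z(i := y)) \<partial>gamma_dist (c i))"
      using m[of z] z by (simp only:) (intro nn_integral_cmult, auto simp: space_gamma_prod)
  qed
  also have "\<dots> = (\<integral>\<^sup>+z. ennreal (exp (- (l * (\<Sum>j\<in>J. z j)))) *
       (ennreal ((1 + l) powr (- c i)) * (\<integral>\<^sup>+y. f (z(i := y / (1 + l))) \<partial>gamma_dist (c i))) \<partial>gamma_prod J c)"
    using m J l by (intro nn_integral_cong arg_cong2[where f="(*)"] refl gamma_dist_exp_tilt) (auto simp: space_gamma_prod)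
  also have "\<dots> = ennreal ((1 + l) powr (- c i)) * (\<integral>\<^sup>+z. ennreal (exp (- (l * (\<Sum>j\<in>J. z j)))) *
       (\<integral>\<^sup>+y. f (z(i := y / (1 + l))) \<partial>gamma_dist (c i)) \<partial>gamma_prod J c)"
    by (subst nn_integral_cmult[symmetric]) (measurable, simp add: mult_ac)
  also have "(\<integral>\<^sup>+z. ennreal (exp (- (l * (\<Sum>j\<in>J. z j)))) *
       (\<integral>\<^sup>+y. f (z(i := y / (1 + l))) \<partial>gamma_dist (c i)) \<partial>gamma_prod J c)
     = ennreal ((1 + l) powr (- (\<Sum>i\<in>J. c i))) *
       (\<integral>\<^sup>+z. (\<integral>\<^sup>+y. f ((\<lambda>i\<in>J. z i / (1 + l))(i := y / (1 + l))) \<partial>gamma_dist (c i)) \<partial>gamma_prod J c)"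
    by (rule insert.IH, erule J(3), measurable)
  also have "(\<integral>\<^sup>+z. (\<integral>\<^sup>+y. f ((\<lambda>i\<in>J. z i / (1 + l))(i := y / (1 + l))) \<partial>gamma_dist (c i)) \<partial>gamma_prod J c)
     = (\<integral>\<^sup>+z. f (\<lambda>i\<in>insert i J. z i / (1 + l)) \<partial>gamma_prod (insert i J) c)"
  proof (subst gamma_prod_insert)
    show "(\<integral>\<^sup>+z. (\<integral>\<^sup>+y. f ((\<lambda>i\<in>J. z i / (1 + l))(i := y / (1 + l))) \<partial>gamma_dist (c i)) \<partial>gamma_prod J c) =
      (\<integral>\<^sup>+z. (\<integral>\<^sup>+y. f (\<lambda>j\<in>insert i J. (z(i := y)) j / (1 + l)) \<partial>gamma_dist (c i)) \<partial>gamma_prod J c)"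
      using J by (intro nn_integral_cong arg_cong[where f=f]) auto
  qed (use J insert.prems in auto)
  also have "ennreal ((1 + l) powr (- c i)) * (ennreal ((1 + l) powr (- (\<Sum>i\<in>J. c i))) * F)
      = ennreal ((1 + l) powr (- (\<Sum>i\<in>insert i J. c i))) * F" for F
    using J l by (simp add: mult.assoc[symmetric] ennreal_mult[symmetric] powr_add[symmetric])
  finally show ?case .
qed

section \<open>Normalised gamma vectors\<close>

definition simplex_normalise :: "'i set \<Rightarrow> ('i \<Rightarrow> real) \<Rightarrow> 'i \<Rightarrow> real" where
  "simplex_normalise I z = (\<lambda>i\<in>I. z i / (\<Sum>j\<in>I. z j))"

lemma measurable_simplex_normalise [measurable]:
  "simplex_normalise I \<in> (\<Pi>\<^sub>M i\<in>I. borel) \<rightarrow>\<^sub>M (\<Pi>\<^sub>M i\<in>I. borel)"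
  unfolding simplex_normalise_def by measurable

lemma dirichlet_dist_eq: "dirichlet_dist I c = distr (gamma_prod I c) (\<Pi>\<^sub>M i\<in>I. borel) (simplex_normalise I)"
  unfolding dirichlet_dist_def gamma_prod_def simplex_normalise_def ..

lemma sets_dirichlet_dist [simp, measurable_cong]: "sets (dirichlet_dist I c) = sets (\<Pi>\<^sub>M i\<in>I. borel)"
  by (simp add: dirichlet_dist_eq)

lemma space_dirichlet_dist: "space (dirichlet_dist I c) = space (\<Pi>\<^sub>M i\<in>I. borel)"
  by (simp add: dirichlet_dist_eq)

lemma prob_space_dirichlet_dist:
  assumes "\<And>i. i \<in> I \<Longrightarrow> 0 \<le> c i"
  shows "prob_space (dirichlet_dist I c)"
  unfolding dirichlet_dist_eq by (intro prob_space.prob_space_distr prob_space_gamma_prod assms) measurable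

text \<open>Shapes may be \<open>0\<close>, so single coordinates can vanish. A positive total
  forces one positive shape, and that coordinate makes the sum positive.\<close>

lemma AE_gamma_prod:
  assumes I: "finite I" and c: "\<And>j. j \<in> I \<Longrightarrow> 0 \<le> c j" and pos: "(\<Sum>i\<in>I. c i) > 0"
  shows "AE z in gamma_prod I c. (\<forall>i\<in>I. 0 \<le> z i) \<and> 0 < (\<Sum>i\<in>I. z i)"
proof -
  interpret prob_space "gamma_prod I c" by (intro prob_space_gamma_prod c)
  have comp: "AE z in gamma_prod I c. P (z i)" if i: "i \<in> I" and "AE x in gamma_dist (c i). P x" for i P
    unfolding gamma_prod_def
    by (rule AE_PiM_component[OF _ i]) (use that c prob_space_gamma_dist in auto)
  have "\<exists>i\<in>I. c i > 0"
  proof (rule ccontr)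
    assume "\<not> ?thesis"
    then have "(\<Sum>i\<in>I. c i) \<le> 0" by (intro sum_nonpos) auto
    with pos show False by simp
  qed
  then obtain i where i: "i \<in> I" "c i > 0" by blast
  have "AE z in gamma_prod I c. \<forall>i\<in>I. 0 \<le> z i"
    using I by (intro AE_finite_allI comp AE_gamma_dist_nonneg)
  moreover have "AE z in gamma_prod I c. 0 < z i"
    using i by (intro comp AE_gamma_dist_pos)
  ultimately show ?thesis
  proof eventually_elim
    case (elim z)
    then show ?case using i I by (auto intro: sum_pos2)
  qed
qed

lemma AE_dirichlet_dist:
  assumes I: "finite I" and c: "\<And>j. j \<in> I \<Longrightarrow> 0 \<le> c j" and pos: "(\<Sum>i\<in>I. c i) > 0"
  shows "AE v in dirichlet_dist I c. (\<forall>i\<in>I. v i \<in> {0..1}) \<and> (\<Sum>i\<in>I. v i) = 1"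
  unfolding dirichlet_dist_eq
proof (subst AE_distr_iff)
  show "simplex_normalise I \<in> gamma_prod I c \<rightarrow>\<^sub>M (\<Pi>\<^sub>M i\<in>I. borel)" by measurable
  have [measurable]: "finite I" by fact
  show "{x \<in> space (\<Pi>\<^sub>M i\<in>I. borel). (\<forall>i\<in>I. x i \<in> {0..1}) \<and> (\<Sum>i\<in>I. x i) = (1::real)} \<in> sets (\<Pi>\<^sub>M i\<in>I. borel)"
    using I by measurable
  have "AE z in gamma_prod I c. (\<forall>i\<in>I. 0 \<le> z i) \<and> 0 < (\<Sum>i\<in>I. z i)"
    by (rule AE_gamma_prod) (use assms in auto)
  then show "AE x in gamma_prod I c. (\<forall>i\<in>I. simplex_normalise I x i \<in> {0..1}) \<and> (\<Sum>i\<in>I. simplex_normalise I x i) = 1"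
  proof eventually_elim
    case (elim z)
    have "z i \<le> (\<Sum>i\<in>I. z i)" if "i \<in> I" for i
      using elim I that by (intro member_le_sum) auto
    then show ?case
      using elim by (auto simp: simplex_normalise_def sum_divide_distrib[symmetric] divide_simps)
  qed
qed

text \<open>The integrand is the Laplace transform of a gamma total \<open>S\<close> of shape
  \<open>a + 1\<close>; integrating it over \<open>l\<close> evaluates
  \<open>E (1 / S)\<close>.\<close>

lemma nn_integral_powr_tail:
  assumes "a > (0::real)"
  shows "(\<integral>\<^sup>+l. ennreal ((1 + l) powr (- (a + 1))) * indicator {0..} l \<partial>lborel) = ennreal (1 / a)"
proof -
  have "(\<integral>\<^sup>+l. ennreal ((1 + l) powr (- (a + 1))) * indicator {0..} l \<partial>lborel) = ennreal (0 - (- ((1 + 0) powr (- a)) / a))"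
  proof (rule nn_integral_FTC_atLeast)
    fix x :: real assume x: "0 \<le> x"
    have "((\<lambda>x. - ((1 + x) powr (- a)) / a) has_real_derivative - (- a * (1 + x) powr (- a - 1)) / a) (at x)"
      using x by (auto intro!: derivative_eq_intros)
    moreover have "- (a + 1) = - a - 1" by simp
    ultimately show "((\<lambda>x. - ((1 + x) powr (- a)) / a) has_real_derivative (1 + x) powr (- (a + 1))) (at x)"
      using assms by (simp only:) simp
  next
    have "((\<lambda>x::real. - ((1 + x) powr (- a)) / a) \<longlongrightarrow> - 0 / a) at_top"
      using assms
      by (intro tendsto_intros tendsto_neg_powr filterlim_tendsto_add_at_top[OF tendsto_const] filterlim_ident) auto
    then show "((\<lambda>x::real. - ((1 + x) powr (- a)) / a) \<longlongrightarrow> 0) at_top" by simp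
  qed auto
  then show ?thesis by simp
qed

lemma nn_integral_exp_tail:
  assumes "s > (0::real)"
  shows "(\<integral>\<^sup>+l. ennreal (exp (- (l * s))) * indicator {0..} l \<partial>lborel) = ennreal (1 / s)"
proof -
  have "(\<integral>\<^sup>+l. ennreal (exp (- (l * s))) * indicator {0..} l \<partial>lborel) = ennreal (0 - (- exp (- (0 * s)) / s))"
  proof (rule nn_integral_FTC_atLeast)
    fix x :: real
    show "((\<lambda>x. - exp (- (x * s)) / s) has_real_derivative exp (- (x * s))) (at x)"
      using assms by (auto intro!: derivative_eq_intros)
  next
    have "((\<lambda>x::real. - exp (- (x * s)) / s) \<longlongrightarrow> - 0 / s) at_top"
      using assms
      by (intro tendsto_intros filterlim_compose[OF exp_at_bot] filterlim_uminus_at_bot[THEN iffD2])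
         (auto intro!: filterlim_at_top_mult_tendsto_pos[OF tendsto_const _ filterlim_ident])
    then show "((\<lambda>x::real. - exp (- (x * s)) / s) \<longlongrightarrow> 0) at_top" by simp
  qed auto
  then show ?thesis by simp
qed

text \<open>Independence of the normalised vector from the total mass, in the weak form that is needed:
  exponential tilting only rescales the gamma vector, and \<open>1 / s\<close> is the integral of \<open>exp (- l s)\<close> over \<open>l\<close>.\<close>

lemma gamma_prod_inverse_total:
  assumes I: "finite I" and c: "\<And>j. j \<in> I \<Longrightarrow> 0 \<le> c j" and a: "(\<Sum>i\<in>I. c i) = a + 1" "a > 0"
    and f[measurable]: "f \<in> borel_measurable (\<Pi>\<^sub>M i\<in>I. borel)"
  shows "(\<integral>\<^sup>+z. ennreal (1 / (\<Sum>i\<in>I. z i)) * f (simplex_normalise I z) \<partial>gamma_prod I c)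
     = ennreal (1 / a) * (\<integral>\<^sup>+v. f v \<partial>dirichlet_dist I c)"
proof -
  interpret prob_space "gamma_prod I c" by (intro prob_space_gamma_prod c)
  interpret pair_sigma_finite lborel "gamma_prod I c" ..
  let ?N = "\<lambda>z. f (simplex_normalise I z)"
  have mN: "?N \<in> borel_measurable (\<Pi>\<^sub>M i\<in>I. borel)" by measurable
  note [measurable] = mN
  have ae: "AE z in gamma_prod I c. (\<forall>i\<in>I. 0 \<le> z i) \<and> 0 < (\<Sum>i\<in>I. z i)"
    by (rule AE_gamma_prod) (use I c a in auto)
  have "(\<integral>\<^sup>+z. ennreal (1 / (\<Sum>i\<in>I. z i)) * ?N z \<partial>gamma_prod I c)
     = (\<integral>\<^sup>+z. (\<integral>\<^sup>+l. ennreal (exp (- (l * (\<Sum>i\<in>I. z i)))) * indicator {0..} l * ?N z \<partial>lborel) \<partial>gamma_prod I c)"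
    using ae by (intro nn_integral_cong_AE) (auto simp: nn_integral_multc nn_integral_exp_tail)
  also have "\<dots> = (\<integral>\<^sup>+l. (\<integral>\<^sup>+z. ennreal (exp (- (l * (\<Sum>i\<in>I. z i)))) * indicator {0..} l * ?N z \<partial>gamma_prod I c) \<partial>lborel)"
    by (rule Fubini') measurable
  also have "\<dots> = (\<integral>\<^sup>+l. ennreal ((1 + l) powr (- (a + 1))) * indicator {0..} l * (\<integral>\<^sup>+z. ?N z \<partial>gamma_prod I c) \<partial>lborel)"
  proof (intro nn_integral_cong)
    fix l :: real
    show "(\<integral>\<^sup>+z. ennreal (exp (- (l * (\<Sum>i\<in>I. z i)))) * indicator {0..} l * ?N z \<partial>gamma_prod I c)
      = ennreal ((1 + l) powr (- (a + 1))) * indicator {0..} l * (\<integral>\<^sup>+z. ?N z \<partial>gamma_prod I c)"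
    proof (cases "l \<ge> 0")
      case True
      \<comment> \<open>Normalisation ignores the common factor \<open>1 + l\<close>, so the tilt
        contributes only its Laplace transform.\<close>
      have "simplex_normalise I (\<lambda>i\<in>I. z i / (1 + l)) = simplex_normalise I z" for z
        unfolding simplex_normalise_def using True
        by (auto simp: sum_divide_distrib[symmetric] fun_eq_iff restrict_def)
      then show ?thesis
        using gamma_prod_exp_tilt[OF I c True mN] True a by simp
    qed simp
  qed
  also have "\<dots> = ennreal (1 / a) * (\<integral>\<^sup>+z. ?N z \<partial>gamma_prod I c)"
    by (subst nn_integral_multc) (measurable, simp only: nn_integral_powr_tail[OF a(2)])
  also have "(\<integral>\<^sup>+z. ?N z \<partial>gamma_prod I c) = (\<integral>\<^sup>+v. f v \<partial>dirichlet_dist I c)"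
    unfolding dirichlet_dist_eq by (subst nn_integral_distr) auto
  finally show ?thesis .
qed

text \<open>In \<open>v i = z i / S\<close> the factor \<open>z i\<close> is absorbed by the gamma
  law at the price \<open>c i\<close> and raises the total shape to \<open>a + 1\<close>; for that
  shape the remaining factor \<open>1 / S\<close> is worth \<open>1 / a\<close>.\<close>

lemma dirichlet_dist_size_bias:
  assumes I: "finite I" "i \<in> I" and c: "\<And>j. j \<in> I \<Longrightarrow> 0 \<le> c j" and a: "(\<Sum>i\<in>I. c i) = a" "a > 0"
    and f[measurable]: "f \<in> borel_measurable (\<Pi>\<^sub>M i\<in>I. borel)"
  shows "(\<integral>\<^sup>+v. ennreal (v i) * f v \<partial>dirichlet_dist I c)
     = ennreal (c i / a) * (\<integral>\<^sup>+v. f v \<partial>dirichlet_dist I (c(i := c i + 1)))"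
proof -
  let ?N = "\<lambda>z. f (simplex_normalise I z)"
  have mN[measurable]: "?N \<in> borel_measurable (\<Pi>\<^sub>M i\<in>I. borel)" by measurable
  have [measurable]: "(\<lambda>z. z i) \<in> borel_measurable (\<Pi>\<^sub>M i\<in>I. borel)" using I by measurable
  have sum': "(\<Sum>j\<in>I. (c(i := c i + 1)) j) = a + 1"
  proof -
    have "(\<Sum>j\<in>I. (c(i := c i + 1)) j) = (\<Sum>j\<in>I. c j + (if j = i then 1 else 0))"
      by (intro sum.cong) auto
    then show ?thesis using I a by (simp add: sum.distrib)
  qed
  have ae: "AE z in gamma_prod I c. (\<forall>i\<in>I. 0 \<le> z i) \<and> 0 < (\<Sum>i\<in>I. z i)"
    by (rule AE_gamma_prod) (use I c a in auto)
  have "(\<integral>\<^sup>+v. ennreal (v i) * f v \<partial>dirichlet_dist I c)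
    = (\<integral>\<^sup>+z. ennreal (z i / (\<Sum>j\<in>I. z j)) * ?N z \<partial>gamma_prod I c)"
    unfolding dirichlet_dist_eq using I
    by (subst nn_integral_distr) (auto simp: simplex_normalise_def)
  also have "\<dots> = (\<integral>\<^sup>+z. ennreal (z i) * (ennreal (1 / (\<Sum>j\<in>I. z j)) * ?N z) \<partial>gamma_prod I c)"
    using ae I by (intro nn_integral_cong_AE) (auto simp: mult.assoc[symmetric] ennreal_mult[symmetric])
  also have "\<dots> = ennreal (c i) * (\<integral>\<^sup>+z. ennreal (1 / (\<Sum>j\<in>I. z j)) * ?N z \<partial>gamma_prod I (c(i := c i + 1)))"
    using I c by (intro gamma_prod_size_bias) auto
  also have "\<dots> = ennreal (c i) * (ennreal (1 / a) * (\<integral>\<^sup>+v. f v \<partial>dirichlet_dist I (c(i := c i + 1))))"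
    using I c[OF I(2)] c sum' a by (subst gamma_prod_inverse_total) auto
  finally show ?thesis
    using c[OF I(2)] a by (simp add: mult.assoc[symmetric] ennreal_mult[symmetric])
qed

section \<open>Beta distributions\<close>

lemma prob_space_beta_dist:
  assumes "b > 0" "c > 0" shows "prob_space (beta_dist b c)"
proof -
  have B: "Beta b c > 0" using assms by (simp add: Beta_def)
  have "((\<lambda>t. t powr (b - 1) * (1 - t) powr (c - 1) / Beta b c) has_integral Beta b c / Beta b c) {0..1}"
    using has_integral_Beta_real[OF assms] by (rule has_integral_divide)
  then have I: "((\<lambda>t. t powr (b - 1) * (1 - t) powr (c - 1) / Beta b c) has_integral 1) {0..1}"
    using B by simp
  have "(\<integral>\<^sup>+t. ennreal (indicator {0..1} t * (t powr (b - 1) * (1 - t) powr (c - 1) / Beta b c)) \<partial>lborel) = ennreal 1"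
    using I B by (intro nn_integral_has_integral_lebesgue) auto
  also have "(\<integral>\<^sup>+t. ennreal (indicator {0..1} t * (t powr (b - 1) * (1 - t) powr (c - 1) / Beta b c)) \<partial>lborel)
     = (\<integral>\<^sup>+x. ennreal (if 0 < x \<and> x < 1 then x powr (b - 1) * (1 - x) powr (c - 1) / Beta b c else 0) \<partial>lborel)"
    using AE_lborel_singleton[of "0::real"] AE_lborel_singleton[of "1::real"]
    by (intro nn_integral_cong_AE) (auto simp: indicator_def)
  finally show ?thesis
    unfolding beta_dist_def by (intro prob_spaceI) (simp add: emeasure_density)
qed

lemma sets_beta_dist [simp, measurable_cong]: "sets (beta_dist b c) = sets borel"
  by (simp add: beta_dist_def)

lemma space_beta_dist [simp]: "space (beta_dist b c) = UNIV"
  by (simp add: beta_dist_def)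

lemma AE_beta_dist: "AE t in beta_dist b c. 0 < t \<and> t < 1"
  unfolding beta_dist_def by (subst AE_density) auto

text \<open>The factors \<open>t\<close> and \<open>1 - t\<close> each raise one exponent of the
  density by one; the constants are the ratios of the corresponding beta functions.\<close>

lemma beta_dist_size_bias:
  assumes bc: "b > 0" "c > 0" and [measurable]: "f \<in> borel_measurable borel"
  shows "(\<integral>\<^sup>+t. ennreal t * f t \<partial>beta_dist b c) = ennreal (b / (b + c)) * (\<integral>\<^sup>+t. f t \<partial>beta_dist (b + 1) c)"
    and "(\<integral>\<^sup>+t. ennreal (1 - t) * f t \<partial>beta_dist b c) = ennreal (c / (b + c)) * (\<integral>\<^sup>+t. f t \<partial>beta_dist b (c + 1))"
proof -
  let ?d = "\<lambda>b c x. ennreal (if 0 < x \<and> x < 1 then x powr (b - 1) * (1 - x) powr (c - 1) / Beta b c else 0)"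
  have B: "Beta b c > 0" "Beta (b + 1) c > 0" "Beta b (c + 1) > 0" using bc by (simp_all add: Beta_def)
  have B1: "Beta (b + 1) c = b / (b + c) * Beta b c"
    using Beta_plus1_left[of b c] bc nonpos_Ints_nonpos[of b] by (force simp: field_simps)
  have B2: "Beta b (c + 1) = c / (b + c) * Beta b c"
    using Beta_plus1_right[of c b] bc nonpos_Ints_nonpos[of c] by (force simp: field_simps)
  have "?d b c t * (ennreal t * f t) = ennreal (b / (b + c)) * (?d (b + 1) c t * f t)" for t
  proof (cases "0 < t \<and> t < 1")
    case True
    have "t powr (b - 1) * t = t powr (b + 1 - 1)" using True by (simp add: powr_diff)
    then have "t powr (b - 1) * (1 - t) powr (c - 1) / Beta b c * t
        = t powr (b + 1 - 1) * (1 - t) powr (c - 1) / Beta b c"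
      by (metis times_divide_eq_left mult.assoc mult.commute)
    also have "\<dots> = b / (b + c) * (t powr (b + 1 - 1) * (1 - t) powr (c - 1) / Beta (b + 1) c)"
      unfolding B1 using bc by simp
    finally show ?thesis
      using True bc B by (simp only: if_True simp_thms) (rule ennreal_mult_regroup, auto)
  qed auto
  then show "(\<integral>\<^sup>+t. ennreal t * f t \<partial>beta_dist b c) = ennreal (b / (b + c)) * (\<integral>\<^sup>+t. f t \<partial>beta_dist (b + 1) c)"
    unfolding beta_dist_def by (simp add: nn_integral_density nn_integral_cmult)
  have "?d b c t * (ennreal (1 - t) * f t) = ennreal (c / (b + c)) * (?d b (c + 1) t * f t)" for t
  proof (cases "0 < t \<and> t < 1")
    case True
    have "(1 - t) powr (c - 1) * (1 - t) = (1 - t) powr (c + 1 - 1)" using True by (simp add: powr_diff)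
    then have "t powr (b - 1) * (1 - t) powr (c - 1) / Beta b c * (1 - t)
        = t powr (b - 1) * (1 - t) powr (c + 1 - 1) / Beta b c"
      by (metis times_divide_eq_left mult.assoc)
    also have "\<dots> = c / (b + c) * (t powr (b - 1) * (1 - t) powr (c + 1 - 1) / Beta b (c + 1))"
      unfolding B2 using bc by simp
    finally show ?thesis
      using True bc B by (simp only: if_True simp_thms) (rule ennreal_mult_regroup, auto)
  qed auto
  then show "(\<integral>\<^sup>+t. ennreal (1 - t) * f t \<partial>beta_dist b c) = ennreal (c / (b + c)) * (\<integral>\<^sup>+t. f t \<partial>beta_dist b (c + 1))"
    unfolding beta_dist_def by (simp add: nn_integral_density nn_integral_cmult)
qed

section \<open>Mixtures of Dirichlet distributions\<close>

text \<open>Almost surely the coordinates sum to one; inserting that sum under the integral and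
  size-biasing each term gives the mixture. This identity is what makes Dirichlet expectations
  harmonic for the urn.\<close>

lemma dirichlet_dist_mixture:
  assumes I: "finite I" and c: "\<And>j. j \<in> I \<Longrightarrow> 0 \<le> c j" and a: "(\<Sum>i\<in>I. c i) = a" "a > 0"
    and f[measurable]: "f \<in> borel_measurable (\<Pi>\<^sub>M i\<in>I. borel)"
  shows "(\<integral>\<^sup>+v. f v \<partial>dirichlet_dist I c)
     = (\<Sum>i\<in>I. ennreal (c i / a) * (\<integral>\<^sup>+v. f v \<partial>dirichlet_dist I (c(i := c i + 1))))"
proof -
  have ae: "AE v in dirichlet_dist I c. (\<forall>i\<in>I. v i \<in> {0..1}) \<and> (\<Sum>i\<in>I. v i) = 1"
    by (rule AE_dirichlet_dist) (use assms in auto)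
  have "(\<integral>\<^sup>+v. f v \<partial>dirichlet_dist I c) = (\<integral>\<^sup>+v. (\<Sum>i\<in>I. ennreal (v i) * f v) \<partial>dirichlet_dist I c)"
    using ae
  proof (intro nn_integral_cong_AE, eventually_elim)
    case (elim v)
    then have "(\<Sum>i\<in>I. ennreal (v i)) = 1" by (subst sum_ennreal) auto
    then show ?case by (simp add: sum_distrib_right[symmetric])
  qed
  also have "\<dots> = (\<Sum>i\<in>I. \<integral>\<^sup>+v. ennreal (v i) * f v \<partial>dirichlet_dist I c)"
    by (intro nn_integral_sum) measurable
  also have "\<dots> = (\<Sum>i\<in>I. ennreal (c i / a) * (\<integral>\<^sup>+v. f v \<partial>dirichlet_dist I (c(i := c i + 1))))"
    using assms by (intro sum.cong refl dirichlet_dist_size_bias) auto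
  finally show ?thesis .
qed

text \<open>The mass that the discrete measure with weights \<open>q i\<close> at points labelled
  \<open>y i\<close> puts on the label \<open>k\<close>; with all weights \<open>1\<close> it counts
  the points of that label.\<close>

definition label_sum :: "'i set \<Rightarrow> ('i \<Rightarrow> 'k) \<Rightarrow> ('i \<Rightarrow> real) \<Rightarrow> 'k \<Rightarrow> real" where
  "label_sum I y q k = (\<Sum>i\<in>I. if y i = k then q i else 0)"

lemma label_sum_nonneg: "(\<And>i. i \<in> I \<Longrightarrow> 0 \<le> q i) \<Longrightarrow> 0 \<le> label_sum I y q k"
  unfolding label_sum_def by (intro sum_nonneg) auto

lemma sum_label_sum:
  assumes "finite I" "finite K" "y ` I \<subseteq> K"
  shows "(\<Sum>k\<in>K. label_sum I y q k) = (\<Sum>i\<in>I. q i)"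
  unfolding label_sum_def using assms by (subst sum.swap) (auto intro!: sum.cong simp: sum.delta')

text \<open>A unit added to the weight of point \<open>i\<close> goes to the label of that point.
  This carries a size-bias shift of the weight parameter over to the parameter of the law on
  labels.\<close>

lemma label_sum_upd:
  assumes "finite I" "i \<in> I"
  shows "label_sum I y (q(i := q i + 1)) = (label_sum I y q)(y i := label_sum I y q (y i) + 1)"
proof
  fix k
  have "(\<Sum>j\<in>I. if y j = k then (q(i := q i + 1)) j else 0) = (\<Sum>j\<in>I. (if y j = k then q j else 0) + (if j = i \<and> y j = k then 1 else 0))"
    by (intro sum.cong) auto
  also have "\<dots> = (\<Sum>j\<in>I. if y j = k then q j else 0) + (\<Sum>j\<in>I. if j = i then (if y i = k then 1 else 0) else 0)"
    unfolding sum.distrib by (intro arg_cong2[where f="(+)"] sum.cong refl) auto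
  finally show "label_sum I y (q(i := q i + 1)) k = ((label_sum I y q)(y i := label_sum I y q (y i) + 1)) k"
    using assms by (auto simp: label_sum_def)
qed

lemma sum_upd_plus_1:
  fixes c :: "'i \<Rightarrow> real"
  assumes "finite I" "i \<in> I"
  shows "(\<Sum>j\<in>I. (c(i := c i + 1)) j) = (\<Sum>j\<in>I. c j) + 1"
proof -
  have "(\<Sum>j\<in>I. (c(i := c i + 1)) j) = (\<Sum>j\<in>I. c j + (if j = i then 1 else 0))"
    by (intro sum.cong) auto
  then show ?thesis using assms by (simp add: sum.distrib)
qed

text \<open>Both sides satisfy the same size-bias recursion in the degree of the monomial, with \<open>b\<close> and \<open>c\<close>
  varying; this replaces the beta-gamma algebra.\<close>

lemma beta_dirichlet_mixture_moments:
  fixes A :: "('k \<times> nat) set" and I :: "'i set"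
  assumes I: "finite I" and K: "finite K" and y: "y ` I \<subseteq> K" and A: "finite A" "fst ` A \<subseteq> K"
    and b: "\<And>i. i \<in> I \<Longrightarrow> 0 \<le> b i" "(\<Sum>i\<in>I. b i) > 0" and c: "\<And>k. k \<in> K \<Longrightarrow> 0 \<le> c k" "(\<Sum>k\<in>K. c k) > 0"
  shows "(\<integral>\<^sup>+t. (\<integral>\<^sup>+q. (\<integral>\<^sup>+v. ennreal (\<Prod>x\<in>A. t * label_sum I y q (fst x) + (1 - t) * v (fst x))
       \<partial>dirichlet_dist K c) \<partial>dirichlet_dist I b) \<partial>beta_dist (\<Sum>i\<in>I. b i) (\<Sum>k\<in>K. c k))
    = (\<integral>\<^sup>+v. ennreal (\<Prod>x\<in>A. v (fst x)) \<partial>dirichlet_dist K (\<lambda>k. c k + label_sum I y b k))"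
  using A b c
proof (induction A arbitrary: b c rule: finite_induct)
  case empty
  have nn: "0 \<le> c k + label_sum I y b k" if "k \<in> K" for k
    using empty that by (intro add_nonneg_nonneg label_sum_nonneg) auto
  interpret B: prob_space "beta_dist (\<Sum>i\<in>I. b i) (\<Sum>k\<in>K. c k)" by (rule prob_space_beta_dist) (use empty in auto)
  interpret b: prob_space "dirichlet_dist I b" by (rule prob_space_dirichlet_dist) (use empty in auto)
  interpret c: prob_space "dirichlet_dist K c" by (rule prob_space_dirichlet_dist) (use empty in auto)
  interpret bc: prob_space "dirichlet_dist K (\<lambda>k. c k + label_sum I y b k)" by (rule prob_space_dirichlet_dist) (rule nn)
  show ?case
    by (simp add: B.emeasure_space_1 b.emeasure_space_1 c.emeasure_space_1 bc.emeasure_space_1 del: space_beta_dist)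
next
  case (insert x A)
  define k where "k = fst x"
  have k: "k \<in> K" and AK: "fst ` A \<subseteq> K" using insert.prems by (auto simp: k_def)
  let ?X = "\<lambda>t q v k. t * label_sum I y q k + (1 - t) * v k"
  define g where "g = (\<lambda>(t, q, v). ennreal (\<Prod>x\<in>A. ?X t q v (fst x)))"
  let ?PI = "\<Pi>\<^sub>M i\<in>I. (borel :: real measure)" and ?PK = "\<Pi>\<^sub>M i\<in>K. (borel :: real measure)"
  have g[measurable]: "g \<in> borel_measurable (borel \<Otimes>\<^sub>M ?PI \<Otimes>\<^sub>M ?PK)"
  proof -
    have "(\<lambda>(t, q, v). ?X t q v (fst x)) \<in> borel_measurable (borel \<Otimes>\<^sub>M ?PI \<Otimes>\<^sub>M ?PK)" if "x \<in> A" for x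
    proof -
      have [simp]: "fst x \<in> K" using that AK by auto
      show ?thesis unfolding label_sum_def by measurable
    qed
    then have "(\<lambda>p. ennreal (\<Prod>x\<in>A. case p of (t, q, v) \<Rightarrow> ?X t q v (fst x))) \<in> borel_measurable (borel \<Otimes>\<^sub>M ?PI \<Otimes>\<^sub>M ?PK)"
      by measurable
    then show ?thesis unfolding g_def by (simp add: case_prod_unfold)
  qed
  \<comment> \<open>\<open>E\<close> keeps \<open>b\<close> and \<open>c\<close> as arguments, since
    the induction hypothesis is applied to parameters raised by one.\<close>
  define E where "E b c h = (\<integral>\<^sup>+t. (\<integral>\<^sup>+q. (\<integral>\<^sup>+v. h t q v \<partial>dirichlet_dist K c) \<partial>dirichlet_dist I b) \<partial>beta_dist (\<Sum>i\<in>I. b i) (\<Sum>k\<in>K. c k))"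
    for b c and h :: "real \<Rightarrow> ('i \<Rightarrow> real) \<Rightarrow> ('k \<Rightarrow> real) \<Rightarrow> ennreal"
  define D where "D c = (\<integral>\<^sup>+v. ennreal (\<Prod>x\<in>A. v (fst x)) \<partial>dirichlet_dist K c)" for c
  define bs where "bs = (\<Sum>i\<in>I. b i)"
  define cs where "cs = (\<Sum>k\<in>K. c k)"
  have pos: "bs > 0" "cs > 0" using insert.prems by (auto simp: bs_def cs_def)
  have IH: "E b c (\<lambda>t q v. g (t, q, v)) = D (\<lambda>k. c k + label_sum I y b k)"
    if "\<And>i. i \<in> I \<Longrightarrow> 0 \<le> b i" "(\<Sum>i\<in>I. b i) > 0" "\<And>k. k \<in> K \<Longrightarrow> 0 \<le> c k" "(\<Sum>k\<in>K. c k) > 0" for b c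
    unfolding E_def D_def g_def prod.case by (rule insert.IH[OF AK that]) 
  have sig: "sigma_finite_measure (dirichlet_dist I b)" "sigma_finite_measure (dirichlet_dist K c)"
    if "\<And>i. i \<in> I \<Longrightarrow> 0 \<le> b i" "\<And>k. k \<in> K \<Longrightarrow> 0 \<le> c k" for b :: "'i \<Rightarrow> real" and c :: "'k \<Rightarrow> real"
    by (intro prob_space_imp_sigma_finite prob_space_dirichlet_dist that; simp)+
  interpret b: sigma_finite_measure "dirichlet_dist I b" by (rule sig(1)[of b c]) (use insert.prems in auto)
  interpret c: sigma_finite_measure "dirichlet_dist K c" by (rule sig(2)[of b c]) (use insert.prems in auto)
  have comp[measurable]: "(\<lambda>v. v k) \<in> borel_measurable ?PK" using k by measurable
  have aeI: "AE q in dirichlet_dist I b. \<forall>i\<in>I. 0 \<le> q i"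
    using AE_dirichlet_dist[of I b] I insert.prems by auto
  have aeK: "AE v in dirichlet_dist K c. \<forall>k\<in>K. 0 \<le> v k"
    using AE_dirichlet_dist[of K c] K insert.prems by auto
  \<comment> \<open>One factor of the monomial is split off and written as a sum of terms carrying
    either \<open>t * q i\<close> or \<open>(1 - t) * v k\<close>; each such term is a pair of
    size-bias factors.\<close>
  have "E b c (\<lambda>t q v. ennreal (\<Prod>x\<in>insert x A. ?X t q v (fst x)))
    = E b c (\<lambda>t q v. (\<Sum>i\<in>I. if y i = k then ennreal t * (ennreal (q i) * g (t, q, v)) else 0) + ennreal (1 - t) * (ennreal (v k) * g (t, q, v)))"
    unfolding E_def using AE_beta_dist
  proof (intro nn_integral_cong_AE, eventually_elim)
    case t: (elim t)
    show ?case using aeI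
    proof (intro nn_integral_cong_AE, eventually_elim)
      case q: (elim q)
      show ?case using aeK
      proof (intro nn_integral_cong_AE, eventually_elim)
        case v: (elim v)
        have "(\<Prod>x\<in>insert x A. ?X t q v (fst x)) = ?X t q v k * (\<Prod>x\<in>A. ?X t q v (fst x))"
          using insert.hyps by (simp add: k_def)
        moreover have "0 \<le> ?X t q v (fst x)" if "x \<in> A" for x
          using t q v AK that by (auto intro!: add_nonneg_nonneg mult_nonneg_nonneg label_sum_nonneg)
        ultimately have "ennreal (\<Prod>x\<in>insert x A. ?X t q v (fst x)) = ennreal (?X t q v k) * g (t, q, v)"
          unfolding g_def by (simp add: ennreal_mult'' prod_nonneg)
        also have "ennreal (?X t q v k) = ennreal (t * label_sum I y q k) + ennreal ((1 - t) * v k)"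
          using t q v k by (intro ennreal_plus mult_nonneg_nonneg label_sum_nonneg) auto
        also have "ennreal (t * label_sum I y q k) = (\<Sum>i\<in>I. if y i = k then ennreal t * ennreal (q i) else 0)"
          unfolding label_sum_def sum_distrib_left using t q
          by (subst sum_ennreal[symmetric]) (auto intro!: sum.cong simp: ennreal_mult)
        also have "ennreal ((1 - t) * v k) = ennreal (1 - t) * ennreal (v k)"
          using t v k by (intro ennreal_mult) auto
        finally show ?case
          by (simp add: distrib_right sum_distrib_right mult.assoc if_distrib[where f="\<lambda>z. z * _"] cong: if_cong)
      qed
    qed
  qed
  also have "\<dots> = (\<Sum>i\<in>I. if y i = k then E b c (\<lambda>t q v. ennreal t * (ennreal (q i) * g (t, q, v))) else 0)
     + E b c (\<lambda>t q v. ennreal (1 - t) * (ennreal (v k) * g (t, q, v)))"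
  proof -
    have 1: "E b c (\<lambda>t q v. h (t, q, v) + h' (t, q, v)) = E b c (\<lambda>t q v. h (t, q, v)) + E b c (\<lambda>t q v. h' (t, q, v))"
      if [measurable]: "h \<in> borel_measurable (borel \<Otimes>\<^sub>M ?PI \<Otimes>\<^sub>M ?PK)"
        "h' \<in> borel_measurable (borel \<Otimes>\<^sub>M ?PI \<Otimes>\<^sub>M ?PK)" for h h'
    proof -
      have "(\<integral>\<^sup>+v. h (t, q, v) + h' (t, q, v) \<partial>dirichlet_dist K c) = (\<integral>\<^sup>+v. h (t, q, v) \<partial>dirichlet_dist K c) + (\<integral>\<^sup>+v. h' (t, q, v) \<partial>dirichlet_dist K c)"
        if [simp]: "q \<in> space ?PI" for t q
        by (intro nn_integral_add) measurable
      then have "E b c (\<lambda>t q v. h (t, q, v) + h' (t, q, v)) = (\<integral>\<^sup>+t. (\<integral>\<^sup>+q. (\<integral>\<^sup>+v. h (t, q, v) \<partial>dirichlet_dist K c) + (\<integral>\<^sup>+v. h' (t, q, v) \<partial>dirichlet_dist K c) \<partial>dirichlet_dist I b) \<partial>beta_dist (\<Sum>i\<in>I. b i) (\<Sum>k\<in>K. c k))"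
        unfolding E_def by (intro nn_integral_cong) (simp add: space_dirichlet_dist)
      also have "\<dots> = (\<integral>\<^sup>+t. (\<integral>\<^sup>+q. (\<integral>\<^sup>+v. h (t, q, v) \<partial>dirichlet_dist K c) \<partial>dirichlet_dist I b) + (\<integral>\<^sup>+q. (\<integral>\<^sup>+v. h' (t, q, v) \<partial>dirichlet_dist K c) \<partial>dirichlet_dist I b) \<partial>beta_dist (\<Sum>i\<in>I. b i) (\<Sum>k\<in>K. c k))"
        by (intro nn_integral_cong nn_integral_add) measurable
      also have "\<dots> = E b c (\<lambda>t q v. h (t, q, v)) + E b c (\<lambda>t q v. h' (t, q, v))"
        unfolding E_def by (intro nn_integral_add) measurable
      finally show ?thesis .
    qed
    have m: "(\<lambda>(t, q, v). ennreal t * (ennreal (q i) * g (t, q, v))) \<in> borel_measurable (borel \<Otimes>\<^sub>M ?PI \<Otimes>\<^sub>M ?PK)" if "i \<in> I" for i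
      using that by measurable
    have m': "(\<lambda>(t, q, v). if y i = k then ennreal t * (ennreal (q i) * g (t, q, v)) else 0) \<in> borel_measurable (borel \<Otimes>\<^sub>M ?PI \<Otimes>\<^sub>M ?PK)" if "i \<in> I" for i
      using m[OF that] by (cases "y i = k") auto
    have "E b c (\<lambda>t q v. \<Sum>i\<in>I'. if y i = k then ennreal t * (ennreal (q i) * g (t, q, v)) else 0)
       = (\<Sum>i\<in>I'. if y i = k then E b c (\<lambda>t q v. ennreal t * (ennreal (q i) * g (t, q, v))) else 0)" if "I' \<subseteq> I" for I'
      using finite_subset[OF that I] that
    proof (induction I' rule: finite_induct)
      case (insert i J)
      have "(\<lambda>(t, q, v). \<Sum>i\<in>J. if y i = k then ennreal t * (ennreal (q i) * g (t, q, v)) else 0) \<in> borel_measurable (borel \<Otimes>\<^sub>M ?PI \<Otimes>\<^sub>M ?PK)"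
        using insert.prems m' unfolding case_prod_unfold by (intro borel_measurable_sum) auto
      moreover have "E b c (\<lambda>t q v. if y i = k then ennreal t * (ennreal (q i) * g (t, q, v)) else 0)
         = (if y i = k then E b c (\<lambda>t q v. ennreal t * (ennreal (q i) * g (t, q, v))) else 0)"
        by (simp add: E_def)
      ultimately show ?case 
        using insert 1[OF m'[of i], of "\<lambda>(t, q, v). \<Sum>i\<in>J. if y i = k then ennreal t * (ennreal (q i) * g (t, q, v)) else 0"]
        by simp
    qed (simp add: E_def)
    moreover have "(\<lambda>(t, q, v). \<Sum>i\<in>I. if y i = k then ennreal t * (ennreal (q i) * g (t, q, v)) else 0) \<in> borel_measurable (borel \<Otimes>\<^sub>M ?PI \<Otimes>\<^sub>M ?PK)"
      using m' unfolding case_prod_unfold by (intro borel_measurable_sum) auto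
    moreover have "(\<lambda>(t, q, v). ennreal (1 - t) * (ennreal (v k) * g (t, q, v))) \<in> borel_measurable (borel \<Otimes>\<^sub>M ?PI \<Otimes>\<^sub>M ?PK)"
      by measurable
    ultimately show ?thesis using 1[of "\<lambda>(t, q, v). \<Sum>i\<in>I. if y i = k then ennreal t * (ennreal (q i) * g (t, q, v)) else 0"
      "\<lambda>(t, q, v). ennreal (1 - t) * (ennreal (v k) * g (t, q, v))"] by simp
  qed
  \<comment> \<open>\<open>q i\<close> raises \<open>b i\<close> with constant
    \<open>b i / bs\<close>, and \<open>t\<close> raises the first beta parameter with constant
    \<open>bs / (bs + cs)\<close>. The beta parameter is again the total of the raised
    \<open>b\<close>, so the induction hypothesis applies.\<close>
  also have "(\<Sum>i\<in>I. if y i = k then E b c (\<lambda>t q v. ennreal t * (ennreal (q i) * g (t, q, v))) else 0)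
     = (\<Sum>i\<in>I. if y i = k then ennreal (b i / (bs + cs)) * D ((\<lambda>k. c k + label_sum I y b k)(k := c k + label_sum I y b k + 1)) else 0)"
  proof (intro sum.cong refl if_cong)
    fix i assume i: "i \<in> I" "y i = k"
    let ?b = "b(i := b i + 1)"
    have b': "0 \<le> ?b j" if "j \<in> I" for j using insert.prems that by auto
    have [measurable]: "(\<lambda>q. q i) \<in> borel_measurable ?PI" using i by measurable
    interpret b': sigma_finite_measure "dirichlet_dist I ?b" by (rule sig(1)[of ?b c]) (use insert.prems b' in auto)
    have "E b c (\<lambda>t q v. ennreal t * (ennreal (q i) * g (t, q, v))) =
       (\<integral>\<^sup>+t. ennreal t * (\<integral>\<^sup>+q. ennreal (q i) * (\<integral>\<^sup>+v. g (t, q, v) \<partial>dirichlet_dist K c) \<partial>dirichlet_dist I b) \<partial>beta_dist bs cs)"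
      unfolding E_def bs_def cs_def
    proof (intro nn_integral_cong)
      fix t :: real
      have "(\<integral>\<^sup>+v. ennreal t * (ennreal (q i) * g (t, q, v)) \<partial>dirichlet_dist K c)
         = ennreal t * (ennreal (q i) * (\<integral>\<^sup>+v. g (t, q, v) \<partial>dirichlet_dist K c))" if [simp]: "q \<in> space ?PI" for q
      proof -
        have [measurable]: "(\<lambda>v. g (t, q, v)) \<in> borel_measurable ?PK" by measurable
        show ?thesis by (simp add: nn_integral_cmult)
      qed
      then have "(\<integral>\<^sup>+q. (\<integral>\<^sup>+v. ennreal t * (ennreal (q i) * g (t, q, v)) \<partial>dirichlet_dist K c) \<partial>dirichlet_dist I b)
         = (\<integral>\<^sup>+q. ennreal t * (ennreal (q i) * (\<integral>\<^sup>+v. g (t, q, v) \<partial>dirichlet_dist K c)) \<partial>dirichlet_dist I b)"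
        by (intro nn_integral_cong) (simp add: space_dirichlet_dist)
      also have "\<dots> = ennreal t * (\<integral>\<^sup>+q. ennreal (q i) * (\<integral>\<^sup>+v. g (t, q, v) \<partial>dirichlet_dist K c) \<partial>dirichlet_dist I b)"
        by (intro nn_integral_cmult) measurable
      finally show "(\<integral>\<^sup>+q. (\<integral>\<^sup>+v. ennreal t * (ennreal (q i) * g (t, q, v)) \<partial>dirichlet_dist K c) \<partial>dirichlet_dist I b)
         = ennreal t * (\<integral>\<^sup>+q. ennreal (q i) * (\<integral>\<^sup>+v. g (t, q, v) \<partial>dirichlet_dist K c) \<partial>dirichlet_dist I b)" .
    qed
    also have "\<dots> = (\<integral>\<^sup>+t. ennreal t * (ennreal (b i / bs) * (\<integral>\<^sup>+q. (\<integral>\<^sup>+v. g (t, q, v) \<partial>dirichlet_dist K c) \<partial>dirichlet_dist I ?b)) \<partial>beta_dist bs cs)"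
      using I i insert.prems by (intro nn_integral_cong arg_cong2[where f="(*)"] refl dirichlet_dist_size_bias) (auto simp: bs_def)
    also have "\<dots> = ennreal (b i / bs) * (\<integral>\<^sup>+t. ennreal t * (\<integral>\<^sup>+q. (\<integral>\<^sup>+v. g (t, q, v) \<partial>dirichlet_dist K c) \<partial>dirichlet_dist I ?b) \<partial>beta_dist bs cs)"
    proof -
      have F: "(\<lambda>t. ennreal t * (\<integral>\<^sup>+q. (\<integral>\<^sup>+v. g (t, q, v) \<partial>dirichlet_dist K c) \<partial>dirichlet_dist I ?b)) \<in> borel_measurable (beta_dist bs cs)"
      proof -
        have "(\<lambda>(t, q). \<integral>\<^sup>+v. g (t, q, v) \<partial>dirichlet_dist K c) \<in> borel_measurable (borel \<Otimes>\<^sub>M dirichlet_dist I ?b)"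
          by measurable
        from b'.borel_measurable_nn_integral[OF this]
        have m: "(\<lambda>t. \<integral>\<^sup>+q. (\<integral>\<^sup>+v. g (t, q, v) \<partial>dirichlet_dist K c) \<partial>dirichlet_dist I ?b) \<in> borel_measurable borel"
          by simp
        have e: "(\<lambda>t. ennreal t) \<in> borel_measurable borel" "(\<lambda>t. ennreal (1 - t)) \<in> borel_measurable borel"
          by measurable
        show ?thesis
          using borel_measurable_times_ennreal[OF e(1) m] borel_measurable_times_ennreal[OF e(2) m]
          by (simp cong: measurable_cong_sets)
      qed
      have "(\<integral>\<^sup>+t. ennreal t * (ennreal (b i / bs) * (\<integral>\<^sup>+q. (\<integral>\<^sup>+v. g (t, q, v) \<partial>dirichlet_dist K c) \<partial>dirichlet_dist I ?b)) \<partial>beta_dist bs cs)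
        = (\<integral>\<^sup>+t. ennreal (b i / bs) * (ennreal t * (\<integral>\<^sup>+q. (\<integral>\<^sup>+v. g (t, q, v) \<partial>dirichlet_dist K c) \<partial>dirichlet_dist I ?b)) \<partial>beta_dist bs cs)"
        by (intro nn_integral_cong mult.left_commute)
      then show ?thesis unfolding nn_integral_cmult[OF F] .
    qed
    also have "\<dots> = ennreal (b i / bs) * (ennreal (bs / (bs + cs)) * (\<integral>\<^sup>+t. (\<integral>\<^sup>+q. (\<integral>\<^sup>+v. g (t, q, v) \<partial>dirichlet_dist K c) \<partial>dirichlet_dist I ?b) \<partial>beta_dist (bs + 1) cs))"
      using pos by (subst beta_dist_size_bias(1)) auto
    also have "(\<integral>\<^sup>+t. (\<integral>\<^sup>+q. (\<integral>\<^sup>+v. g (t, q, v) \<partial>dirichlet_dist K c) \<partial>dirichlet_dist I ?b) \<partial>beta_dist (bs + 1) cs) = E ?b c (\<lambda>t q v. g (t, q, v))"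
      unfolding E_def sum_upd_plus_1[OF I i(1)] bs_def cs_def ..
    also have "E ?b c (\<lambda>t q v. g (t, q, v)) = D (\<lambda>k. c k + label_sum I y ?b k)"
      using b' insert.prems sum_upd_plus_1[OF I i(1), of b] pos by (intro IH) (auto simp: bs_def)
    also have "(\<lambda>k. c k + label_sum I y ?b k) = (\<lambda>k. c k + label_sum I y b k)(k := c k + label_sum I y b k + 1)"
      unfolding label_sum_upd[OF I i(1)] using i by auto
    also have "ennreal (b i / bs) * (ennreal (bs / (bs + cs)) * F) = ennreal (b i / (bs + cs)) * F" for F
      using pos insert.prems(2)[OF i(1)] by (simp add: mult.assoc[symmetric] ennreal_mult[symmetric])
    finally show "E b c (\<lambda>t q v. ennreal t * (ennreal (q i) * g (t, q, v))) =
        ennreal (b i / (bs + cs)) * D ((\<lambda>k. c k + label_sum I y b k)(k := c k + label_sum I y b k + 1))" .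
  qed
  \<comment> \<open>The mirror image: \<open>v k\<close> raises \<open>c k\<close> and
    \<open>1 - t\<close> raises the second beta parameter. Both kinds of terms end at the same
    raised target parameter.\<close>
  also have "E b c (\<lambda>t q v. ennreal (1 - t) * (ennreal (v k) * g (t, q, v)))
     = ennreal (c k / (bs + cs)) * D ((\<lambda>k. c k + label_sum I y b k)(k := c k + label_sum I y b k + 1))"
  proof -
    let ?c = "c(k := c k + 1)"
    have c': "0 \<le> ?c j" if "j \<in> K" for j using insert.prems that by auto
    interpret c': sigma_finite_measure "dirichlet_dist K ?c" by (rule sig(2)[of b ?c]) (use insert.prems c' in auto)
    have "E b c (\<lambda>t q v. ennreal (1 - t) * (ennreal (v k) * g (t, q, v))) =
       (\<integral>\<^sup>+t. ennreal (1 - t) * (\<integral>\<^sup>+q. (\<integral>\<^sup>+v. ennreal (v k) * g (t, q, v) \<partial>dirichlet_dist K c) \<partial>dirichlet_dist I b) \<partial>beta_dist bs cs)"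
      unfolding E_def bs_def cs_def
    proof (intro nn_integral_cong)
      fix t :: real
      have "(\<integral>\<^sup>+v. ennreal (1 - t) * (ennreal (v k) * g (t, q, v)) \<partial>dirichlet_dist K c)
         = ennreal (1 - t) * (\<integral>\<^sup>+v. ennreal (v k) * g (t, q, v) \<partial>dirichlet_dist K c)" if [simp]: "q \<in> space ?PI" for q
      proof -
        have [measurable]: "(\<lambda>v. g (t, q, v)) \<in> borel_measurable ?PK" by measurable
        show ?thesis by (simp add: nn_integral_cmult)
      qed
      then have "(\<integral>\<^sup>+q. (\<integral>\<^sup>+v. ennreal (1 - t) * (ennreal (v k) * g (t, q, v)) \<partial>dirichlet_dist K c) \<partial>dirichlet_dist I b)
         = (\<integral>\<^sup>+q. ennreal (1 - t) * (\<integral>\<^sup>+v. ennreal (v k) * g (t, q, v) \<partial>dirichlet_dist K c) \<partial>dirichlet_dist I b)"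
        by (intro nn_integral_cong) (simp add: space_dirichlet_dist)
      also have "\<dots> = ennreal (1 - t) * (\<integral>\<^sup>+q. (\<integral>\<^sup>+v. ennreal (v k) * g (t, q, v) \<partial>dirichlet_dist K c) \<partial>dirichlet_dist I b)"
        by (intro nn_integral_cmult) measurable
      finally show "(\<integral>\<^sup>+q. (\<integral>\<^sup>+v. ennreal (1 - t) * (ennreal (v k) * g (t, q, v)) \<partial>dirichlet_dist K c) \<partial>dirichlet_dist I b)
         = ennreal (1 - t) * (\<integral>\<^sup>+q. (\<integral>\<^sup>+v. ennreal (v k) * g (t, q, v) \<partial>dirichlet_dist K c) \<partial>dirichlet_dist I b)" .
    qed
    also have "\<dots> = (\<integral>\<^sup>+t. ennreal (1 - t) * (\<integral>\<^sup>+q. ennreal (c k / cs) * (\<integral>\<^sup>+v. g (t, q, v) \<partial>dirichlet_dist K ?c) \<partial>dirichlet_dist I b) \<partial>beta_dist bs cs)"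
    proof (intro nn_integral_cong arg_cong2[where f="(*)"] refl)
      fix t q assume q: "q \<in> space (dirichlet_dist I b)"
      have "(\<lambda>v. g (t, q, v)) \<in> borel_measurable ?PK" using q unfolding space_dirichlet_dist by measurable
      then show "(\<integral>\<^sup>+v. ennreal (v k) * g (t, q, v) \<partial>dirichlet_dist K c) = ennreal (c k / cs) * (\<integral>\<^sup>+v. g (t, q, v) \<partial>dirichlet_dist K ?c)"
        using K k insert.prems by (intro dirichlet_dist_size_bias) (auto simp: cs_def)
    qed
    also have "\<dots> = ennreal (c k / cs) * (\<integral>\<^sup>+t. ennreal (1 - t) * (\<integral>\<^sup>+q. (\<integral>\<^sup>+v. g (t, q, v) \<partial>dirichlet_dist K ?c) \<partial>dirichlet_dist I b) \<partial>beta_dist bs cs)"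
    proof -
      have F: "(\<lambda>t. ennreal (1 - t) * (\<integral>\<^sup>+q. (\<integral>\<^sup>+v. g (t, q, v) \<partial>dirichlet_dist K ?c) \<partial>dirichlet_dist I b)) \<in> borel_measurable (beta_dist bs cs)"
      proof -
        have "(\<lambda>(t, q). \<integral>\<^sup>+v. g (t, q, v) \<partial>dirichlet_dist K ?c) \<in> borel_measurable (borel \<Otimes>\<^sub>M dirichlet_dist I b)"
          by measurable
        from b.borel_measurable_nn_integral[OF this]
        have m: "(\<lambda>t. \<integral>\<^sup>+q. (\<integral>\<^sup>+v. g (t, q, v) \<partial>dirichlet_dist K ?c) \<partial>dirichlet_dist I b) \<in> borel_measurable borel"
          by simp
        have e: "(\<lambda>t. ennreal t) \<in> borel_measurable borel" "(\<lambda>t. ennreal (1 - t)) \<in> borel_measurable borel"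
          by measurable
        show ?thesis
          using borel_measurable_times_ennreal[OF e(1) m] borel_measurable_times_ennreal[OF e(2) m]
          by (simp cong: measurable_cong_sets)
      qed
      have "(\<integral>\<^sup>+q. ennreal (c k / cs) * (\<integral>\<^sup>+v. g (t, q, v) \<partial>dirichlet_dist K ?c) \<partial>dirichlet_dist I b)
        = ennreal (c k / cs) * (\<integral>\<^sup>+q. (\<integral>\<^sup>+v. g (t, q, v) \<partial>dirichlet_dist K ?c) \<partial>dirichlet_dist I b)" for t
        by (rule nn_integral_cmult) measurable
      then have "(\<integral>\<^sup>+t. ennreal (1 - t) * (\<integral>\<^sup>+q. ennreal (c k / cs) * (\<integral>\<^sup>+v. g (t, q, v) \<partial>dirichlet_dist K ?c) \<partial>dirichlet_dist I b) \<partial>beta_dist bs cs)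
        = (\<integral>\<^sup>+t. ennreal (c k / cs) * (ennreal (1 - t) * (\<integral>\<^sup>+q. (\<integral>\<^sup>+v. g (t, q, v) \<partial>dirichlet_dist K ?c) \<partial>dirichlet_dist I b)) \<partial>beta_dist bs cs)"
        by (simp only:) (intro nn_integral_cong mult.left_commute)
      then show ?thesis unfolding nn_integral_cmult[OF F] .
    qed
    also have "\<dots> = ennreal (c k / cs) * (ennreal (cs / (bs + cs)) * (\<integral>\<^sup>+t. (\<integral>\<^sup>+q. (\<integral>\<^sup>+v. g (t, q, v) \<partial>dirichlet_dist K ?c) \<partial>dirichlet_dist I b) \<partial>beta_dist bs (cs + 1)))"
      using pos by (subst beta_dist_size_bias(2)) auto
    also have "(\<integral>\<^sup>+t. (\<integral>\<^sup>+q. (\<integral>\<^sup>+v. g (t, q, v) \<partial>dirichlet_dist K ?c) \<partial>dirichlet_dist I b) \<partial>beta_dist bs (cs + 1)) = E b ?c (\<lambda>t q v. g (t, q, v))"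
      unfolding E_def sum_upd_plus_1[OF K k] bs_def cs_def ..
    also have "E b ?c (\<lambda>t q v. g (t, q, v)) = D (\<lambda>k. ?c k + label_sum I y b k)"
      using c' insert.prems sum_upd_plus_1[OF K k, of c] pos by (intro IH) (auto simp: cs_def)
    also have "(\<lambda>k. ?c k + label_sum I y b k) = (\<lambda>k. c k + label_sum I y b k)(k := c k + label_sum I y b k + 1)"
      by auto
    also have "ennreal (c k / cs) * (ennreal (cs / (bs + cs)) * F) = ennreal (c k / (bs + cs)) * F" for F
      using pos insert.prems(4)[OF k] by (simp add: mult.assoc[symmetric] ennreal_mult[symmetric])
    finally show ?thesis .
  qed
  \<comment> \<open>The constants add up to the size-bias constant of the target law at coordinate
    \<open>k\<close>, whose parameters total \<open>bs + cs\<close>.\<close>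
  also have "(\<Sum>i\<in>I. if y i = k then ennreal (b i / (bs + cs)) * F else 0) + ennreal (c k / (bs + cs)) * F
     = ennreal ((c k + label_sum I y b k) / (bs + cs)) * F" for F
  proof -
    have "(\<Sum>i\<in>I. if y i = k then ennreal (b i / (bs + cs)) * F else 0) = ennreal (label_sum I y b k / (bs + cs)) * F"
    proof -
      have "ennreal (label_sum I y b k / (bs + cs)) = (\<Sum>i\<in>I. ennreal ((if y i = k then b i else 0) / (bs + cs)))"
        unfolding label_sum_def sum_divide_distrib using insert.prems pos by (intro sum_ennreal[symmetric]) auto
      then show ?thesis by (auto simp: sum_distrib_right intro!: sum.cong)
    qed
    moreover have "label_sum I y b k \<ge> 0" using insert.prems by (intro label_sum_nonneg) auto
    ultimately show ?thesis
      using pos insert.prems(4)[OF k] by (simp add: add_divide_distrib distrib_right add.commute)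
  qed
  \<comment> \<open>The size-bias identity of the target law, read backwards, restores the split-off
    factor as \<open>v k\<close>.\<close>
  also have "ennreal ((c k + label_sum I y b k) / (bs + cs)) * D ((\<lambda>k. c k + label_sum I y b k)(k := c k + label_sum I y b k + 1))
     = (\<integral>\<^sup>+v. ennreal (v k) * ennreal (\<Prod>x\<in>A. v (fst x)) \<partial>dirichlet_dist K (\<lambda>k. c k + label_sum I y b k))"
    unfolding D_def
  proof (rule dirichlet_dist_size_bias[symmetric, OF K k])
    show "0 \<le> c k + label_sum I y b k" if "k \<in> K" for k
      using insert.prems that by (intro add_nonneg_nonneg label_sum_nonneg) auto
    show "(\<Sum>k\<in>K. c k + label_sum I y b k) = bs + cs"
      using sum_label_sum[OF I K y] by (simp add: sum.distrib bs_def cs_def)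
    show "bs + cs > 0" using pos by simp
    have "x \<in> A \<Longrightarrow> fst x \<in> K" for x using AK by auto
    then show "(\<lambda>v. ennreal (\<Prod>x\<in>A. v (fst x))) \<in> borel_measurable ?PK" by measurable
  qed
  also have "\<dots> = (\<integral>\<^sup>+v. ennreal (\<Prod>x\<in>insert x A. v (fst x)) \<partial>dirichlet_dist K (\<lambda>k. c k + label_sum I y b k))"
  proof (intro nn_integral_cong_AE)
    have nn: "0 \<le> c k + label_sum I y b k" if "k \<in> K" for k
      using insert.prems that by (intro add_nonneg_nonneg label_sum_nonneg) auto
    have "(\<Sum>k\<in>K. c k + label_sum I y b k) = bs + cs"
      using sum_label_sum[OF I K y] by (simp add: sum.distrib bs_def cs_def)
    then have "AE v in dirichlet_dist K (\<lambda>k. c k + label_sum I y b k). (\<forall>k\<in>K. v k \<in> {0..1}) \<and> (\<Sum>k\<in>K. v k) = 1"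
      using K nn pos by (intro AE_dirichlet_dist) auto
    then show "AE v in dirichlet_dist K (\<lambda>k. c k + label_sum I y b k). ennreal (v k) * ennreal (\<Prod>x\<in>A. v (fst x)) = ennreal (\<Prod>x\<in>insert x A. v (fst x))"
      by eventually_elim (use k insert.hyps in \<open>simp add: k_def[symmetric] ennreal_mult'\<close>)
  qed
  finally show ?case unfolding E_def .
qed

section \<open>The urn martingales of a Polya sequence\<close>

lemma subalgebra_generated_algebra:
  assumes "\<And>i. i \<in> I \<Longrightarrow> X i \<in> M \<rightarrow>\<^sub>M S"
  shows "subalgebra M (generated_algebra M I S X)"
proof -
  have "(\<lambda>\<omega>. \<lambda>i\<in>I. X i \<omega>) \<in> M \<rightarrow>\<^sub>M (\<Pi>\<^sub>M i\<in>I. S)"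
    using assms by (intro measurable_restrict)
  then show ?thesis
    unfolding subalgebra_def generated_algebra_def
    by (subst sets_vimage_algebra2) (auto intro: measurable_sets dest: measurable_space)
qed

lemma measurable_generated_algebra:
  assumes "\<And>i. i \<in> I \<Longrightarrow> X i \<in> M \<rightarrow>\<^sub>M S" and "i \<in> I"
  shows "X i \<in> generated_algebra M I S X \<rightarrow>\<^sub>M S"
proof -
  have "(\<lambda>\<omega>. \<lambda>i\<in>I. X i \<omega>) \<in> space M \<rightarrow> space (\<Pi>\<^sub>M i\<in>I. S)"
    using assms(1) measurable_space[of "X _" M S] by (auto simp: space_PiM)
  then have "(\<lambda>\<omega>. \<lambda>i\<in>I. X i \<omega>) \<in> generated_algebra M I S X \<rightarrow>\<^sub>M (\<Pi>\<^sub>M i\<in>I. S)"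
    unfolding generated_algebra_def by (rule measurable_vimage_algebra1)
  from measurable_compose[OF this measurable_component_singleton[OF assms(2)]] assms(2)
  show ?thesis by simp
qed

text \<open>\<open>\<Phi>\<close> is an arbitrary function; measurability comes from the labels
  taking only countably many values. The induction absorbs the last label into
  \<open>c\<close>.\<close>

lemma measurable_label_counts:
  fixes \<kappa> :: "'w \<Rightarrow> nat \<Rightarrow> nat" and \<Phi> :: "(nat \<Rightarrow> real) \<Rightarrow> real"
  assumes "\<And>i. i \<in> {1..m} \<Longrightarrow> (\<lambda>\<omega>. \<kappa> \<omega> i) \<in> F \<rightarrow>\<^sub>M count_space UNIV"
  shows "(\<lambda>\<omega>. \<Phi> (\<lambda>k. c k + label_sum {1..m} (\<kappa> \<omega>) (\<lambda>_. 1) k)) \<in> borel_measurable F"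
  using assms
proof (induction m arbitrary: c)
  case 0
  then show ?case by (simp add: label_sum_def)
next
  case (Suc m)
  have eq: "(\<lambda>k. c k + label_sum {1..Suc m} (\<kappa> \<omega>) (\<lambda>_. 1) k)
     = (\<lambda>k. (c(\<kappa> \<omega> (Suc m) := c (\<kappa> \<omega> (Suc m)) + 1)) k + label_sum {1..m} (\<kappa> \<omega>) (\<lambda>_. 1) k)" for \<omega>
    by (auto simp: fun_eq_iff label_sum_def)
  have "(\<lambda>\<omega>. (\<lambda>j \<omega>. \<Phi> (\<lambda>k. (c(j := c j + 1)) k + label_sum {1..m} (\<kappa> \<omega>) (\<lambda>_. 1) k)) (\<kappa> \<omega> (Suc m)) \<omega>) \<in> borel_measurable F"
    by (rule measurable_compose_countable) (use Suc in auto)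
  then show ?case unfolding eq by simp
qed

text \<open>The urn property: along a P\'olya sequence, functions of the updated parameter that satisfy
  the Dirichlet mixture identity are martingales.\<close>

lemma polya_sequence_harmonic:
  fixes \<Phi> :: "(nat \<Rightarrow> real) \<Rightarrow> real" and \<alpha> :: "'a::polish_space measure"
  assumes Z: "polya_sequence N \<alpha> Z" and K: "finite K" and \<kappa>: "\<kappa> \<in> borel \<rightarrow>\<^sub>M count_space UNIV" "range \<kappa> \<subseteq> K"
    and \<alpha>: "sets \<alpha> = sets borel" "finite_measure \<alpha>" "measure \<alpha> UNIV > 0"
    and c: "\<And>k. c k = measure \<alpha> {x. \<kappa> x = k}"
    and bound: "\<And>c. \<bar>\<Phi> c\<bar> \<le> B"
    and harm: "\<And>c. (\<And>k. k \<in> K \<Longrightarrow> 0 \<le> c k) \<Longrightarrow> (\<Sum>k\<in>K. c k) > 0 \<Longrightarrow>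
       \<Phi> c = (\<Sum>k\<in>K. c k / (\<Sum>k\<in>K. c k) * \<Phi> (c(k := c k + 1)))"
  shows "(\<integral>\<omega>. \<Phi> (\<lambda>k. c k + label_sum {1..m} (\<lambda>i. \<kappa> (Z i \<omega>)) (\<lambda>_. 1) k) \<partial>N) = \<Phi> c"
proof (induction m)
  case 0
  interpret prob_space N using Z by (simp add: polya_sequence_def)
  show ?case by (simp add: label_sum_def prob_space)
next
  case (Suc m)
  interpret prob_space N using Z by (simp add: polya_sequence_def)
  interpret \<alpha>: finite_measure \<alpha> by fact
  define a where "a = measure \<alpha> UNIV"
  have Zm[measurable]: "Z i \<in> borel_measurable N" if "i \<ge> 1" for i
    using Z that by (auto simp: polya_sequence_def)
  note \<kappa>(1)[measurable]
  define Bk where "Bk k = {x. \<kappa> x = k}" for k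
  have Bk[measurable]: "Bk k \<in> sets borel" for k
    using measurable_sets[OF \<kappa>(1), of "{k}"] by (simp add: Bk_def vimage_def)
  have sum_c: "(\<Sum>k\<in>K. c k) = a"
  proof -
    have "(\<Sum>k\<in>K. measure \<alpha> (Bk k)) = measure \<alpha> (\<Union>k\<in>K. Bk k)"
      using K \<alpha>(1) by (intro \<alpha>.finite_measure_finite_Union[symmetric]) (auto simp: disjoint_family_on_def Bk_def[abs_def] image_subset_iff Bk[unfolded Bk_def])
    also have "(\<Union>k\<in>K. Bk k) = UNIV" using \<kappa>(2) by (auto simp: Bk_def)
    finally show ?thesis by (simp add: c Bk_def a_def)
  qed
  have c0: "0 \<le> c k" for k by (simp add: c)
  have a: "a > 0" using \<alpha> by (simp add: a_def)
  define C where "C \<omega> k = c k + label_sum {1..m} (\<lambda>i. \<kappa> (Z i \<omega>)) (\<lambda>_. 1) k" for \<omega> k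
  have C0: "0 \<le> C \<omega> k" for \<omega> k
    using c0 unfolding C_def by (intro add_nonneg_nonneg label_sum_nonneg) auto
  have sumC: "(\<Sum>k\<in>K. C \<omega> k) = a + m" for \<omega>
  proof -
    have "(\<Sum>k\<in>K. label_sum {1..m} (\<lambda>i. \<kappa> (Z i \<omega>)) (\<lambda>_. 1) k) = (\<Sum>i\<in>{1..m}. 1)"
      using K \<kappa>(2) by (intro sum_label_sum) auto
    then show ?thesis unfolding C_def sum.distrib sum_c by simp
  qed
  \<comment> \<open>\<open>G k\<close> is the value of \<open>\<Phi>\<close> if the next draw has
    label \<open>k\<close>. It depends only on the first \<open>m\<close> draws, so conditioning
    acts on the indicator of the next draw alone.\<close>
  define G where "G k \<omega> = \<Phi> ((C \<omega>)(k := C \<omega> k + 1))" for k \<omega>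
  have G_eq: "G k \<omega> = \<Phi> (\<lambda>j. (c(k := c k + 1)) j + label_sum {1..m} (\<lambda>i. \<kappa> (Z i \<omega>)) (\<lambda>_. 1) j)" for k \<omega>
    unfolding G_def by (rule arg_cong[where f=\<Phi>]) (auto simp: C_def)
  have split: "\<Phi> (\<lambda>k. c k + label_sum {1..Suc m} (\<lambda>i. \<kappa> (Z i \<omega>)) (\<lambda>_. 1) k)
     = (\<Sum>k\<in>K. G k \<omega> * indicator (Bk k) (Z (Suc m) \<omega>))" for \<omega>
  proof -
    have "\<Phi> (\<lambda>k. c k + label_sum {1..Suc m} (\<lambda>i. \<kappa> (Z i \<omega>)) (\<lambda>_. 1) k) = G (\<kappa> (Z (Suc m) \<omega>)) \<omega>"
      unfolding G_def by (rule arg_cong[where f=\<Phi>]) (auto simp: C_def label_sum_def)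
    also have "\<dots> = (\<Sum>k\<in>K. if k = \<kappa> (Z (Suc m) \<omega>) then G k \<omega> else 0)"
      using K \<kappa>(2) by (subst sum.delta) auto
    also have "\<dots> = (\<Sum>k\<in>K. G k \<omega> * indicator (Bk k) (Z (Suc m) \<omega>))"
      by (intro sum.cong) (auto simp: Bk_def)
    finally show ?thesis .
  qed
  have GN[measurable]: "G k \<in> borel_measurable N" for k
    unfolding G_eq[abs_def] using Zm by (intro measurable_label_counts) auto
  have iG: "integrable N (\<lambda>\<omega>. G k \<omega> * indicator (Bk k) (Z (Suc m) \<omega>))" for k
  proof (rule integrable_const_bound[of _ B])
    have "\<bar>G k \<omega> * indicator (Bk k) (Z (Suc m) \<omega>)\<bar> \<le> B" for \<omega>
      using bound[of "(C \<omega>)(k := C \<omega> k + 1)"] by (auto simp: G_def indicator_def)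
    then show "AE \<omega> in N. norm (G k \<omega> * indicator (Bk k) (Z (Suc m) \<omega>)) \<le> B" by simp
  qed (use Zm[of "Suc m"] in measurable)
  have CN: "(\<lambda>\<omega>. C \<omega> k) \<in> borel_measurable N" for k
    unfolding C_def using Zm measurable_label_counts[of m "\<lambda>\<omega> i. \<kappa> (Z i \<omega>)" N "\<lambda>c. c k"] by auto
  have step: "(\<integral>\<omega>. G k \<omega> * indicator (Bk k) (Z (Suc m) \<omega>) \<partial>N) = (\<integral>\<omega>. C \<omega> k / (a + m) * G k \<omega> \<partial>N)" if "k \<in> K" for k
  proof (cases "m = 0")
    \<comment> \<open>The first draw has its own clause in \<open>polya_sequence\<close>;
      conditional laws start with the second draw.\<close>
    case True
    have "{\<omega> \<in> space N. Z 1 \<omega> \<in> Bk k} \<in> events"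
      using Zm[of 1] by measurable
    have "(\<integral>\<omega>. G k \<omega> * indicator (Bk k) (Z (Suc m) \<omega>) \<partial>N) = (\<integral>\<omega>. \<Phi> (c(k := c k + 1)) * indicator {\<omega> \<in> space N. Z 1 \<omega> \<in> Bk k} \<omega> \<partial>N)"
      using True by (intro Bochner_Integration.integral_cong) (auto simp: G_eq label_sum_def indicator_def fun_upd_def)
    also have "\<dots> = \<Phi> (c(k := c k + 1)) * prob {\<omega> \<in> space N. Z 1 \<omega> \<in> Bk k}"
      by (simp add: Int_def conj_commute cong: conj_cong)
    also have "prob {\<omega> \<in> space N. Z 1 \<omega> \<in> Bk k} = c k / a"
      using Z Bk[of k] unfolding polya_sequence_def a_def c Bk_def[symmetric] by blast
    finally show ?thesis
      using True by (simp add: G_eq C_def label_sum_def prob_space)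
  next
    case False
    define F where "F = generated_algebra N {1..m} borel Z"
    have sub: "subalgebra N F" unfolding F_def using Zm by (intro subalgebra_generated_algebra) auto
    interpret F: finite_measure_subalgebra N F by unfold_locales (rule sub)
    have ZF: "Z i \<in> borel_measurable F" if "i \<in> {1..m}" for i
      unfolding F_def using Zm that by (intro measurable_generated_algebra) auto
    have GF: "G k \<in> borel_measurable F"
      unfolding G_eq[abs_def] using ZF \<kappa>(1) by (intro measurable_label_counts) (auto intro: measurable_compose)
    have "AE \<omega> in N. real_cond_exp N F (\<lambda>\<omega>. indicator (Bk k) (Z (Suc m) \<omega>)) \<omega>
        = 1 / (a + real m) * measure \<alpha> (Bk k) + 1 / (a + real m) * (\<Sum>i=1..m. measure (return borel (Z i \<omega>)) (Bk k))"
      using Z False Bk[of k] unfolding polya_sequence_def F_def a_def by simp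
    \<comment> \<open>Initial mass plus count: the conditional probability of the label
      \<open>k\<close> is its share in the updated parameter \<open>C \<omega>\<close>.\<close>
    moreover have "1 / (a + real m) * measure \<alpha> (Bk k) + 1 / (a + real m) * (\<Sum>i=1..m. measure (return borel (Z i \<omega>)) (Bk k)) = C \<omega> k / (a + m)" for \<omega>
    proof -
      have "(\<Sum>i=1..m. measure (return borel (Z i \<omega>)) (Bk k)) = label_sum {1..m} (\<lambda>i. \<kappa> (Z i \<omega>)) (\<lambda>_. 1) k"
        unfolding label_sum_def by (intro sum.cong refl) (auto simp: measure_return Bk_def indicator_def Bk[unfolded Bk_def])
      then show ?thesis by (simp add: C_def c Bk_def add_divide_distrib)
    qed
    ultimately have ce: "AE \<omega> in N. real_cond_exp N F (\<lambda>\<omega>. indicator (Bk k) (Z (Suc m) \<omega>)) \<omega> = C \<omega> k / (a + m)"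
      by simp
    have "(\<integral>\<omega>. G k \<omega> * indicator (Bk k) (Z (Suc m) \<omega>) \<partial>N)
       = (\<integral>\<omega>. G k \<omega> * real_cond_exp N F (\<lambda>\<omega>. indicator (Bk k) (Z (Suc m) \<omega>)) \<omega> \<partial>N)"
      using Zm[of "Suc m"] by (intro F.real_cond_exp_intg(2)[symmetric] iG GF) auto
    also have "\<dots> = (\<integral>\<omega>. C \<omega> k / (a + m) * G k \<omega> \<partial>N)"
      using ce CN by (intro integral_cong_AE) auto
    finally show ?thesis .
  qed
  have Cle: "C \<omega> k \<le> a + m" if "k \<in> K" for \<omega> k
    using member_le_sum[OF that, of "C \<omega>"] C0 K sumC[of \<omega>] by auto
  have iC: "integrable N (\<lambda>\<omega>. C \<omega> k / (a + m) * G k \<omega>)" if "k \<in> K" for k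
  proof (rule integrable_const_bound[of _ B])
    have "\<bar>C \<omega> k / (a + m) * G k \<omega>\<bar> \<le> 1 * B" for \<omega>
      unfolding abs_mult using C0[of \<omega> k] Cle[OF that, of \<omega>] a bound by (intro mult_mono) (auto simp: G_def divide_le_eq)
    then show "AE \<omega> in N. norm (C \<omega> k / (a + m) * G k \<omega>) \<le> B" by simp
  qed (use CN in measurable)
  have "(\<integral>\<omega>. \<Phi> (\<lambda>k. c k + label_sum {1..Suc m} (\<lambda>i. \<kappa> (Z i \<omega>)) (\<lambda>_. 1) k) \<partial>N)
     = (\<Sum>k\<in>K. \<integral>\<omega>. G k \<omega> * indicator (Bk k) (Z (Suc m) \<omega>) \<partial>N)"
    unfolding split by (intro Bochner_Integration.integral_sum iG)
  also have "\<dots> = (\<Sum>k\<in>K. \<integral>\<omega>. C \<omega> k / (a + m) * G k \<omega> \<partial>N)"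
    by (intro sum.cong refl step)
  also have "\<dots> = (\<integral>\<omega>. (\<Sum>k\<in>K. C \<omega> k / (a + m) * G k \<omega>) \<partial>N)"
    using iC by (intro Bochner_Integration.integral_sum[symmetric])
  \<comment> \<open>This is \<open>harm\<close> at the updated parameter: averaging over the label
    of the next draw returns \<open>\<Phi> (C \<omega>)\<close>.\<close>
  also have "\<dots> = (\<integral>\<omega>. \<Phi> (C \<omega>) \<partial>N)"
  proof (intro Bochner_Integration.integral_cong refl)
    fix \<omega>
    have "(\<Sum>k\<in>K. C \<omega> k) > 0" using sumC[of \<omega>] a by simp
    from harm[of "C \<omega>", OF C0 this]
    show "(\<Sum>k\<in>K. C \<omega> k / (a + m) * G k \<omega>) = \<Phi> (C \<omega>)" unfolding G_def sumC by simp
  qed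
  also have "\<dots> = \<Phi> c" using Suc.IH unfolding C_def .
  finally show ?case .
qed

section \<open>Dirichlet moments along a Polya sequence\<close>

lemma dirichlet_moment_bounds:
  assumes K: "finite K" and c: "\<And>k. k \<in> K \<Longrightarrow> 0 \<le> c k" "(\<Sum>k\<in>K. c k) > 0" and A: "finite A" "fst ` A \<subseteq> K"
  shows "(\<integral>\<^sup>+v. ennreal (\<Prod>x\<in>A. v (fst x)) \<partial>dirichlet_dist K c) \<le> 1"
proof -
  interpret prob_space "dirichlet_dist K c" by (intro prob_space_dirichlet_dist c)
  have "AE v in dirichlet_dist K c. (\<forall>i\<in>K. v i \<in> {0..1}) \<and> (\<Sum>i\<in>K. v i) = 1"
    by (rule AE_dirichlet_dist) (use assms in auto)
  then have "(\<integral>\<^sup>+v. ennreal (\<Prod>x\<in>A. v (fst x)) \<partial>dirichlet_dist K c) \<le> (\<integral>\<^sup>+v. 1 \<partial>dirichlet_dist K c)"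
    by (intro nn_integral_mono_AE, eventually_elim) (use A in \<open>auto simp: ennreal_le_1 intro!: prod_le_1\<close>)
  then show ?thesis by (simp add: emeasure_space_1)
qed

text \<open>As functions of the parameter, Dirichlet moments satisfy the mixture identity and are
  bounded by one; hence they are martingales along the urn.\<close>

lemma polya_dirichlet_moments:
  fixes \<alpha> :: "'a::polish_space measure" and A :: "(nat \<times> nat) set"
  assumes Z: "polya_sequence N \<alpha> Z" and K: "finite K" and \<kappa>: "\<kappa> \<in> borel \<rightarrow>\<^sub>M count_space UNIV" "range \<kappa> \<subseteq> K"
    and \<alpha>: "sets \<alpha> = sets borel" "finite_measure \<alpha>" "measure \<alpha> UNIV > 0"
    and c: "\<And>k. c k = measure \<alpha> {x. \<kappa> x = k}" and A: "finite A" "fst ` A \<subseteq> K"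
  shows "(\<integral>\<^sup>+\<omega>. (\<integral>\<^sup>+v. ennreal (\<Prod>x\<in>A. v (fst x)) \<partial>dirichlet_dist K (\<lambda>k. c k + label_sum {1..m} (\<lambda>i. \<kappa> (Z i \<omega>)) (\<lambda>_. 1) k)) \<partial>N)
    = (\<integral>\<^sup>+v. ennreal (\<Prod>x\<in>A. v (fst x)) \<partial>dirichlet_dist K c)"
proof -
  interpret prob_space N using Z by (simp add: polya_sequence_def)
  interpret \<alpha>: finite_measure \<alpha> by fact
  define D where "D c = (\<integral>\<^sup>+v. ennreal (\<Prod>x\<in>A. v (fst x)) \<partial>dirichlet_dist K c)" for c
  \<comment> \<open>The martingale lemma wants a bounded real function of every parameter.
    \<open>ok\<close> marks the parameters that are nonnegative with positive total; elsewhere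
    \<open>\<Phi>\<close> is set to \<open>0\<close>.\<close>
  define ok where "ok c \<longleftrightarrow> (\<forall>k\<in>K. 0 \<le> c k) \<and> (\<Sum>k\<in>K. c k) > 0" for c :: "nat \<Rightarrow> real"
  define \<Phi> where "\<Phi> c = (if ok c then enn2real (D c) else 0)" for c
  have D1: "D c \<le> 1" if "ok c" for c
    unfolding D_def using that by (intro dirichlet_moment_bounds K A) (auto simp: ok_def)
  have D\<Phi>: "D c = ennreal (\<Phi> c)" "0 \<le> \<Phi> c" "\<Phi> c \<le> 1" if "ok c" for c
    using D1[OF that] that enn2real_mono[OF D1[OF that]] by (auto simp: \<Phi>_def ennreal_enn2real_if top_unique)
  have AK: "x \<in> A \<Longrightarrow> fst x \<in> K" for x using A by auto
  have "(\<integral>\<omega>. \<Phi> (\<lambda>k. c k + label_sum {1..m} (\<lambda>i. \<kappa> (Z i \<omega>)) (\<lambda>_. 1) k) \<partial>N) = \<Phi> c"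
  proof (rule polya_sequence_harmonic[OF Z K \<kappa> \<alpha> c])
    show "\<bar>\<Phi> c\<bar> \<le> 1" for c using D\<Phi>[of c] by (cases "ok c") (auto simp: \<Phi>_def)
    fix c :: "nat \<Rightarrow> real" assume c: "\<And>k. k \<in> K \<Longrightarrow> 0 \<le> c k" "(\<Sum>k\<in>K. c k) > 0"
    have okc: "ok c" using c by (simp add: ok_def)
    have oku: "ok (c(k := c k + 1))" if "k \<in> K" for k
      using c sum_upd_plus_1[OF K that, of c] that unfolding ok_def by auto
    have "D c = (\<Sum>k\<in>K. ennreal (c k / (\<Sum>k\<in>K. c k)) * D (c(k := c k + 1)))"
      unfolding D_def using AK by (intro dirichlet_dist_mixture K c refl) measurable
    also have "\<dots> = (\<Sum>k\<in>K. ennreal (c k / (\<Sum>k\<in>K. c k) * \<Phi> (c(k := c k + 1))))"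
      using c oku D\<Phi> by (intro sum.cong refl) (simp add: ennreal_mult[symmetric])
    also have "\<dots> = ennreal (\<Sum>k\<in>K. c k / (\<Sum>k\<in>K. c k) * \<Phi> (c(k := c k + 1)))"
      using c oku D\<Phi> by (intro sum_ennreal) (auto intro!: mult_nonneg_nonneg divide_nonneg_pos)
    finally show "\<Phi> c = (\<Sum>k\<in>K. c k / (\<Sum>k\<in>K. c k) * \<Phi> (c(k := c k + 1)))"
      using D\<Phi>[OF okc] c oku D\<Phi> by (simp add: sum_nonneg mult_nonneg_nonneg)
  qed
  moreover have okc: "ok (\<lambda>k. c k + label_sum {1..m} (\<lambda>i. \<kappa> (Z i \<omega>)) (\<lambda>_. 1) k)" "ok c" for \<omega>
  proof -
    have "(\<Sum>k\<in>K. measure \<alpha> {x. \<kappa> x = k}) = measure \<alpha> (\<Union>k\<in>K. {x. \<kappa> x = k})"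
      using K \<alpha>(1) measurable_sets[OF \<kappa>(1), of "{_}"]
      by (intro \<alpha>.finite_measure_finite_Union[symmetric]) (auto simp: disjoint_family_on_def vimage_def)
    also have "(\<Union>k\<in>K. {x. \<kappa> x = k}) = UNIV" using \<kappa>(2) by auto
    finally have s: "(\<Sum>k\<in>K. c k) > 0" using \<alpha> by (simp add: c)
    then show "ok c" by (simp add: ok_def c)
    have "0 \<le> label_sum {1..m} (\<lambda>i. \<kappa> (Z i \<omega>)) (\<lambda>_. 1) k" for k by (rule label_sum_nonneg) simp
    with s show "ok (\<lambda>k. c k + label_sum {1..m} (\<lambda>i. \<kappa> (Z i \<omega>)) (\<lambda>_. 1) k)"
      by (auto simp: ok_def sum.distrib c intro!: add_nonneg_nonneg add_pos_nonneg sum_nonneg)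
  qed
  moreover have "(\<integral>\<^sup>+\<omega>. ennreal (\<Phi> (\<lambda>k. c k + label_sum {1..m} (\<lambda>i. \<kappa> (Z i \<omega>)) (\<lambda>_. 1) k)) \<partial>N)
     = ennreal (\<integral>\<omega>. \<Phi> (\<lambda>k. c k + label_sum {1..m} (\<lambda>i. \<kappa> (Z i \<omega>)) (\<lambda>_. 1) k) \<partial>N)"
  proof (rule nn_integral_eq_integral)
    have Zm[measurable]: "Z i \<in> borel_measurable N" if "i \<ge> 1" for i
      using Z that by (auto simp: polya_sequence_def)
    have "(\<lambda>\<omega>. \<Phi> (\<lambda>k. c k + label_sum {1..m} (\<lambda>i. \<kappa> (Z i \<omega>)) (\<lambda>_. 1) k)) \<in> borel_measurable N"
      using \<kappa>(1) Zm by (intro measurable_label_counts) (auto intro: measurable_compose)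
    then show "integrable N (\<lambda>\<omega>. \<Phi> (\<lambda>k. c k + label_sum {1..m} (\<lambda>i. \<kappa> (Z i \<omega>)) (\<lambda>_. 1) k))"
      using D\<Phi>[OF okc(1)] by (intro integrable_const_bound[of _ 1]) auto
  qed (use D\<Phi>[OF okc(1)] in auto)
  ultimately show ?thesis using D\<Phi>[OF okc(1)] D\<Phi>[OF okc(2)] by (simp add: D_def)
qed

section \<open>Random mixtures of measures\<close>

definition mix :: "real \<Rightarrow> 'a::polish_space measure \<Rightarrow> 'a measure \<Rightarrow> 'a measure" where
  "mix t D p = measure_of UNIV (sets borel) (\<lambda>A. ennreal t * emeasure D A + ennreal (1 - t) * emeasure p A)"

lemma sets_mix [simp, measurable_cong]: "sets (mix t D p) = sets borel"
  using sets.space_closed[of borel] sets.sigma_sets_eq[of borel] by (simp add: mix_def)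

lemma emeasure_mix:
  assumes D: "sets D = sets borel" and p: "sets p = sets borel" and A: "A \<in> sets borel"
  shows "emeasure (mix t D p) A = ennreal t * emeasure D A + ennreal (1 - t) * emeasure p A"
proof (rule emeasure_measure_of[OF mix_def])
  show "A \<in> sets (mix t D p)" using A by simp
  show "countably_additive (sets (mix t D p)) (\<lambda>A. ennreal t * emeasure D A + ennreal (1 - t) * emeasure p A)"
  proof (rule countably_additiveI)
    fix F :: "nat \<Rightarrow> 'a set" assume F: "range F \<subseteq> sets (mix t D p)" "disjoint_family F"
    then have "(\<Sum>i. emeasure D (F i)) = emeasure D (\<Union>i. F i)" "(\<Sum>i. emeasure p (F i)) = emeasure p (\<Union>i. F i)"
      using D p by (auto intro!: suminf_emeasure)
    then show "(\<Sum>i. ennreal t * emeasure D (F i) + ennreal (1 - t) * emeasure p (F i))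
        = ennreal t * emeasure D (\<Union>i. F i) + ennreal (1 - t) * emeasure p (\<Union>i. F i)"
      by (simp add: suminf_add[symmetric] ennreal_suminf_cmult)
  qed
qed (auto simp: positive_def)

lemma measurable_measure_prob_algebra [measurable]:
  "A \<in> sets M \<Longrightarrow> (\<lambda>p. measure p A) \<in> borel_measurable (prob_algebra M)"
  unfolding prob_algebra_def by (intro measurable_restrict_space1) measurable

lemma measurable_emeasure_prob_algebra [measurable]:
  "A \<in> sets M \<Longrightarrow> (\<lambda>p. emeasure p A) \<in> borel_measurable (prob_algebra M)"
  unfolding prob_algebra_def by (intro measurable_restrict_space1) measurable

lemma mix_in_prob_algebra:
  assumes t: "t \<in> {0..1}" and D: "D \<in> space (prob_algebra borel)" and p: "p \<in> space (prob_algebra borel)"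
  shows "mix t D p \<in> space (prob_algebra borel)"
proof -
  from D have D': "prob_space D" "sets D = sets borel" by (auto simp: space_prob_algebra)
  from p have p': "prob_space p" "sets p = sets borel" by (auto simp: space_prob_algebra)
  have "emeasure D UNIV = 1" "emeasure p UNIV = 1"
    using prob_space.emeasure_space_1[OF D'(1)] prob_space.emeasure_space_1[OF p'(1)]
      sets_eq_imp_space_eq[OF D'(2)] sets_eq_imp_space_eq[OF p'(2)] by auto
  then have "emeasure (mix t D p) UNIV = ennreal t + ennreal (1 - t)"
    using D' p' by (simp add: emeasure_mix)
  also have "\<dots> = 1" using t by (simp add: ennreal_plus[symmetric] del: ennreal_plus)
  finally have "emeasure (mix t D p) (space (mix t D p)) = 1"
    using sets_eq_imp_space_eq[OF sets_mix[of t D p]] by simp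
  then show ?thesis by (auto simp: space_prob_algebra intro: prob_spaceI)
qed

lemma measure_mix:
  assumes t: "t \<in> {0..1}" and D: "D \<in> space (prob_algebra borel)" and p: "p \<in> space (prob_algebra borel)"
  shows "measure (mix t D p) A = t * measure D A + (1 - t) * measure p A"
proof (cases "A \<in> sets borel")
  case True
  interpret D: prob_space D using D by (simp add: space_prob_algebra)
  interpret p: prob_space p using p by (simp add: space_prob_algebra)
  have "emeasure (mix t D p) A = ennreal (t * measure D A + (1 - t) * measure p A)"
    using t D p True
    by (subst emeasure_mix) (auto simp: space_prob_algebra D.emeasure_eq_measure p.emeasure_eq_measure ennreal_mult)
  then show ?thesis using t by (intro measure_eq_emeasure_eq_ennreal) auto
next
  \<comment> \<open>For a set that is not Borel all three measures are \<open>0\<close> by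
    convention, so the formula holds for every \<open>A\<close>.\<close>
  case False
  then show ?thesis using D p by (simp add: measure_notin_sets space_prob_algebra)
qed

lemma measurable_mix:
  assumes t[measurable]: "t \<in> borel_measurable M" "\<And>x. x \<in> space M \<Longrightarrow> t x \<in> {0..1}"
    and D[measurable]: "D \<in> M \<rightarrow>\<^sub>M prob_algebra borel" and p[measurable]: "p \<in> M \<rightarrow>\<^sub>M prob_algebra borel"
  shows "(\<lambda>x. mix (t x) (D x) (p x)) \<in> M \<rightarrow>\<^sub>M prob_algebra borel"
proof (rule measurable_prob_algebraI)
  have sp: "mix (t x) (D x) (p x) \<in> space (prob_algebra borel)" if "x \<in> space M" for x
    using that t(2) measurable_space[OF D] measurable_space[OF p] by (intro mix_in_prob_algebra) auto
  then show "prob_space (mix (t x) (D x) (p x))" if "x \<in> space M" for x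
    using that by (auto simp: space_prob_algebra)
  show "(\<lambda>x. mix (t x) (D x) (p x)) \<in> M \<rightarrow>\<^sub>M subprob_algebra borel"
  proof (rule measurable_subprob_algebra)
    fix x assume "x \<in> space M"
    then show "subprob_space (mix (t x) (D x) (p x))"
      using sp by (auto simp: space_prob_algebra intro: prob_space_imp_subprob_space)
  next
    fix A :: "'b set" assume A[measurable]: "A \<in> sets borel"
    have "(\<lambda>x. ennreal (t x) * emeasure (D x) A + ennreal (1 - t x) * emeasure (p x) A) \<in> borel_measurable M"
      by measurable
    also have "?this \<longleftrightarrow> (\<lambda>x. emeasure (mix (t x) (D x) (p x)) A) \<in> borel_measurable M"
      using measurable_space[OF D] measurable_space[OF p] A
      by (intro measurable_cong) (subst emeasure_mix, auto simp: space_prob_algebra)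
    finally show "(\<lambda>x. emeasure (mix (t x) (D x) (p x)) A) \<in> borel_measurable M" .
  qed simp
qed

section \<open>The moment recursion of an affine step\<close>

lemma prod_mem_unit_interval: "(\<And>x. x \<in> A \<Longrightarrow> f x \<in> {0..1::real}) \<Longrightarrow> (\<Prod>x\<in>A. f x) \<in> {0..1}"
  by (auto intro!: prod_nonneg prod_le_1)

text \<open>The product expands over the subset \<open>X\<close> of factors that take the innovation
  term. The pair \<open>(t, d)\<close> lives on \<open>M\<close> and \<open>v\<close> on
  \<open>P\<close>, so every term splits into a product of two expectations; this is the
  independence of innovation and state.\<close>

lemma integral_convex_combination_monomial:
  fixes t :: "'w \<Rightarrow> real" and d :: "'x \<Rightarrow> 'w \<Rightarrow> real" and v :: "'x \<Rightarrow> 'p \<Rightarrow> real"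
  assumes M: "prob_space M" and P: "prob_space P" and A: "finite A"
    and t[measurable]: "t \<in> borel_measurable M" and t1: "\<And>\<omega>. \<omega> \<in> space M \<Longrightarrow> t \<omega> \<in> {0..1}"
    and d[measurable]: "\<And>x. x \<in> A \<Longrightarrow> d x \<in> borel_measurable M" and d1: "\<And>x \<omega>. x \<in> A \<Longrightarrow> \<omega> \<in> space M \<Longrightarrow> d x \<omega> \<in> {0..1}"
    and v[measurable]: "\<And>x. x \<in> A \<Longrightarrow> v x \<in> borel_measurable P" and v1: "AE p in P. \<forall>x\<in>A. v x p \<in> {0..1}"
  shows "(\<integral>\<^sup>+\<omega>. (\<integral>\<^sup>+p. ennreal (\<Prod>x\<in>A. t \<omega> * d x \<omega> + (1 - t \<omega>) * v x p) \<partial>P) \<partial>M)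
    = ennreal (\<Sum>X\<in>Pow A. (\<integral>\<omega>. (\<Prod>x\<in>X. t \<omega> * d x \<omega>) * (\<Prod>x\<in>A - X. 1 - t \<omega>) \<partial>M) * (\<integral>p. (\<Prod>x\<in>A - X. v x p) \<partial>P))"
proof -
  interpret M: prob_space M by fact
  interpret P: prob_space P by fact
  let ?u = "\<lambda>X \<omega>. (\<Prod>x\<in>X. t \<omega> * d x \<omega>) * (\<Prod>x\<in>A - X. 1 - t \<omega>)"
  let ?m = "\<lambda>Y. \<integral>p. (\<Prod>x\<in>Y. v x p) \<partial>P"
  have iv: "integrable P (\<lambda>p. \<Prod>x\<in>Y. v x p)" if Y: "Y \<subseteq> A" for Y
  proof (rule P.integrable_const_bound[of _ 1])
    show "AE p in P. norm (\<Prod>x\<in>Y. v x p) \<le> 1"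
      using v1
    proof eventually_elim
      case (elim p)
      then have "(\<Prod>x\<in>Y. v x p) \<in> {0..1}" using Y by (intro prod_mem_unit_interval) auto
      then show ?case by auto
    qed
    show "(\<lambda>p. \<Prod>x\<in>Y. v x p) \<in> borel_measurable P" using Y v by (intro borel_measurable_prod) auto
  qed
  have u1: "?u X \<omega> \<in> {0..1}" if "X \<subseteq> A" "\<omega> \<in> space M" for X \<omega>
  proof -
    have "(\<Prod>x\<in>X. t \<omega> * d x \<omega>) \<in> {0..1}"
      using that t1[of \<omega>] d1[of _ \<omega>] by (intro prod_mem_unit_interval) (auto intro!: mult_le_one)
    moreover have "(\<Prod>x\<in>A - X. 1 - t \<omega>) \<in> {0..1}"
      using that t1[of \<omega>] by (intro prod_mem_unit_interval) auto
    ultimately show ?thesis by (auto intro!: mult_le_one)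
  qed
  have mu: "?u X \<in> borel_measurable M" if "X \<subseteq> A" for X
    using that d t by (intro borel_measurable_times borel_measurable_prod borel_measurable_diff) auto
  have iu: "integrable M (?u X)" if "X \<subseteq> A" for X
    using u1[OF that] mu[OF that] by (intro M.integrable_const_bound[of _ 1]) auto
  have expand: "(\<Prod>x\<in>A. t \<omega> * d x \<omega> + (1 - t \<omega>) * v x p) = (\<Sum>X\<in>Pow A. ?u X \<omega> * (\<Prod>x\<in>A - X. v x p))" for \<omega> p
    unfolding prod_add[OF A] by (intro sum.cong refl) (simp add: prod.distrib)
  have m0: "0 \<le> ?m Y" if "Y \<subseteq> A" for Y
    using v1 that by (intro integral_nonneg_AE) (auto elim!: eventually_mono intro!: prod_nonneg)
  have inner: "(\<integral>\<^sup>+p. ennreal (\<Prod>x\<in>A. t \<omega> * d x \<omega> + (1 - t \<omega>) * v x p) \<partial>P) = ennreal (\<Sum>X\<in>Pow A. ?u X \<omega> * ?m (A - X))"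
    if \<omega>: "\<omega> \<in> space M" for \<omega>
  proof -
    have "(\<integral>\<^sup>+p. ennreal (\<Prod>x\<in>A. t \<omega> * d x \<omega> + (1 - t \<omega>) * v x p) \<partial>P)
      = ennreal (\<integral>p. (\<Prod>x\<in>A. t \<omega> * d x \<omega> + (1 - t \<omega>) * v x p) \<partial>P)"
    proof (rule nn_integral_eq_integral)
      show "integrable P (\<lambda>p. \<Prod>x\<in>A. t \<omega> * d x \<omega> + (1 - t \<omega>) * v x p)"
        unfolding expand by (intro Bochner_Integration.integrable_sum integrable_mult_right iv) auto
      show "AE p in P. 0 \<le> (\<Prod>x\<in>A. t \<omega> * d x \<omega> + (1 - t \<omega>) * v x p)"
        using v1 by eventually_elim (use t1[OF \<omega>] d1[OF _ \<omega>] in \<open>auto intro!: prod_nonneg add_nonneg_nonneg mult_nonneg_nonneg\<close>)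
    qed
    also have "(\<integral>p. (\<Prod>x\<in>A. t \<omega> * d x \<omega> + (1 - t \<omega>) * v x p) \<partial>P) = (\<Sum>X\<in>Pow A. ?u X \<omega> * ?m (A - X))"
      unfolding expand by (subst Bochner_Integration.integral_sum) (auto intro!: integrable_mult_right iv)
    finally show ?thesis .
  qed
  have "(\<integral>\<^sup>+\<omega>. (\<integral>\<^sup>+p. ennreal (\<Prod>x\<in>A. t \<omega> * d x \<omega> + (1 - t \<omega>) * v x p) \<partial>P) \<partial>M)
     = (\<integral>\<^sup>+\<omega>. ennreal (\<Sum>X\<in>Pow A. ?u X \<omega> * ?m (A - X)) \<partial>M)"
    by (intro nn_integral_cong inner)
  also have "\<dots> = ennreal (\<integral>\<omega>. (\<Sum>X\<in>Pow A. ?u X \<omega> * ?m (A - X)) \<partial>M)"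
  proof (rule nn_integral_eq_integral)
    show "integrable M (\<lambda>\<omega>. \<Sum>X\<in>Pow A. ?u X \<omega> * ?m (A - X))"
      by (intro Bochner_Integration.integrable_sum integrable_mult_left iu) auto
    show "AE \<omega> in M. 0 \<le> (\<Sum>X\<in>Pow A. ?u X \<omega> * ?m (A - X))"
      by (intro AE_I2 sum_nonneg mult_nonneg_nonneg[OF conjunct1[OF u1[unfolded atLeastAtMost_iff]] m0]) auto
  qed
  also have "(\<integral>\<omega>. (\<Sum>X\<in>Pow A. ?u X \<omega> * ?m (A - X)) \<partial>M) = (\<Sum>X\<in>Pow A. (\<integral>\<omega>. ?u X \<omega> \<partial>M) * ?m (A - X))"
    by (subst Bochner_Integration.integral_sum, rule integrable_mult_left[OF iu]) (simp_all del: prod_constant)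
  finally show ?thesis .
qed

text \<open>The term \<open>X = {}\<close> is the only one that reproduces the value at the full
  set. Its coefficient differs from \<open>1\<close>, so that value can be solved for in terms of
  values at proper subsets.\<close>

lemma subset_recursion_unique:
  fixes m1 m2 :: "'x set \<Rightarrow> real"
  assumes A: "finite A"
    and 1: "\<And>B. B \<subseteq> A \<Longrightarrow> m1 B = (\<Sum>X\<in>Pow B. \<kappa> X (B - X) * m1 (B - X))"
    and 2: "\<And>B. B \<subseteq> A \<Longrightarrow> m2 B = (\<Sum>X\<in>Pow B. \<kappa> X (B - X) * m2 (B - X))"
    and empty: "m1 {} = m2 {}" and \<kappa>: "\<And>B. B \<subseteq> A \<Longrightarrow> B \<noteq> {} \<Longrightarrow> \<kappa> {} B \<noteq> 1"
  shows "m1 A = m2 A"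
  using A 1 2 \<kappa>
proof (induction rule: finite_psubset_induct)
  case (psubset A)
  show ?case
  proof (cases "A = {}")
    case False
    have split: "m A = \<kappa> {} A * m A + (\<Sum>X\<in>Pow A - {{}}. \<kappa> X (A - X) * m (A - X))"
      if "m A = (\<Sum>X\<in>Pow A. \<kappa> X (A - X) * m (A - X))" for m :: "'x set \<Rightarrow> real"
      using that psubset.hyps by (subst (asm) sum.remove[of _ "{}"]) auto
    have "m1 (A - X) = m2 (A - X)" if "X \<in> Pow A - {{}}" for X
    proof (rule psubset.IH)
      show "A - X \<subset> A" using that by auto
      have sub: "B \<subseteq> A" if "B \<subseteq> A - X" for B using that by auto
      show "m1 B = (\<Sum>X\<in>Pow B. \<kappa> X (B - X) * m1 (B - X))" "m2 B = (\<Sum>X\<in>Pow B. \<kappa> X (B - X) * m2 (B - X))"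
        if "B \<subseteq> A - X" for B
        using psubset.prems(1,2) sub[OF that] by blast+
      show "\<kappa> {} B \<noteq> 1" if "B \<subseteq> A - X" "B \<noteq> {}" for B
        using psubset.prems(3) sub[OF that(1)] that(2) by blast
    qed
    then have "(\<Sum>X\<in>Pow A - {{}}. \<kappa> X (A - X) * m1 (A - X)) = (\<Sum>X\<in>Pow A - {{}}. \<kappa> X (A - X) * m2 (A - X))"
      by (intro sum.cong) auto
    with split[OF psubset.prems(1)] split[OF psubset.prems(2)] have "(1 - \<kappa> {} A) * m1 A = (1 - \<kappa> {} A) * m2 A"
      by (simp add: algebra_simps)
    then show ?thesis using psubset.prems(3)[of A] False by auto
  qed (simp add: empty)
qed

text \<open>Abstracts from the laws of the innovations: what remains is a random weight and a random
  probability measure, possibly dependent on each other. Positivity of \<open>E t\<close> rules out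
  \<open>t = 0\<close> almost surely, in which case every law would be invariant.\<close>

locale random_mixture = prob_space M for M :: "'w measure" +
  fixes t :: "'w \<Rightarrow> real" and D :: "'w \<Rightarrow> 'a::polish_space measure"
  assumes t[measurable]: "t \<in> borel_measurable M" and t_range: "\<And>\<omega>. \<omega> \<in> space M \<Longrightarrow> t \<omega> \<in> {0..1}"
    and D[measurable]: "D \<in> M \<rightarrow>\<^sub>M prob_algebra borel"
    and t_pos: "(\<integral>\<omega>. t \<omega> \<partial>M) > 0"
begin

definition kernel :: "'a measure \<Rightarrow> 'a measure measure" where
  "kernel p = distr M prob_measures (\<lambda>\<omega>. mix (t \<omega>) (D \<omega>) p)"

lemma measurable_mix_pair:
  "(\<lambda>(p, \<omega>). mix (t \<omega>) (D \<omega>) p) \<in> prob_measures \<Otimes>\<^sub>M M \<rightarrow>\<^sub>M prob_measures"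
proof -
  have "(\<lambda>x. mix (t (snd x)) (D (snd x)) (fst x)) \<in> prob_measures \<Otimes>\<^sub>M M \<rightarrow>\<^sub>M prob_algebra borel"
  proof (rule measurable_mix)
    have "fst \<in> prob_measures \<Otimes>\<^sub>M M \<rightarrow>\<^sub>M prob_measures" by measurable
    then show "fst \<in> prob_measures \<Otimes>\<^sub>M M \<rightarrow>\<^sub>M prob_algebra borel"
      by (simp cong: measurable_cong_sets add: sets_prob_measures)
    show "\<And>x. x \<in> space (prob_measures \<Otimes>\<^sub>M M) \<Longrightarrow> t (snd x) \<in> {0..1}"
      using t_range by (auto simp: space_pair_measure)
  qed measurable
  then show ?thesis
    by (simp cong: measurable_cong_sets add: sets_prob_measures case_prod_unfold)
qed

lemma measurable_mix_sample:
  assumes "p \<in> space prob_measures"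
  shows "(\<lambda>\<omega>. mix (t \<omega>) (D \<omega>) p) \<in> M \<rightarrow>\<^sub>M prob_measures"
  using measurable_Pair2[OF measurable_mix_pair assms] by simp

lemma measurable_kernel: "kernel \<in> prob_measures \<rightarrow>\<^sub>M prob_algebra prob_measures"
  unfolding kernel_def
  by (rule measurable_distr_prob_space2[where M=M])
     (auto simp: space_prob_algebra prob_space_axioms measurable_mix_pair intro!: measurable_const)

text \<open>Invariance is given on sets; in the form \<open>Q \<bind> kernel = Q\<close> it extends
  to nonnegative functions. The order of integration is then exchanged so that the innovation stands
  outside, as in the moment expansion.\<close>

lemma nn_integral_invariant:
  assumes Q: "invariant_measure prob_measures kernel Q" and f[measurable]: "f \<in> borel_measurable prob_measures"
  shows "(\<integral>\<^sup>+p. f p \<partial>Q) = (\<integral>\<^sup>+\<omega>. (\<integral>\<^sup>+p. f (mix (t \<omega>) (D \<omega>) p) \<partial>Q) \<partial>M)"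
proof -
  have Q': "prob_space Q" "sets Q = sets prob_measures"
    and inv: "\<And>A. A \<in> sets prob_measures \<Longrightarrow> (\<integral>\<^sup>+x. emeasure (kernel x) A \<partial>Q) = emeasure Q A"
    using Q by (auto simp: invariant_measure_def)
  interpret Q: prob_space Q by fact
  note [measurable_cong] = Q'(2)
  have K: "kernel \<in> Q \<rightarrow>\<^sub>M subprob_algebra prob_measures"
    using measurable_prob_algebraD[OF measurable_kernel] by (simp cong: measurable_cong_sets add: Q'(2))
  have eq: "Q \<bind> kernel = Q"
  proof (rule measure_eqI)
    show s: "sets (Q \<bind> kernel) = sets Q"
      using K Q.not_empty by (simp add: sets_bind Q'(2) subprob_measurableD(2)[OF K])
    fix A assume "A \<in> sets (Q \<bind> kernel)"
    then have "A \<in> sets prob_measures" using s Q' by simp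
    then show "emeasure (Q \<bind> kernel) A = emeasure Q A"
      using inv by (simp add: emeasure_bind[OF Q.not_empty K])
  qed
  have mp: "(\<lambda>(p, \<omega>). mix (t \<omega>) (D \<omega>) p) \<in> Q \<Otimes>\<^sub>M M \<rightarrow>\<^sub>M prob_measures"
    using measurable_mix_pair by (simp cong: measurable_cong_sets add: Q'(2) sets_pair_measure_cong[OF Q'(2) refl])
  interpret pair_sigma_finite Q M ..
  have "(\<integral>\<^sup>+p. f p \<partial>Q) = (\<integral>\<^sup>+p. (\<integral>\<^sup>+q. f q \<partial>kernel p) \<partial>Q)"
    by (subst eq[symmetric]) (rule nn_integral_bind[OF f K])
  also have "\<dots> = (\<integral>\<^sup>+p. (\<integral>\<^sup>+\<omega>. f (mix (t \<omega>) (D \<omega>) p) \<partial>M) \<partial>Q)"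
    unfolding kernel_def using measurable_mix_sample sets_eq_imp_space_eq[OF Q'(2)]
    by (intro nn_integral_cong nn_integral_distr) auto
  also have "\<dots> = (\<integral>\<^sup>+\<omega>. (\<integral>\<^sup>+p. f (mix (t \<omega>) (D \<omega>) p) \<partial>Q) \<partial>M)"
    using measurable_compose[OF mp f] by (intro Fubini'[symmetric]) (simp add: case_prod_unfold)
  finally show ?thesis .
qed

text \<open>A nonempty product of equal factors in the unit interval is at most one of them, and
  \<open>E (1 - t) = 1 - E t\<close>.\<close>

lemma integral_power_less_1:
  assumes "finite A" "A \<noteq> {}"
  shows "(\<integral>\<omega>. (\<Prod>x\<in>A. 1 - t \<omega>) \<partial>M) < 1"
proof -
  have it: "integrable M t" using t_range by (intro integrable_const_bound[of _ 1]) auto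
  have "(\<integral>\<omega>. (\<Prod>x\<in>A. 1 - t \<omega>) \<partial>M) \<le> (\<integral>\<omega>. 1 - t \<omega> \<partial>M)"
  proof (rule integral_mono)
    show "integrable M (\<lambda>\<omega>. \<Prod>x\<in>A. 1 - t \<omega>)"
      using t_range by (intro integrable_const_bound[of _ 1]) (auto intro!: power_le_one simp: power_abs[symmetric])
    show "integrable M (\<lambda>\<omega>. 1 - t \<omega>)" using it by auto
    fix \<omega> assume \<omega>: "\<omega> \<in> space M"
    have "(1 - t \<omega>) ^ card A \<le> (1 - t \<omega>) ^ 1"
      using t_range[OF \<omega>] assms by (intro power_decreasing) (auto simp: Suc_le_eq card_gt_0_iff)
    then show "(\<Prod>x\<in>A. 1 - t \<omega>) \<le> 1 - t \<omega>" by simp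
  qed
  also have "\<dots> = 1 - (\<integral>\<omega>. t \<omega> \<partial>M)" using it by (simp add: prob_space)
  finally show ?thesis using t_pos by simp
qed

text \<open>The coefficients of the recursion are integrals over \<open>M\<close> alone, so two
  solutions of the fixed point equation share their moments even when they live on different spaces.
  The equation is required for every \<open>B \<subseteq> A\<close> because the recursion descends
  to subsets.\<close>

lemma fixed_moments_unique:
  fixes u :: "'x \<Rightarrow> 'p \<Rightarrow> real" and u' :: "'x \<Rightarrow> 'q \<Rightarrow> real"
  assumes A: "finite A" and d: "\<And>x. x \<in> A \<Longrightarrow> d x \<in> borel_measurable M" "\<And>x \<omega>. x \<in> A \<Longrightarrow> \<omega> \<in> space M \<Longrightarrow> d x \<omega> \<in> {0..1}"
    and P1: "prob_space P1" "\<And>x. x \<in> A \<Longrightarrow> u x \<in> borel_measurable P1" "AE p in P1. \<forall>x\<in>A. u x p \<in> {0..1}"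
      "\<And>B. B \<subseteq> A \<Longrightarrow> (\<integral>\<^sup>+p. ennreal (\<Prod>x\<in>B. u x p) \<partial>P1) = (\<integral>\<^sup>+\<omega>. (\<integral>\<^sup>+p. ennreal (\<Prod>x\<in>B. t \<omega> * d x \<omega> + (1 - t \<omega>) * u x p) \<partial>P1) \<partial>M)"
    and P2: "prob_space P2" "\<And>x. x \<in> A \<Longrightarrow> u' x \<in> borel_measurable P2" "AE p in P2. \<forall>x\<in>A. u' x p \<in> {0..1}"
      "\<And>B. B \<subseteq> A \<Longrightarrow> (\<integral>\<^sup>+p. ennreal (\<Prod>x\<in>B. u' x p) \<partial>P2) = (\<integral>\<^sup>+\<omega>. (\<integral>\<^sup>+p. ennreal (\<Prod>x\<in>B. t \<omega> * d x \<omega> + (1 - t \<omega>) * u' x p) \<partial>P2) \<partial>M)"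
  shows "(\<integral>p. (\<Prod>x\<in>A. u x p) \<partial>P1) = (\<integral>p. (\<Prod>x\<in>A. u' x p) \<partial>P2)"
proof -
  define \<kappa> where "\<kappa> X Y = (\<integral>\<omega>. (\<Prod>x\<in>X. t \<omega> * d x \<omega>) * (\<Prod>x\<in>Y. 1 - t \<omega>) \<partial>M)" for X Y :: "'x set"
  have rec: "(\<integral>p. (\<Prod>x\<in>B. v x p) \<partial>P) = (\<Sum>X\<in>Pow B. \<kappa> X (B - X) * (\<integral>p. (\<Prod>x\<in>B - X. v x p) \<partial>P))"
    if P: "prob_space P" "\<And>x. x \<in> A \<Longrightarrow> v x \<in> borel_measurable P" "AE p in P. \<forall>x\<in>A. v x p \<in> {0..1}"
      "\<And>B. B \<subseteq> A \<Longrightarrow> (\<integral>\<^sup>+p. ennreal (\<Prod>x\<in>B. v x p) \<partial>P) = (\<integral>\<^sup>+\<omega>. (\<integral>\<^sup>+p. ennreal (\<Prod>x\<in>B. t \<omega> * d x \<omega> + (1 - t \<omega>) * v x p) \<partial>P) \<partial>M)"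
      and B: "B \<subseteq> A" for P :: "'r measure" and v and B
  proof -
    interpret P: prob_space P by fact
    have v01: "AE p in P. \<forall>x\<in>B. v x p \<in> {0..1}" using P(3) B by auto
    have int: "integrable P (\<lambda>p. \<Prod>x\<in>C. v x p)" and nn: "AE p in P. 0 \<le> (\<Prod>x\<in>C. v x p)" if "C \<subseteq> B" for C
    proof -
      have ae: "AE p in P. (\<Prod>x\<in>C. v x p) \<in> {0..1}"
        using v01 by eventually_elim (use that in \<open>blast intro: prod_mem_unit_interval\<close>)
      then show "AE p in P. 0 \<le> (\<Prod>x\<in>C. v x p)" by auto
      show "integrable P (\<lambda>p. \<Prod>x\<in>C. v x p)"
        using ae P(2) B that by (intro P.integrable_const_bound[of _ 1] borel_measurable_prod) auto
    qed
    have "ennreal (\<integral>p. (\<Prod>x\<in>B. v x p) \<partial>P) = (\<integral>\<^sup>+p. ennreal (\<Prod>x\<in>B. v x p) \<partial>P)"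
      by (rule nn_integral_eq_integral[symmetric, OF int nn]) auto
    also have "\<dots> = ennreal (\<Sum>X\<in>Pow B. \<kappa> X (B - X) * (\<integral>p. (\<Prod>x\<in>B - X. v x p) \<partial>P))"
      unfolding P(4)[OF B] \<kappa>_def
      by (rule integral_convex_combination_monomial)
         (use B A t_range d P v01 prob_space_axioms finite_subset in auto)
    finally show ?thesis
    proof (subst (asm) ennreal_inj)
      show "0 \<le> (\<integral>p. (\<Prod>x\<in>B. v x p) \<partial>P)" using nn[of B] by (intro integral_nonneg_AE) auto
      show "0 \<le> (\<Sum>X\<in>Pow B. \<kappa> X (B - X) * (\<integral>p. (\<Prod>x\<in>B - X. v x p) \<partial>P))"
        unfolding \<kappa>_def
      proof (intro sum_nonneg mult_nonneg_nonneg)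
        fix X assume X: "X \<in> Pow B"
        then show "0 \<le> (\<integral>\<omega>. (\<Prod>x\<in>X. t \<omega> * d x \<omega>) * (\<Prod>x\<in>B - X. 1 - t \<omega>) \<partial>M)"
          using t_range d(2) B
          by (intro integral_nonneg_AE AE_I2 mult_nonneg_nonneg prod_nonneg) (auto intro!: mult_nonneg_nonneg)
        show "0 \<le> (\<integral>p. (\<Prod>x\<in>B - X. v x p) \<partial>P)"
          by (intro integral_nonneg_AE nn) auto
      qed
    qed
  qed
  show ?thesis
  proof (rule subset_recursion_unique[where \<kappa>=\<kappa>, OF A])
    interpret P1: prob_space P1 by fact
    interpret P2: prob_space P2 by fact
    show "(\<integral>p. (\<Prod>x\<in>{}. u x p) \<partial>P1) = (\<integral>p. (\<Prod>x\<in>{}. u' x p) \<partial>P2)"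
      by (simp add: P1.prob_space P2.prob_space)
    show "\<kappa> {} B \<noteq> 1" if "B \<subseteq> A" "B \<noteq> {}" for B
      using integral_power_less_1[of B] that finite_subset[OF _ A] by (auto simp: \<kappa>_def)
    show "(\<integral>p. (\<Prod>x\<in>B. u x p) \<partial>P1) = (\<Sum>X\<in>Pow B. \<kappa> X (B - X) * (\<integral>p. (\<Prod>x\<in>B - X. u x p) \<partial>P1))"
      if "B \<subseteq> A" for B by (rule rec[OF P1 that])
    show "(\<integral>p. (\<Prod>x\<in>B. u' x p) \<partial>P2) = (\<Sum>X\<in>Pow B. \<kappa> X (B - X) * (\<integral>p. (\<Prod>x\<in>B - X. u' x p) \<partial>P2))"
      if "B \<subseteq> A" for B by (rule rec[OF P2 that])
  qed
qed

lemma invariant_fixed_moments: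
  fixes S :: "'i \<Rightarrow> 'a set"
  assumes Q: "invariant_measure prob_measures kernel Q" and A: "finite A" "\<And>x. x \<in> A \<Longrightarrow> S (fst x) \<in> sets borel"
  shows "(\<integral>\<^sup>+p. ennreal (\<Prod>x\<in>A. measure p (S (fst x))) \<partial>Q)
    = (\<integral>\<^sup>+\<omega>. (\<integral>\<^sup>+p. ennreal (\<Prod>x\<in>A. t \<omega> * measure (D \<omega>) (S (fst x)) + (1 - t \<omega>) * measure p (S (fst x))) \<partial>Q) \<partial>M)"
proof -
  have Q': "sets Q = sets prob_measures" using Q by (simp add: invariant_measure_def)
  have m: "(\<lambda>p. measure p (S (fst x))) \<in> borel_measurable prob_measures" if "x \<in> A" for x
    using measurable_measure_prob_algebra[OF A(2)[OF that]] by (simp cong: measurable_cong_sets add: sets_prob_measures)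
  have "(\<lambda>p. ennreal (\<Prod>x\<in>A. measure p (S (fst x)))) \<in> borel_measurable prob_measures"
    using m by (intro measurable_compose[OF borel_measurable_prod measurable_ennreal]) auto
  from nn_integral_invariant[OF Q this] show ?thesis
    using sets_eq_imp_space_eq[OF Q'] t_range measurable_space[OF D]
    by (simp only:) (intro nn_integral_cong arg_cong[where f=ennreal] prod.cong refl measure_mix, auto simp: space_prob_measures)
qed

lemma measure_in_unit_interval: "p \<in> space (prob_algebra N) \<Longrightarrow> measure p A \<in> {0..1}"
  using prob_space.prob_le_1[of p A] by (auto simp: space_prob_algebra)

text \<open>The fixed point equation determines the moments, and moments determine laws on the unit
  cube. This serves twice: with all Borel sets as indices, where \<open>P\<close> comes from a
  second invariant law, and with a finite partition, where \<open>P\<close> is a Dirichlet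
  law.\<close>

lemma invariant_masses_eq:
  fixes S :: "'i \<Rightarrow> 'a set" and P :: "('i \<Rightarrow> real) measure"
  assumes Q: "invariant_measure prob_measures kernel Q" and S: "\<And>i. i \<in> I \<Longrightarrow> S i \<in> sets borel"
    and P: "prob_space P" "sets P = sets (\<Pi>\<^sub>M i\<in>I. borel)" "\<And>i. i \<in> I \<Longrightarrow> AE v in P. v i \<in> {0..1}"
    and fp: "\<And>A :: ('i \<times> nat) set. finite A \<Longrightarrow> fst ` A \<subseteq> I \<Longrightarrow>
      (\<integral>\<^sup>+v. ennreal (\<Prod>x\<in>A. v (fst x)) \<partial>P)
      = (\<integral>\<^sup>+\<omega>. (\<integral>\<^sup>+v. ennreal (\<Prod>x\<in>A. t \<omega> * measure (D \<omega>) (S (fst x)) + (1 - t \<omega>) * v (fst x)) \<partial>P) \<partial>M)"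
  shows "distr Q (\<Pi>\<^sub>M i\<in>I. borel) (\<lambda>p. \<lambda>i\<in>I. measure p (S i)) = P"
proof -
  have Q': "prob_space Q" "sets Q = sets prob_measures" using Q by (auto simp: invariant_measure_def)
  interpret Q: prob_space Q by fact
  have spQ: "space Q = space (prob_algebra borel)" using sets_eq_imp_space_eq[OF Q'(2)] by (simp add: space_prob_measures)
  have mS: "(\<lambda>p. measure p (S i)) \<in> borel_measurable Q" if "i \<in> I" for i
    using measurable_measure_prob_algebra[OF S[OF that]] by (simp cong: measurable_cong_sets add: sets_prob_measures Q'(2))
  have mv: "(\<lambda>p. \<lambda>i\<in>I. measure p (S i)) \<in> Q \<rightarrow>\<^sub>M (\<Pi>\<^sub>M i\<in>I. borel)"
    using mS by (intro measurable_restrict)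
  have mP: "(\<lambda>v. v i) \<in> borel_measurable P" if "i \<in> I" for i
    using measurable_component_singleton[OF that, of "\<lambda>_. borel"] by (simp cong: measurable_cong_sets add: P(2))
  show ?thesis
  proof (rule prob_PiM_eqI_moments[OF _ _ _ P])
    show "prob_space (distr Q (\<Pi>\<^sub>M i\<in>I. borel) (\<lambda>p. \<lambda>i\<in>I. measure p (S i)))"
      by (rule Q.prob_space_distr[OF mv])
    show "AE v in distr Q (\<Pi>\<^sub>M i\<in>I. borel) (\<lambda>p. \<lambda>i\<in>I. measure p (S i)). v i \<in> {0..1}" if "i \<in> I" for i
    proof (subst AE_distr_iff[OF mv])
      show "{x \<in> space (\<Pi>\<^sub>M i\<in>I. borel). x i \<in> {0..1::real}} \<in> sets (\<Pi>\<^sub>M i\<in>I. borel)"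
        using that by measurable
      show "AE p in Q. (\<lambda>i\<in>I. measure p (S i)) i \<in> {0..1}"
        using measure_in_unit_interval that by (intro AE_I2) (auto simp: spQ)
    qed
    fix A :: "('i \<times> nat) set" assume A: "finite A" "fst ` A \<subseteq> I"
    have AI: "x \<in> A \<Longrightarrow> fst x \<in> I" for x using A by auto
    have "(\<integral>v. (\<Prod>x\<in>A. v (fst x)) \<partial>distr Q (\<Pi>\<^sub>M i\<in>I. borel) (\<lambda>p. \<lambda>i\<in>I. measure p (S i)))
       = (\<integral>p. (\<Prod>x\<in>A. (\<lambda>i\<in>I. measure p (S i)) (fst x)) \<partial>Q)"
      using AI by (intro integral_distr[OF mv] borel_measurable_prod measurable_component_singleton) auto
    also have "\<dots> = (\<integral>p. (\<Prod>x\<in>A. measure p (S (fst x))) \<partial>Q)"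
      using AI by (intro Bochner_Integration.integral_cong prod.cong) auto
    also have "\<dots> = (\<integral>v. (\<Prod>x\<in>A. v (fst x)) \<partial>P)"
    proof (rule fixed_moments_unique[where d="\<lambda>x \<omega>. measure (D \<omega>) (S (fst x))" and u="\<lambda>x p. measure p (S (fst x))" and u'="\<lambda>x v. v (fst x)"])
      show "(\<lambda>\<omega>. measure (D \<omega>) (S (fst x))) \<in> borel_measurable M" if "x \<in> A" for x
        using measurable_compose[OF D measurable_measure_prob_algebra[OF S[OF AI[OF that]]]] .
      show "measure (D \<omega>) (S (fst x)) \<in> {0..1}" if "x \<in> A" "\<omega> \<in> space M" for x \<omega>
        using measure_in_unit_interval measurable_space[OF D that(2)] by blast
      show "AE p in Q. \<forall>x\<in>A. measure p (S (fst x)) \<in> {0..1}"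
        using measure_in_unit_interval by (intro AE_I2) (auto simp: spQ)
      show "AE v in P. \<forall>x\<in>A. v (fst x) \<in> {0..1}"
        using A AI P(3) by (intro AE_finite_allI) auto
      fix B assume B: "B \<subseteq> A"
      then have B': "finite B" "fst ` B \<subseteq> I" using A finite_subset by auto
      show "(\<integral>\<^sup>+p. ennreal (\<Prod>x\<in>B. measure p (S (fst x))) \<partial>Q)
        = (\<integral>\<^sup>+\<omega>. (\<integral>\<^sup>+p. ennreal (\<Prod>x\<in>B. t \<omega> * measure (D \<omega>) (S (fst x)) + (1 - t \<omega>) * measure p (S (fst x))) \<partial>Q) \<partial>M)"
        using B' S by (intro invariant_fixed_moments Q) auto
      show "(\<integral>\<^sup>+v. ennreal (\<Prod>x\<in>B. v (fst x)) \<partial>P)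
        = (\<integral>\<^sup>+\<omega>. (\<integral>\<^sup>+v. ennreal (\<Prod>x\<in>B. t \<omega> * measure (D \<omega>) (S (fst x)) + (1 - t \<omega>) * v (fst x)) \<partial>P) \<partial>M)"
        by (rule fp[OF B'])
    qed (use A AI mS mP Q' P in auto)
    finally show "(\<integral>v. (\<Prod>x\<in>A. v (fst x)) \<partial>distr Q (\<Pi>\<^sub>M i\<in>I. borel) (\<lambda>p. \<lambda>i\<in>I. measure p (S i)))
       = (\<integral>v. (\<Prod>x\<in>A. v (fst x)) \<partial>P)" .
  qed simp
qed

end

text \<open>The sigma-algebra of \<open>prob_algebra\<close> is contained in the pull-back
  \<open>V\<close> of the product over all Borel sets along the map sending \<open>p\<close> to its
  masses. Every event is thus a preimage, and the law of the mass family decides its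
  probability.\<close>

lemma prob_algebra_measure_eqI:
  fixes Q1 Q2 :: "'a::topological_space measure measure"
  assumes Q1: "sets Q1 = sets (prob_algebra borel)" and Q2: "sets Q2 = sets (prob_algebra borel)"
    and eq: "distr Q1 (\<Pi>\<^sub>M A\<in>sets borel. borel) (\<lambda>p. \<lambda>A\<in>sets borel. measure p A)
      = distr Q2 (\<Pi>\<^sub>M A\<in>sets borel. borel) (\<lambda>p. \<lambda>A\<in>sets borel. measure p A)"
  shows "Q1 = Q2"
proof -
  let ?P = "\<Pi>\<^sub>M A\<in>sets (borel::'a measure). (borel :: real measure)"
  let ?e = "\<lambda>p. \<lambda>A\<in>sets (borel::'a measure). measure p A"
  let ?PA = "prob_algebra (borel::'a measure)"
  have me: "?e \<in> ?PA \<rightarrow>\<^sub>M ?P"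
    by (intro measurable_restrict measurable_measure_prob_algebra)
  define V where "V = vimage_algebra (space ?PA) ?e ?P"
  have fe: "?e \<in> space ?PA \<rightarrow> space ?P" using measurable_space[OF me] by auto
  have eV: "?e \<in> V \<rightarrow>\<^sub>M ?P" unfolding V_def using fe by (rule measurable_vimage_algebra1)
  have spV: "space V = space ?PA" by (simp add: V_def)
  have "(\<lambda>p. p) \<in> V \<rightarrow>\<^sub>M ?PA"
  proof (rule measurable_prob_algebraI)
    show "(\<lambda>p. p) \<in> V \<rightarrow>\<^sub>M subprob_algebra borel"
    proof (rule measurable_subprob_algebra)
      fix A :: "'a set" assume A: "A \<in> sets borel"
      have "(\<lambda>p. ennreal (?e p A)) \<in> borel_measurable V"
        using measurable_compose[OF eV measurable_component_singleton[OF A]] by (intro measurable_compose[OF _ measurable_ennreal])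
      also have "?this \<longleftrightarrow> (\<lambda>p. emeasure p A) \<in> borel_measurable V"
        using A by (intro measurable_cong) (auto simp: spV space_prob_algebra finite_measure.emeasure_eq_measure prob_space.finite_measure)
      finally show "(\<lambda>p. emeasure p A) \<in> borel_measurable V" .
    qed (auto simp: spV space_prob_algebra prob_space_imp_subprob_space)
  qed (auto simp: spV space_prob_algebra)
  then have V: "A \<in> sets V" if "A \<in> sets ?PA" for A
    using measurable_sets[of "\<lambda>p. p" V ?PA A] that sets.sets_into_space[OF that] by (simp add: spV Int_absorb2)
  show ?thesis
  proof (rule measure_eqI)
    show "sets Q1 = sets Q2" using Q1 Q2 by simp
    fix A assume "A \<in> sets Q1"
    then have A: "A \<in> sets V" using V Q1 by simp
    then obtain T where T: "T \<in> sets ?P" "A = ?e -` T \<inter> space ?PA"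
      unfolding V_def using sets_vimage_algebra2[OF fe] by auto
    have "emeasure Q A = emeasure (distr Q ?P ?e) T" if "sets Q = sets ?PA" for Q
      using T me sets_eq_imp_space_eq[OF that] by (subst emeasure_distr) (auto cong: measurable_cong_sets simp: that)
    then show "emeasure Q1 A = emeasure Q2 A" using eq Q1 Q2 by simp
  qed
qed

section \<open>Uniqueness of the invariant law\<close>

context random_mixture begin

text \<open>The masses of \<open>Q2\<close> on all Borel sets at once play the role of the law
  \<open>P\<close>; invariance of \<open>Q2\<close> supplies the fixed point equation.\<close>

lemma invariant_unique:
  assumes Q1: "invariant_measure prob_measures kernel Q1" and Q2: "invariant_measure prob_measures kernel Q2"
  shows "Q1 = Q2"
proof (rule prob_algebra_measure_eqI)
  let ?P = "\<Pi>\<^sub>M A\<in>sets (borel::'a measure). (borel :: real measure)"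
  let ?e = "\<lambda>p. \<lambda>A\<in>sets (borel::'a measure). measure p A"
  have Q2': "prob_space Q2" "sets Q2 = sets prob_measures" using Q2 by (auto simp: invariant_measure_def)
  then interpret Q2: prob_space Q2 by simp
  have me: "?e \<in> Q2 \<rightarrow>\<^sub>M ?P"
    using measurable_restrict[of "sets borel" "\<lambda>A p. measure p A" "prob_algebra (borel::'a measure)" "\<lambda>_. borel"] measurable_measure_prob_algebra
    by (simp cong: measurable_cong_sets add: Q2'(2) sets_prob_measures)
  have spQ: "space Q2 = space (prob_algebra borel)" using sets_eq_imp_space_eq[OF Q2'(2)] by (simp add: space_prob_measures)
  show "distr Q1 ?P ?e = distr Q2 ?P ?e"
  proof (rule invariant_masses_eq[OF Q1, of "sets borel" "\<lambda>A. A"])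
    show "prob_space (distr Q2 ?P ?e)" by (rule Q2.prob_space_distr[OF me])
    show "AE v in distr Q2 ?P ?e. v i \<in> {0..1}" if "i \<in> sets borel" for i
    proof (subst AE_distr_iff[OF me])
      show "{x \<in> space ?P. x i \<in> {0..1::real}} \<in> sets ?P"
        using that by measurable
      show "AE p in Q2. ?e p i \<in> {0..1}"
        using measure_in_unit_interval that by (intro AE_I2) (auto simp: spQ)
    qed
    fix A :: "('a set \<times> nat) set" assume A: "finite A" "fst ` A \<subseteq> sets borel"
    have AI: "x \<in> A \<Longrightarrow> fst x \<in> sets borel" for x using A by auto
    \<comment> \<open>One transport rule for both sides of the fixed point equation:
      \<open>f x\<close> is the identity on one side and an affine function of the mass on the
      other.\<close>
    have ev: "(\<integral>\<^sup>+v. ennreal (\<Prod>x\<in>A. f x (v (fst x))) \<partial>distr Q2 ?P ?e) = (\<integral>\<^sup>+p. ennreal (\<Prod>x\<in>A. f x (measure p (fst x))) \<partial>Q2)"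
      if "\<And>x. f x \<in> borel_measurable borel" for f :: "_ \<Rightarrow> real \<Rightarrow> real"
    proof -
      have "(\<lambda>v. f x (v (fst x))) \<in> borel_measurable ?P" if "x \<in> A" for x
        using measurable_compose[OF measurable_component_singleton[OF AI[OF that]] \<open>f x \<in> borel_measurable borel\<close>] .
      then have "(\<lambda>v. ennreal (\<Prod>x\<in>A. f x (v (fst x)))) \<in> borel_measurable ?P"
        by measurable
      then have "(\<integral>\<^sup>+v. ennreal (\<Prod>x\<in>A. f x (v (fst x))) \<partial>distr Q2 ?P ?e) = (\<integral>\<^sup>+p. ennreal (\<Prod>x\<in>A. f x (?e p (fst x))) \<partial>Q2)"
        by (intro nn_integral_distr[OF me]) simp
      also have "\<dots> = (\<integral>\<^sup>+p. ennreal (\<Prod>x\<in>A. f x (measure p (fst x))) \<partial>Q2)"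
        using AI by (intro nn_integral_cong arg_cong[where f=ennreal] prod.cong) auto
      finally show ?thesis .
    qed
    show "(\<integral>\<^sup>+v. ennreal (\<Prod>x\<in>A. v (fst x)) \<partial>distr Q2 ?P ?e)
      = (\<integral>\<^sup>+\<omega>. (\<integral>\<^sup>+v. ennreal (\<Prod>x\<in>A. t \<omega> * measure (D \<omega>) (fst x) + (1 - t \<omega>) * v (fst x)) \<partial>distr Q2 ?P ?e) \<partial>M)"
    proof -
      have "(\<integral>\<^sup>+v. ennreal (\<Prod>x\<in>A. t \<omega> * measure (D \<omega>) (fst x) + (1 - t \<omega>) * v (fst x)) \<partial>distr Q2 ?P ?e)
         = (\<integral>\<^sup>+p. ennreal (\<Prod>x\<in>A. t \<omega> * measure (D \<omega>) (fst x) + (1 - t \<omega>) * measure p (fst x)) \<partial>Q2)" for \<omega>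
        by (rule ev) measurable
      moreover have "(\<integral>\<^sup>+v. ennreal (\<Prod>x\<in>A. v (fst x)) \<partial>distr Q2 ?P ?e) = (\<integral>\<^sup>+p. ennreal (\<Prod>x\<in>A. measure p (fst x)) \<partial>Q2)"
        by (rule ev) measurable
      ultimately show ?thesis
        using invariant_fixed_moments[OF Q2 A(1), of "\<lambda>x. x"] AI by simp
    qed
  qed auto
qed (use assms in \<open>auto simp: invariant_measure_def sets_prob_measures\<close>)

end

section \<open>Existence of an invariant law\<close>

context random_mixture begin

text \<open>Prepending an independent sample to an i.i.d. sequence does not change the law of the
  sequence; here in the form of integrals, with the new sample integrated first.\<close>

lemma PiM_iter_nn_integral:
  assumes f: "f \<in> borel_measurable (\<Pi>\<^sub>M i\<in>UNIV::nat set. M)"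
  shows "(\<integral>\<^sup>+\<omega>. f \<omega> \<partial>(\<Pi>\<^sub>M i\<in>UNIV. M)) = (\<integral>\<^sup>+\<omega>. (\<integral>\<^sup>+s. f (case_nat s \<omega>) \<partial>M) \<partial>(\<Pi>\<^sub>M i\<in>UNIV. M))"
proof -
  interpret S: sequence_space M ..
  let ?S = "\<Pi>\<^sub>M i\<in>UNIV::nat set. M"
  interpret prob_space ?S by (rule prob_space_PiM, rule prob_space_axioms)
  interpret pair_sigma_finite M ?S ..
  have mc: "(\<lambda>(s, \<omega>). case_nat s \<omega>) \<in> M \<Otimes>\<^sub>M ?S \<rightarrow>\<^sub>M ?S"
    by measurable
  have "(\<integral>\<^sup>+\<omega>. f \<omega> \<partial>?S) = (\<integral>\<^sup>+\<omega>. f \<omega> \<partial>distr (M \<Otimes>\<^sub>M ?S) ?S (\<lambda>(s, \<omega>). case_nat s \<omega>))"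
    by (simp add: S.PiM_iter)
  also have "\<dots> = (\<integral>\<^sup>+(s, \<omega>). f (case_nat s \<omega>) \<partial>(M \<Otimes>\<^sub>M ?S))"
    using f by (subst nn_integral_distr[OF mc]) (auto simp: case_prod_unfold)
  also have "\<dots> = (\<integral>\<^sup>+\<omega>. (\<integral>\<^sup>+s. f (case_nat s \<omega>) \<partial>M) \<partial>?S)"
    using measurable_compose[OF mc f] by (subst nn_integral_snd[symmetric]) (auto simp: case_prod_unfold)
  finally show ?thesis .
qed

text \<open>The weight of the \<open>m\<close>-th measure when
  \<open>t_0 D_0 + (1 - t_0) (t_1 D_1 + ...)\<close> is multiplied out. Index \<open>0\<close>
  belongs to the latest step, so one more step of the chain prepends a sample.\<close>

definition stick :: "nat \<Rightarrow> (nat \<Rightarrow> 'w) \<Rightarrow> real" where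
  "stick m \<omega> = t (\<omega> m) * (\<Prod>l<m. 1 - t (\<omega> l))"

lemma stick_nonneg: "\<omega> \<in> space (\<Pi>\<^sub>M i\<in>UNIV. M) \<Longrightarrow> 0 \<le> stick m \<omega>"
  using t_range unfolding stick_def by (auto intro!: mult_nonneg_nonneg prod_nonneg simp: space_PiM PiE_iff)

lemma sum_stick: "(\<Sum>l<m. stick l \<omega>) = 1 - (\<Prod>l<m. 1 - t (\<omega> l))"
  by (induction m) (auto simp: stick_def algebra_simps)

lemma stick_case_nat:
  "stick 0 (case_nat s \<omega>) = t s" "stick (Suc m) (case_nat s \<omega>) = (1 - t s) * stick m \<omega>"
  by (auto simp: stick_def prod.lessThan_Suc_shift simp del: prod.lessThan_Suc)

lemma measurable_stick [measurable]: "stick m \<in> borel_measurable (\<Pi>\<^sub>M i\<in>UNIV. M)"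
  unfolding stick_def by measurable

lemma integral_t_bounds: "integrable M t" "(\<integral>\<omega>. t \<omega> \<partial>M) \<le> 1"
proof -
  show i: "integrable M t" using t_range by (intro integrable_const_bound[of _ 1]) auto
  have "(\<integral>\<omega>. t \<omega> \<partial>M) \<le> (\<integral>\<omega>. 1 \<partial>M)" using t_range i by (intro integral_mono) auto
  then show "(\<integral>\<omega>. t \<omega> \<partial>M) \<le> 1" by (simp add: prob_space)
qed

text \<open>Splitting off the first sample multiplies the expectation by \<open>E (1 - t)\<close>,
  so the expected weights form a geometric sequence.\<close>

lemma nn_integral_stick:
  "(\<integral>\<^sup>+\<omega>. ennreal (stick m \<omega>) \<partial>(\<Pi>\<^sub>M i\<in>UNIV. M)) = ennreal ((1 - (\<integral>\<omega>. t \<omega> \<partial>M)) ^ m * (\<integral>\<omega>. t \<omega> \<partial>M))"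
proof (induction m)
  case 0
  interpret S: prob_space "\<Pi>\<^sub>M i\<in>UNIV::nat set. M" by (rule prob_space_PiM, rule prob_space_axioms)
  have "(\<integral>\<^sup>+s. ennreal (t s) \<partial>M) = ennreal (\<integral>s. t s \<partial>M)"
    using integral_t_bounds(1) t_range by (intro nn_integral_eq_integral) auto
  then show ?case
    by (subst PiM_iter_nn_integral) (auto simp: stick_case_nat S.emeasure_space_1)
next
  case (Suc m)
  let ?\<tau> = "\<integral>\<omega>. t \<omega> \<partial>M"
  have "(\<integral>\<^sup>+s. ennreal (1 - t s) \<partial>M) = ennreal (\<integral>s. 1 - t s \<partial>M)"
    using integral_t_bounds(1) t_range by (intro nn_integral_eq_integral) auto
  also have "(\<integral>s. 1 - t s \<partial>M) = 1 - ?\<tau>" using integral_t_bounds(1) by (simp add: prob_space)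
  finally have 1: "(\<integral>\<^sup>+s. ennreal (1 - t s) \<partial>M) = ennreal (1 - ?\<tau>)" .
  have "(\<integral>\<^sup>+\<omega>. ennreal (stick (Suc m) \<omega>) \<partial>(\<Pi>\<^sub>M i\<in>UNIV. M))
    = (\<integral>\<^sup>+\<omega>. (\<integral>\<^sup>+s. ennreal (1 - t s) * ennreal (stick m \<omega>) \<partial>M) \<partial>(\<Pi>\<^sub>M i\<in>UNIV. M))"
    using t_range stick_nonneg by (subst PiM_iter_nn_integral) (auto simp: stick_case_nat ennreal_mult intro!: nn_integral_cong)
  also have "\<dots> = (\<integral>\<^sup>+\<omega>. ennreal (1 - ?\<tau>) * ennreal (stick m \<omega>) \<partial>(\<Pi>\<^sub>M i\<in>UNIV. M))"
    by (simp add: nn_integral_multc 1)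
  also have "\<dots> = ennreal (1 - ?\<tau>) * (\<integral>\<^sup>+\<omega>. ennreal (stick m \<omega>) \<partial>(\<Pi>\<^sub>M i\<in>UNIV. M))"
    by (rule nn_integral_cmult) measurable
  also have "\<dots> = ennreal ((1 - ?\<tau>) ^ Suc m * ?\<tau>)"
    using integral_t_bounds t_pos unfolding Suc.IH by (simp add: ennreal_mult[symmetric] mult_ac)
  finally show ?case .
qed

lemma suminf_stick_le:
  assumes "\<omega> \<in> space (\<Pi>\<^sub>M i\<in>UNIV. M)"
  shows "(\<Sum>m. ennreal (stick m \<omega>)) \<le> 1"
proof -
  have "(\<Sum>l<m. ennreal (stick l \<omega>)) \<le> 1" for m
  proof -
    have "(\<Sum>l<m. ennreal (stick l \<omega>)) = ennreal (1 - (\<Prod>l<m. 1 - t (\<omega> l)))"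
      using stick_nonneg[OF assms] by (simp add: sum_ennreal sum_stick[symmetric])
    also have "\<dots> \<le> ennreal 1"
      using assms t_range by (intro ennreal_leI) (auto intro!: prod_nonneg simp: space_PiM PiE_iff)
    finally show ?thesis by simp
  qed
  then show ?thesis by (intro suminf_le_const) auto
qed

text \<open>The weights sum to at most one everywhere, and to one in expectation by the geometric
  series with ratio \<open>1 - E t\<close>; hence the deficit, being nonnegative with integral
  \<open>0\<close>, vanishes almost surely.\<close>

lemma AE_suminf_stick: "AE \<omega> in \<Pi>\<^sub>M i\<in>UNIV. M. (\<Sum>m. ennreal (stick m \<omega>)) = 1"
proof -
  interpret S: prob_space "\<Pi>\<^sub>M i\<in>UNIV::nat set. M" by (rule prob_space_PiM, rule prob_space_axioms)
  let ?S = "\<Pi>\<^sub>M i\<in>UNIV::nat set. M"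
  let ?\<tau> = "\<integral>\<omega>. t \<omega> \<partial>M"
  have "(\<lambda>m. (1 - ?\<tau>) ^ m * ?\<tau>) sums (1 / (1 - (1 - ?\<tau>)) * ?\<tau>)"
    using t_pos integral_t_bounds(2) by (intro sums_mult2 geometric_sums) auto
  then have "(\<lambda>m. (1 - ?\<tau>) ^ m * ?\<tau>) sums 1" using t_pos by simp
  then have "(\<Sum>m. ennreal ((1 - ?\<tau>) ^ m * ?\<tau>)) = ennreal 1"
    using t_pos integral_t_bounds(2) by (intro suminf_ennreal_eq) auto
  then have i: "(\<integral>\<^sup>+\<omega>. (\<Sum>m. ennreal (stick m \<omega>)) \<partial>?S) = 1"
    by (subst nn_integral_suminf) (auto simp: nn_integral_stick)
  have "(\<integral>\<^sup>+\<omega>. 1 - (\<Sum>m. ennreal (stick m \<omega>)) \<partial>?S) = (\<integral>\<^sup>+\<omega>. 1 \<partial>?S) - (\<integral>\<^sup>+\<omega>. (\<Sum>m. ennreal (stick m \<omega>)) \<partial>?S)"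
    using i suminf_stick_le by (intro nn_integral_diff) auto
  also have "\<dots> = 0" unfolding i by (simp add: S.emeasure_space_1)
  finally have "AE \<omega> in ?S. 1 - (\<Sum>m. ennreal (stick m \<omega>)) = 0"
    by (subst (asm) nn_integral_0_iff_AE) auto
  then show ?thesis
    using suminf_stick_le by (auto simp: diff_eq_0_iff_ennreal intro: antisym)
qed

text \<open>The bind over a weighted counting measure is a countable mixture. Where the weights fail
  to sum to one, which is a null event, a fixed point mass keeps the value a probability
  measure.\<close>

definition series :: "(nat \<Rightarrow> 'w) \<Rightarrow> 'a measure" where
  "series \<omega> = (if (\<Sum>m. ennreal (stick m \<omega>)) = 1
     then density (count_space UNIV) (\<lambda>m. ennreal (stick m \<omega>)) \<bind> (\<lambda>m. D (\<omega> m)) else return borel undefined)"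

lemma D_seq: "\<omega> \<in> space (\<Pi>\<^sub>M i\<in>UNIV. M) \<Longrightarrow> D (\<omega> m) \<in> space (prob_algebra borel)"
  using measurable_space[OF D] by (auto simp: space_PiM PiE_iff)

lemma sets_series [simp]:
  assumes "\<omega> \<in> space (\<Pi>\<^sub>M i\<in>UNIV. M)"
  shows "sets (series \<omega>) = sets borel"
proof -
  have "sets (D (\<omega> m)) = sets borel" for m using D_seq[OF assms] by (simp add: space_prob_algebra)
  then show ?thesis unfolding series_def by (simp add: sets_bind[where N=borel])
qed

lemma emeasure_series:
  assumes \<omega>: "\<omega> \<in> space (\<Pi>\<^sub>M i\<in>UNIV. M)" and 1: "(\<Sum>m. ennreal (stick m \<omega>)) = 1" and A: "A \<in> sets borel"
  shows "emeasure (series \<omega>) A = (\<Sum>m. ennreal (stick m \<omega>) * emeasure (D (\<omega> m)) A)"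
proof -
  have "(\<lambda>m. D (\<omega> m)) \<in> density (count_space UNIV) (\<lambda>m. ennreal (stick m \<omega>)) \<rightarrow>\<^sub>M subprob_algebra borel"
    using D_seq[OF \<omega>] by (auto simp: space_prob_algebra space_subprob_algebra prob_space_imp_subprob_space)
  then show ?thesis
    using 1 A unfolding series_def
    by (subst if_P, simp, subst emeasure_bind) (auto simp: nn_integral_density nn_integral_count_space_nat)
qed

lemma series_in_prob_algebra:
  assumes \<omega>: "\<omega> \<in> space (\<Pi>\<^sub>M i\<in>UNIV. M)"
  shows "series \<omega> \<in> space (prob_algebra borel)"
proof (cases "(\<Sum>m. ennreal (stick m \<omega>)) = 1")
  case True
  have "emeasure (D (\<omega> m)) UNIV = 1" for m
    using D_seq[OF \<omega>, of m] sets_eq_imp_space_eq[of "D (\<omega> m)" borel] prob_space.emeasure_space_1[of "D (\<omega> m)"]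
    by (auto simp: space_prob_algebra)
  then have "emeasure (series \<omega>) UNIV = 1"
    using emeasure_series[OF \<omega> True, of UNIV] True by simp
  then show ?thesis
    using sets_series[OF \<omega>] sets_eq_imp_space_eq[OF sets_series[OF \<omega>]] by (auto simp: space_prob_algebra intro!: prob_spaceI)
next
  case False
  then show ?thesis by (simp add: series_def space_prob_algebra prob_space_return)
qed

lemma measurable_series: "series \<in> (\<Pi>\<^sub>M i\<in>UNIV. M) \<rightarrow>\<^sub>M prob_algebra borel"
proof (rule measurable_prob_algebraI)
  let ?S = "\<Pi>\<^sub>M i\<in>UNIV::nat set. M"
  show "prob_space (series \<omega>)" if "\<omega> \<in> space ?S" for \<omega>
    using series_in_prob_algebra[OF that] by (simp add: space_prob_algebra)
  show "series \<in> ?S \<rightarrow>\<^sub>M subprob_algebra borel"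
  proof (rule measurable_subprob_algebra)
    fix \<omega> assume "\<omega> \<in> space ?S"
    then show "subprob_space (series \<omega>)" "sets (series \<omega>) = sets borel"
      using series_in_prob_algebra[of \<omega>] by (auto simp: space_prob_algebra prob_space_imp_subprob_space)
  next
    fix A :: "'a set" assume A[measurable]: "A \<in> sets borel"
    have [measurable]: "(\<lambda>\<omega>. emeasure (D (\<omega> m)) A) \<in> borel_measurable ?S" for m
      using measurable_compose[OF measurable_compose[OF measurable_component_singleton[of m UNIV "\<lambda>_. M"] D] measurable_emeasure_prob_algebra[OF A]] by simp
    have "(\<lambda>\<omega>. if (\<Sum>m. ennreal (stick m \<omega>)) = 1 then (\<Sum>m. ennreal (stick m \<omega>) * emeasure (D (\<omega> m)) A)
        else emeasure (return borel undefined) A) \<in> borel_measurable ?S"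
      by measurable
    also have "?this \<longleftrightarrow> (\<lambda>\<omega>. emeasure (series \<omega>) A) \<in> borel_measurable ?S"
      using A emeasure_series by (intro measurable_cong) (auto simp: series_def)
    finally show "(\<lambda>\<omega>. emeasure (series \<omega>) A) \<in> borel_measurable ?S" .
  qed
qed

text \<open>Prepending a sample multiplies all weights by \<open>1 - t s\<close> and inserts
  \<open>D s\<close> with weight \<open>t s\<close>, which is one step of the recursion. The weights
  still sum to one, so neither side falls back to the default value.\<close>

lemma series_case_nat:
  assumes \<omega>: "\<omega> \<in> space (\<Pi>\<^sub>M i\<in>UNIV. M)" and s: "s \<in> space M" and 1: "(\<Sum>m. ennreal (stick m \<omega>)) = 1"
  shows "series (case_nat s \<omega>) = mix (t s) (D s) (series \<omega>)"
proof -
  have s\<omega>: "case_nat s \<omega> \<in> space (\<Pi>\<^sub>M i\<in>UNIV. M)"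
    using \<omega> s by (auto simp: space_PiM PiE_iff split: nat.split)
  have split: "(\<Sum>m. ennreal (stick m (case_nat s \<omega>)) * x m) = ennreal (t s) * x 0 + ennreal (1 - t s) * (\<Sum>m. ennreal (stick m \<omega>) * x (Suc m))" for x
  proof -
    have "(\<Sum>m. ennreal (stick m (case_nat s \<omega>)) * x m) = (\<Sum>m. ennreal (stick (m + 1) (case_nat s \<omega>)) * x (m + 1)) + (\<Sum>m<1. ennreal (stick m (case_nat s \<omega>)) * x m)"
      by (rule suminf_offset) auto
    also have "(\<Sum>m. ennreal (stick (m + 1) (case_nat s \<omega>)) * x (m + 1)) = (\<Sum>m. ennreal (1 - t s) * (ennreal (stick m \<omega>) * x (Suc m)))"
      using t_range[OF s] stick_nonneg[OF \<omega>] by (simp add: stick_case_nat ennreal_mult mult.assoc)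
    finally show ?thesis by (simp add: stick_case_nat ennreal_suminf_cmult add.commute)
  qed
  have "(\<Sum>m. ennreal (stick m (case_nat s \<omega>))) = ennreal (t s) + ennreal (1 - t s)"
    using split[of "\<lambda>_. 1"] 1 by simp
  also have "\<dots> = 1" using t_range[OF s] by (simp add: ennreal_plus[symmetric] del: ennreal_plus)
  finally have one: "(\<Sum>m. ennreal (stick m (case_nat s \<omega>))) = 1" .
  show ?thesis
  proof (rule measure_eqI)
    show "sets (series (case_nat s \<omega>)) = sets (mix (t s) (D s) (series \<omega>))" using s\<omega> by simp
    fix A assume "A \<in> sets (series (case_nat s \<omega>))"
    then have A: "A \<in> sets borel" using s\<omega> by simp
    have "sets (D s) = sets borel" using measurable_space[OF D s] by (simp add: space_prob_algebra)
    then show "emeasure (series (case_nat s \<omega>)) A = emeasure (mix (t s) (D s) (series \<omega>)) A"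
      using split[of "\<lambda>m. emeasure (D (case_nat s \<omega> m)) A"] A sets_series[OF \<omega>]
      by (simp add: emeasure_series[OF s\<omega> one A] emeasure_series[OF \<omega> 1 A] emeasure_mix)
  qed
qed

text \<open>One step from the series gives the series of the prepended sequence, and that sequence
  has the same law as the original one.\<close>

lemma invariant_exists: "invariant_measure prob_measures kernel (distr (\<Pi>\<^sub>M i\<in>UNIV. M) prob_measures series)"
  unfolding invariant_measure_def
proof (intro conjI ballI)
  let ?S = "\<Pi>\<^sub>M i\<in>UNIV::nat set. M"
  interpret S: prob_space ?S by (rule prob_space_PiM, rule prob_space_axioms)
  have ms: "series \<in> ?S \<rightarrow>\<^sub>M prob_measures"
    using measurable_series by (simp cong: measurable_cong_sets add: sets_prob_measures)
  show "prob_space (distr ?S prob_measures series)" by (rule S.prob_space_distr[OF ms])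
  show "sets (distr ?S prob_measures series) = sets prob_measures" by simp
  fix A :: "'a measure set" assume A[measurable]: "A \<in> sets prob_measures"
  have mK: "(\<lambda>p. emeasure (kernel p) A) \<in> borel_measurable prob_measures"
    using measurable_compose[OF measurable_kernel measurable_emeasure_prob_algebra[OF A]] .
  have "(\<integral>\<^sup>+p. emeasure (kernel p) A \<partial>distr ?S prob_measures series) = (\<integral>\<^sup>+\<omega>. emeasure (kernel (series \<omega>)) A \<partial>?S)"
    using mK by (intro nn_integral_distr[OF ms]) auto
  also have "\<dots> = (\<integral>\<^sup>+\<omega>. (\<integral>\<^sup>+s. indicator A (mix (t s) (D s) (series \<omega>)) \<partial>M) \<partial>?S)"
  proof (intro nn_integral_cong)
    fix \<omega> assume "\<omega> \<in> space ?S"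
    then have sp: "series \<omega> \<in> space prob_measures" using measurable_space[OF ms] by simp
    have "emeasure (kernel (series \<omega>)) A = (\<integral>\<^sup>+p. indicator A p \<partial>kernel (series \<omega>))"
      using A by (simp add: kernel_def)
    also have "\<dots> = (\<integral>\<^sup>+s. indicator A (mix (t s) (D s) (series \<omega>)) \<partial>M)"
      unfolding kernel_def using A by (intro nn_integral_distr measurable_mix_sample sp) auto
    finally show "emeasure (kernel (series \<omega>)) A = (\<integral>\<^sup>+s. indicator A (mix (t s) (D s) (series \<omega>)) \<partial>M)" .
  qed
  \<comment> \<open>The default value of \<open>series\<close> can spoil the step identity only on
    the null set of deficient weights.\<close>
  also have "\<dots> = (\<integral>\<^sup>+\<omega>. (\<integral>\<^sup>+s. indicator A (series (case_nat s \<omega>)) \<partial>M) \<partial>?S)"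
    using AE_suminf_stick AE_space[of ?S]
    by (intro nn_integral_cong_AE, eventually_elim) (auto intro!: nn_integral_cong simp: series_case_nat)
  also have "\<dots> = (\<integral>\<^sup>+\<omega>. indicator A (series \<omega>) \<partial>?S)"
    by (rule PiM_iter_nn_integral[symmetric, OF measurable_compose[OF ms borel_measurable_indicator[OF A]]])
  also have "\<dots> = emeasure (distr ?S prob_measures series) A"
    using A ms nn_integral_distr[OF ms, of "indicator A"] by simp
  finally show "(\<integral>\<^sup>+p. emeasure (kernel p) A \<partial>distr ?S prob_measures series) = emeasure (distr ?S prob_measures series) A" .
qed

end

section \<open>Independent innovations and the Markov property\<close>

context prob_space begin

section \<open>Joint independence of paired sequences\<close>

lemma indep_set_mono:
  assumes "indep_set A B" "A' \<subseteq> A" "B' \<subseteq> B"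
  shows "indep_set A' B'"
proof -
  have "A \<subseteq> events" "B \<subseteq> events" "\<And>x y. x \<in> A \<Longrightarrow> y \<in> B \<Longrightarrow> prob (x \<inter> y) = prob x * prob y"
    using assms(1) unfolding indep_sets2_eq by simp_all
  then show ?thesis
    using subsetD[OF assms(2)] subsetD[OF assms(3)] assms(2,3) unfolding indep_sets2_eq
    by (intro conjI) (simp_all add: subset_trans[of A' A] subset_trans[of B' B])
qed

text \<open>Stated for sigma-algebras rather than for two variables, so that one component may be
  the identity into a sub-sigma-algebra; this gives the joint law of a fresh innovation and the
  entire past.\<close>

lemma distr_Pair_indep_algebras:
  assumes G: "space Ga = space M" "space Gb = space M" "indep_set (sets Ga) (sets Gb)"
    and X: "X \<in> Ga \<rightarrow>\<^sub>M S" and Y: "Y \<in> Gb \<rightarrow>\<^sub>M T"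
  shows "distr M S X \<Otimes>\<^sub>M distr M T Y = distr M (S \<Otimes>\<^sub>M T) (\<lambda>\<omega>. (X \<omega>, Y \<omega>))"
proof -
  have ev: "sets Ga \<subseteq> events" "sets Gb \<subseteq> events" using G(3) by (auto simp: indep_sets2_eq)
  have rv: "random_variable S X" "random_variable T Y"
    using measurable_mono[OF order_refl refl ev(1) G(1), of S] measurable_mono[OF order_refl refl ev(2) G(2), of T] X Y by auto
  show ?thesis
  proof (rule pair_measure_eqI)
    show "sigma_finite_measure (distr M S X)" "sigma_finite_measure (distr M T Y)"
      using rv by (auto intro!: prob_space_imp_sigma_finite prob_space_distr)
    fix A B assume "A \<in> sets (distr M S X)" "B \<in> sets (distr M T Y)"
    then have AB: "A \<in> sets S" "B \<in> sets T" by auto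
    have "prob ((X -` A \<inter> space M) \<inter> (Y -` B \<inter> space M)) = prob (X -` A \<inter> space M) * prob (Y -` B \<inter> space M)"
      using G(3) measurable_sets[OF X AB(1)] measurable_sets[OF Y AB(2)] by (simp add: indep_sets2_eq G)
    moreover have "(\<lambda>\<omega>. (X \<omega>, Y \<omega>)) -` (A \<times> B) \<inter> space M = (X -` A \<inter> space M) \<inter> (Y -` B \<inter> space M)" by auto
    ultimately show "emeasure (distr M S X) A * emeasure (distr M T Y) B = emeasure (distr M (S \<Otimes>\<^sub>M T) (\<lambda>\<omega>. (X \<omega>, Y \<omega>))) (A \<times> B)"
      using AB rv by (simp add: emeasure_distr emeasure_eq_measure ennreal_mult)
  qed simp
qed

lemma sets_generated_algebra:
  assumes "\<And>i. i \<in> I \<Longrightarrow> X i \<in> M \<rightarrow>\<^sub>M S"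
  shows "sets (generated_algebra M I S X) = {(\<lambda>\<omega>. \<lambda>i\<in>I. X i \<omega>) -` A \<inter> space M | A. A \<in> sets (\<Pi>\<^sub>M i\<in>I. S)}"
proof -
  have "(\<lambda>\<omega>. \<lambda>i\<in>I. X i \<omega>) \<in> M \<rightarrow>\<^sub>M (\<Pi>\<^sub>M i\<in>I. S)"
    using assms by (intro measurable_restrict)
  from measurable_space[OF this] show ?thesis
    unfolding generated_algebra_def by (intro sets_vimage_algebra2) auto
qed

lemma space_generated_algebra [simp]: "space (generated_algebra N I S X) = space N"
  by (simp add: generated_algebra_def)

lemma sets_generated_algebra_subset:
  assumes H: "space H = space M" and X: "\<And>i. i \<in> I \<Longrightarrow> X i \<in> H \<rightarrow>\<^sub>M S"
  shows "sets (generated_algebra M I S X) \<subseteq> sets H"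
proof -
  have m: "(\<lambda>\<omega>. \<lambda>i\<in>I. X i \<omega>) \<in> H \<rightarrow>\<^sub>M (\<Pi>\<^sub>M i\<in>I. S)"
    using X by (intro measurable_restrict)
  have "sets (generated_algebra M I S X) = {(\<lambda>\<omega>. \<lambda>i\<in>I. X i \<omega>) -` A \<inter> space M | A. A \<in> sets (\<Pi>\<^sub>M i\<in>I. S)}"
    unfolding generated_algebra_def using measurable_space[OF m] H by (intro sets_vimage_algebra2) auto
  then show ?thesis using measurable_sets[OF m] by (auto simp: H)
qed

lemma indep_generated_algebras:
  assumes X: "indep_vars (\<lambda>_. S) X I" and AB: "A \<inter> B = {}" "A \<subseteq> I" "B \<subseteq> I"
  shows "indep_set (sets (generated_algebra M A S X)) (sets (generated_algebra M B S X))"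
proof -
  have rv: "X i \<in> M \<rightarrow>\<^sub>M S" if "i \<in> I" for i using X that by (auto simp: indep_vars_def)
  have "indep_var (PiM A (\<lambda>_. S)) (\<lambda>\<omega>. restrict (\<lambda>i. X i \<omega>) A) (PiM B (\<lambda>_. S)) (\<lambda>\<omega>. restrict (\<lambda>i. X i \<omega>) B)"
    by (rule indep_var_restrict[OF X AB])
  then have ind: "indep_set (sigma_sets (space M) {(\<lambda>\<omega>. restrict (\<lambda>i. X i \<omega>) A) -` C \<inter> space M | C. C \<in> sets (PiM A (\<lambda>_. S))})
     (sigma_sets (space M) {(\<lambda>\<omega>. restrict (\<lambda>i. X i \<omega>) B) -` C \<inter> space M | C. C \<in> sets (PiM B (\<lambda>_. S))})"
    by (simp add: indep_var_eq)
  have "sets (generated_algebra M A S X) = {(\<lambda>\<omega>. \<lambda>i\<in>A. X i \<omega>) -` C \<inter> space M | C. C \<in> sets (\<Pi>\<^sub>M i\<in>A. S)}"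
    "sets (generated_algebra M B S X) = {(\<lambda>\<omega>. \<lambda>i\<in>B. X i \<omega>) -` C \<inter> space M | C. C \<in> sets (\<Pi>\<^sub>M i\<in>B. S)}"
    using rv AB by (auto intro!: sets_generated_algebra)
  then show ?thesis
    by (intro indep_set_mono[OF ind]) (simp_all add: sigma_sets_superset_generator)
qed

text \<open>The rectangle events at each time are stable under intersection. Their probabilities
  factor between the two sequences and then over time within each, and the generated sigma-algebras
  inherit this.\<close>

lemma indep_vars_Pair:
  assumes a: "indep_vars (\<lambda>_. S) a I" and b: "indep_vars (\<lambda>_. T) b I"
    and ind: "indep_set (sets (generated_algebra M I S a)) (sets (generated_algebra M I T b))"
  shows "indep_vars (\<lambda>_. S \<Otimes>\<^sub>M T) (\<lambda>i \<omega>. (a i \<omega>, b i \<omega>)) I"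
    and "i \<in> I \<Longrightarrow> distr M (S \<Otimes>\<^sub>M T) (\<lambda>\<omega>. (a i \<omega>, b i \<omega>)) = distr M S (a i) \<Otimes>\<^sub>M distr M T (b i)"
proof -
  have rv: "a i \<in> M \<rightarrow>\<^sub>M S" "b i \<in> M \<rightarrow>\<^sub>M T" if "i \<in> I" for i using a b that by (auto simp: indep_vars_def)
  have ga: "a i \<in> generated_algebra M I S a \<rightarrow>\<^sub>M S" and gb: "b i \<in> generated_algebra M I T b \<rightarrow>\<^sub>M T" if "i \<in> I" for i
    using rv that by (auto intro: measurable_generated_algebra)
  show "distr M (S \<Otimes>\<^sub>M T) (\<lambda>\<omega>. (a i \<omega>, b i \<omega>)) = distr M S (a i) \<Otimes>\<^sub>M distr M T (b i)" if "i \<in> I"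
    by (rule distr_Pair_indep_algebras[OF _ _ ind ga[OF that] gb[OF that], symmetric]) simp_all
  define R where "R i = {(a i -` A \<inter> space M) \<inter> (b i -` B \<inter> space M) | A B. A \<in> sets S \<and> B \<in> sets T}" for i
  have Rev: "R i \<subseteq> events" if "i \<in> I" for i
    using rv[OF that] by (auto simp: R_def)
  have prod: "prob (\<Inter>i\<in>J. (a i -` A i \<inter> space M) \<inter> (b i -` B i \<inter> space M))
     = (\<Prod>i\<in>J. prob (a i -` A i \<inter> space M)) * (\<Prod>i\<in>J. prob (b i -` B i \<inter> space M))"
    if J: "finite J" "J \<noteq> {}" "J \<subseteq> I" and AB: "\<And>i. i \<in> J \<Longrightarrow> A i \<in> sets S" "\<And>i. i \<in> J \<Longrightarrow> B i \<in> sets T" for J A B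
  proof -
    have 1: "(\<Inter>i\<in>J. a i -` A i \<inter> space M) \<in> sets (generated_algebra M I S a)"
      using J AB measurable_sets[OF ga] by (intro sets.finite_INT) (auto simp: subset_iff)
    have 2: "(\<Inter>i\<in>J. b i -` B i \<inter> space M) \<in> sets (generated_algebra M I T b)"
      using J AB measurable_sets[OF gb] by (intro sets.finite_INT) (auto simp: subset_iff)
    have "prob (\<Inter>i\<in>J. (a i -` A i \<inter> space M) \<inter> (b i -` B i \<inter> space M))
      = prob ((\<Inter>i\<in>J. a i -` A i \<inter> space M) \<inter> (\<Inter>i\<in>J. b i -` B i \<inter> space M))"
      by (rule arg_cong[where f=prob]) auto
    also have "\<dots> = prob (\<Inter>i\<in>J. a i -` A i \<inter> space M) * prob (\<Inter>i\<in>J. b i -` B i \<inter> space M)"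
      using ind 1 2 by (simp add: indep_sets2_eq)
    also have "prob (\<Inter>i\<in>J. a i -` A i \<inter> space M) = (\<Prod>i\<in>J. prob (a i -` A i \<inter> space M))"
      using J AB by (intro indep_varsD[OF a]) auto
    also have "prob (\<Inter>i\<in>J. b i -` B i \<inter> space M) = (\<Prod>i\<in>J. prob (b i -` B i \<inter> space M))"
      using J AB by (intro indep_varsD[OF b]) auto
    finally show ?thesis .
  qed
  have "indep_sets R I"
  proof (rule indep_setsI)
    fix C J assume J: "J \<noteq> {}" "J \<subseteq> I" "finite J" and "\<forall>i\<in>J. C i \<in> R i"
    then have "\<forall>i\<in>J. \<exists>A B. C i = (a i -` A \<inter> space M) \<inter> (b i -` B \<inter> space M) \<and> A \<in> sets S \<and> B \<in> sets T"
      by (auto simp: R_def)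
    then obtain A B where C: "\<And>i. i \<in> J \<Longrightarrow> C i = (a i -` A i \<inter> space M) \<inter> (b i -` B i \<inter> space M)"
      and AB: "\<And>i. i \<in> J \<Longrightarrow> A i \<in> sets S" "\<And>i. i \<in> J \<Longrightarrow> B i \<in> sets T" by metis
    have "prob (\<Inter>i\<in>J. C i) = (\<Prod>i\<in>J. prob (a i -` A i \<inter> space M)) * (\<Prod>i\<in>J. prob (b i -` B i \<inter> space M))"
      using prod[OF J(3,1,2) AB] C by (simp cong: INF_cong)
    also have "\<dots> = (\<Prod>i\<in>J. prob (C i))"
      unfolding prod.distrib[symmetric]
    proof (intro prod.cong refl)
      fix i assume i: "i \<in> J"
      show "prob (a i -` A i \<inter> space M) * prob (b i -` B i \<inter> space M) = prob (C i)"
        using prod[of "{i}" A B] i J AB C[OF i] by auto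
    qed
    finally show "prob (\<Inter>i\<in>J. C i) = (\<Prod>i\<in>J. prob (C i))" .
  qed (use Rev in auto)
  moreover have "Int_stable (R i)" for i
  proof (rule Int_stableI)
    fix x y assume "x \<in> R i" "y \<in> R i"
    then obtain A B A' B' where "x = (a i -` A \<inter> space M) \<inter> (b i -` B \<inter> space M)" "A \<in> sets S" "B \<in> sets T"
      "y = (a i -` A' \<inter> space M) \<inter> (b i -` B' \<inter> space M)" "A' \<in> sets S" "B' \<in> sets T"
      unfolding R_def by blast
    then show "x \<inter> y \<in> R i"
      unfolding R_def by (intro CollectI exI[of _ "A \<inter> A'"] exI[of _ "B \<inter> B'"]) auto
  qed
  ultimately have ind': "indep_sets (\<lambda>i. sigma_sets (space M) (R i)) I"
    by (intro indep_sets_sigma) auto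
  show "indep_vars (\<lambda>_. S \<Otimes>\<^sub>M T) (\<lambda>i \<omega>. (a i \<omega>, b i \<omega>)) I"
    unfolding indep_vars_def2
  proof (intro conjI ballI indep_sets_mono_sets[OF ind'])
    fix i assume i: "i \<in> I"
    show "random_variable (S \<Otimes>\<^sub>M T) (\<lambda>\<omega>. (a i \<omega>, b i \<omega>))"
      using rv[OF i] by measurable
    \<comment> \<open>Rectangles with one side the whole space make each component measurable for
      \<open>H\<close>, hence the pair as well.\<close>
    define H where "H = sigma (space M) (R i)"
    have RP: "R i \<subseteq> Pow (space M)" by (auto simp: R_def)
    have spH: "space H = space M" and sH: "sets H = sigma_sets (space M) (R i)"
      using RP by (auto simp: H_def)
    have "a i \<in> H \<rightarrow>\<^sub>M S"
    proof (rule measurableI)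
      fix A assume A: "A \<in> sets S"
      have "a i -` A \<inter> space M = (a i -` A \<inter> space M) \<inter> (b i -` space T \<inter> space M)"
        using measurable_space[OF rv(2)[OF i]] by auto
      then have "a i -` A \<inter> space M \<in> R i" unfolding R_def using A by blast
      then show "a i -` A \<inter> space H \<in> sets H" unfolding spH sH by (rule sigma_sets.Basic)
    qed (use measurable_space[OF rv(1)[OF i]] in \<open>auto simp: spH\<close>)
    moreover have "b i \<in> H \<rightarrow>\<^sub>M T"
    proof (rule measurableI)
      fix B assume B: "B \<in> sets T"
      have "b i -` B \<inter> space M = (a i -` space S \<inter> space M) \<inter> (b i -` B \<inter> space M)"
        using measurable_space[OF rv(1)[OF i]] by auto
      then have "b i -` B \<inter> space M \<in> R i" unfolding R_def using B by blast
      then show "b i -` B \<inter> space H \<in> sets H" unfolding spH sH by (rule sigma_sets.Basic)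
    qed (use measurable_space[OF rv(2)[OF i]] in \<open>auto simp: spH\<close>)
    ultimately have "(\<lambda>\<omega>. (a i \<omega>, b i \<omega>)) \<in> H \<rightarrow>\<^sub>M S \<Otimes>\<^sub>M T" by measurable
    from measurable_sets[OF this]
    show "{(\<lambda>\<omega>. (a i \<omega>, b i \<omega>)) -` A \<inter> space M |A. A \<in> sets (S \<Otimes>\<^sub>M T)} \<subseteq> sigma_sets (space M) (R i)"
      unfolding spH sH by auto
  qed
qed

lemma generated_algebra_Pair_subset:
  assumes "\<And>i. i \<in> I \<Longrightarrow> a i \<in> M \<rightarrow>\<^sub>M S" "\<And>i. i \<in> I \<Longrightarrow> b i \<in> M \<rightarrow>\<^sub>M T"
  shows "sets (generated_algebra M I (S \<Otimes>\<^sub>M T) (\<lambda>i \<omega>. (a i \<omega>, b i \<omega>)))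
    \<subseteq> sigma_sets (space M) (sets (generated_algebra M I S a) \<union> sets (generated_algebra M I T b))" (is "_ \<subseteq> sigma_sets _ ?U")
proof -
  define H where "H = sigma (space M) ?U"
  have "?U \<subseteq> Pow (space M)"
    using sets.space_closed[of "generated_algebra M I S a"] sets.space_closed[of "generated_algebra M I T b"] by auto
  then have H: "space H = space M" "sets H = sigma_sets (space M) ?U" by (auto simp: H_def)
  have "a i \<in> H \<rightarrow>\<^sub>M S" "b i \<in> H \<rightarrow>\<^sub>M T" if "i \<in> I" for i
  proof -
    have "a i \<in> generated_algebra M I S a \<rightarrow>\<^sub>M S" "b i \<in> generated_algebra M I T b \<rightarrow>\<^sub>M T"
      using assms that by (auto intro: measurable_generated_algebra)
    moreover have "sets (generated_algebra M I S a) \<subseteq> sets H" "sets (generated_algebra M I T b) \<subseteq> sets H"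
      unfolding H(2) by (auto intro: sigma_sets.Basic)
    ultimately show "a i \<in> H \<rightarrow>\<^sub>M S" "b i \<in> H \<rightarrow>\<^sub>M T"
      using measurable_mono[OF order_refl refl, of "generated_algebra M I S a" H S]
        measurable_mono[OF order_refl refl, of "generated_algebra M I T b" H T] H(1) by auto
  qed
  then have "sets (generated_algebra M I (S \<Otimes>\<^sub>M T) (\<lambda>i \<omega>. (a i \<omega>, b i \<omega>))) \<subseteq> sets H"
    by (intro sets_generated_algebra_subset H) measurable
  then show ?thesis by (simp add: H)
qed

text \<open>The second and third sequences are merged first: the sigma-algebra generated by both is
  still independent of the first one, so the pairing lemma can be applied twice.\<close>

lemma indep_vars_triple:
  assumes a: "indep_vars (\<lambda>_. S) a I" and b: "indep_vars (\<lambda>_. T) b I" and c: "indep_vars (\<lambda>_. U) c I"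
    and ind: "indep_sets (nth [sets (generated_algebra M I S a), sets (generated_algebra M I T b), sets (generated_algebra M I U c)]) {..<3}"
  shows "indep_vars (\<lambda>_. S \<Otimes>\<^sub>M (T \<Otimes>\<^sub>M U)) (\<lambda>i \<omega>. (a i \<omega>, b i \<omega>, c i \<omega>)) I"
    and "i \<in> I \<Longrightarrow> distr M (S \<Otimes>\<^sub>M (T \<Otimes>\<^sub>M U)) (\<lambda>\<omega>. (a i \<omega>, b i \<omega>, c i \<omega>))
       = distr M S (a i) \<Otimes>\<^sub>M (distr M T (b i) \<Otimes>\<^sub>M distr M U (c i))"
proof -
  let ?G = "nth [sets (generated_algebra M I S a), sets (generated_algebra M I T b), sets (generated_algebra M I U c)]"
  have rv: "b i \<in> M \<rightarrow>\<^sub>M T" "c i \<in> M \<rightarrow>\<^sub>M U" if "i \<in> I" for i using b c that by (auto simp: indep_vars_def)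
  have st: "Int_stable (?G j)" if "j < 3" for j
  proof -
    have "j = 0 \<or> j = 1 \<or> j = 2" using that by auto
    then show ?thesis by (auto simp: Int_stable_def)
  qed
  have bc: "indep_set (sets (generated_algebra M I T b)) (sets (generated_algebra M I U c))"
    unfolding indep_sets2_eq
  proof (intro conjI ballI)
    show "sets (generated_algebra M I T b) \<subseteq> events" "sets (generated_algebra M I U c) \<subseteq> events"
      using ind unfolding indep_sets_def by (force dest: bspec[of _ _ 1], force dest: bspec[of _ _ 2])
    fix x y assume "x \<in> sets (generated_algebra M I T b)" "y \<in> sets (generated_algebra M I U c)"
    then have "prob (\<Inter>j\<in>{1, 2::nat}. if j = 1 then x else y) = (\<Prod>j\<in>{1, 2::nat}. prob (if j = 1 then x else y))"
      by (intro indep_setsD[OF ind]) auto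
    then show "prob (x \<inter> y) = prob x * prob y" by (simp add: Int_commute)
  qed
  \<comment> \<open>The indices are grouped as \<open>{0}\<close> against \<open>{1, 2}\<close>.
    Each of the three families is a sigma-algebra and so stable under intersection, which the
    grouping requires.\<close>
  have "indep_sets (\<lambda>l. sigma_sets (space M) (\<Union>j\<in>case_bool {0} {1, 2} l. ?G j)) UNIV"
  proof (rule indep_sets_collect_sigma)
    have "(\<Union>l. case_bool {0} {1, 2::nat} l) \<subseteq> {..<3}" by (auto split: bool.splits)
    then show "indep_sets ?G (\<Union>l. case_bool {0} {1, 2} l)" by (rule indep_sets_mono_index[OF _ ind])
    show "disjoint_family (case_bool {0} {1, 2::nat})" by (auto simp: disjoint_family_on_def split: bool.splits)
    show "\<And>i j. i \<in> case_bool {0} {1, 2} j \<Longrightarrow> Int_stable (?G i)"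
      using st[of 0] st[of 1] st[of 2] by (auto split: bool.splits)
  qed
  then have "indep_set (sigma_sets (space M) (sets (generated_algebra M I S a)))
      (sigma_sets (space M) (sets (generated_algebra M I T b) \<union> sets (generated_algebra M I U c)))"
    unfolding indep_set_def by (rule iffD1[OF indep_sets_cong, rotated -1]) (auto split: bool.split)
  then have abc: "indep_set (sets (generated_algebra M I S a)) (sets (generated_algebra M I (T \<Otimes>\<^sub>M U) (\<lambda>i \<omega>. (b i \<omega>, c i \<omega>))))"
    by (rule indep_set_mono[OF _ sigma_sets_superset_generator generated_algebra_Pair_subset[of I b T c U]])
       (use rv in auto)
  note bc' = indep_vars_Pair[OF b c bc]
  show "indep_vars (\<lambda>_. S \<Otimes>\<^sub>M (T \<Otimes>\<^sub>M U)) (\<lambda>i \<omega>. (a i \<omega>, b i \<omega>, c i \<omega>)) I"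
    by (rule indep_vars_Pair(1)[OF a bc'(1) abc])
  show "i \<in> I \<Longrightarrow> distr M (S \<Otimes>\<^sub>M (T \<Otimes>\<^sub>M U)) (\<lambda>\<omega>. (a i \<omega>, b i \<omega>, c i \<omega>))
       = distr M S (a i) \<Otimes>\<^sub>M (distr M T (b i) \<Otimes>\<^sub>M distr M U (c i))"
    using indep_vars_Pair(2)[OF a bc'(1) abc] bc'(2) by simp
qed

text \<open>The state at time \<open>m\<close> is a function of the first \<open>m\<close>
  innovations and hence independent of the next one, which can be integrated out with the state
  frozen. Equal laws make the kernel the same at every step.\<close>

lemma random_recursion_markov_chain:
  assumes e: "indep_vars (\<lambda>_. E) e {1..}" and law: "\<And>m. m \<ge> 1 \<Longrightarrow> distr M E (e m) = distr M E (e 1)"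
    and F: "(\<lambda>(u, x). F u x) \<in> E \<Otimes>\<^sub>M S \<rightarrow>\<^sub>M S" and x0: "x0 \<in> space S"
    and X0: "\<And>\<omega>. \<omega> \<in> space M \<Longrightarrow> X 0 \<omega> = x0"
    and X_Suc: "\<And>m \<omega>. \<omega> \<in> space M \<Longrightarrow> X (Suc m) \<omega> = F (e (Suc m) \<omega>) (X m \<omega>)"
  shows "markov_chain M S (\<lambda>x. distr M S (\<lambda>\<omega>. F (e 1 \<omega>) x)) X"
proof -
  have rv: "e i \<in> M \<rightarrow>\<^sub>M E" if "i \<ge> 1" for i using e that by (auto simp: indep_vars_def)
  \<comment> \<open>The past of the innovations contains the past of the states, so every event to
    be tested in the conditional expectation lies in \<open>G m\<close>.\<close>
  define G where "G m = generated_algebra M {1..m} E e" for m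
  have spG: "space (G m) = space M" for m by (simp add: G_def)
  have XG: "X j \<in> G m \<rightarrow>\<^sub>M S" if "j \<le> m" for j m
    using that
  proof (induction j)
    case 0
    have "(\<lambda>_. x0) \<in> G m \<rightarrow>\<^sub>M S" using x0 by simp
    then show ?case using X0 by (subst measurable_cong[where g="\<lambda>_. x0"]) (auto simp: spG)
  next
    case (Suc j)
    then have 1: "X j \<in> G m \<rightarrow>\<^sub>M S" by simp
    have 2: "e (Suc j) \<in> G m \<rightarrow>\<^sub>M E"
      unfolding G_def using rv Suc.prems by (intro measurable_generated_algebra) auto
    have "(\<lambda>\<omega>. F (e (Suc j) \<omega>) (X j \<omega>)) \<in> G m \<rightarrow>\<^sub>M S"
      using measurable_compose[OF measurable_Pair[OF 2 1] F] by simp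
    then show ?case using X_Suc by (subst measurable_cong[where g="\<lambda>\<omega>. F (e (Suc j) \<omega>) (X j \<omega>)"]) (auto simp: spG)
  qed
  have subG: "subalgebra M (G m)" for m
    unfolding G_def using rv by (intro subalgebra_generated_algebra) auto
  have XM: "X m \<in> M \<rightarrow>\<^sub>M S" for m
    using measurable_from_subalg[OF subG XG[OF order_refl]] .
  let ?K = "\<lambda>x. distr M S (\<lambda>\<omega>. F (e 1 \<omega>) x)"
  have K: "?K \<in> S \<rightarrow>\<^sub>M prob_algebra S"
  proof (rule measurable_distr_prob_space2[where M=M])
    show "(\<lambda>x. M) \<in> S \<rightarrow>\<^sub>M prob_algebra M" by (simp add: space_prob_algebra prob_space_axioms)
    have "(\<lambda>p. (e 1 (snd p), fst p)) \<in> S \<Otimes>\<^sub>M M \<rightarrow>\<^sub>M E \<Otimes>\<^sub>M S" using rv[of 1] by measurable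
    from measurable_compose[OF this F] show "(\<lambda>(x, \<omega>). F (e 1 \<omega>) x) \<in> S \<Otimes>\<^sub>M M \<rightarrow>\<^sub>M S"
      by (simp add: case_prod_unfold)
  qed
  have F1: "(\<lambda>u. F u x) \<in> E \<rightarrow>\<^sub>M S" if "x \<in> space S" for x
    using measurable_Pair1[OF F that] by simp
  have main: "AE \<omega> in M. real_cond_exp M (generated_algebra M {..m} S X) (\<lambda>\<omega>. indicator A (X (Suc m) \<omega>)) \<omega>
        = measure (?K (X m \<omega>)) A" if A: "A \<in> sets S" for m A
  proof -
    define FX where "FX = generated_algebra M {..m} S X"
    have sub: "subalgebra M FX" unfolding FX_def using XM by (intro subalgebra_generated_algebra)
    interpret FX: finite_measure_subalgebra M FX by unfold_locales (rule sub)
    have FXG: "sets FX \<subseteq> sets (G m)"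
      unfolding FX_def using XG by (intro sets_generated_algebra_subset spG) auto
    have XmFX: "X m \<in> FX \<rightarrow>\<^sub>M S" unfolding FX_def using XM by (intro measurable_generated_algebra) auto
    have mK: "(\<lambda>x. measure (?K x) A) \<in> borel_measurable S"
    proof -
      have "(\<lambda>p. measure p A) \<in> borel_measurable (prob_algebra S)"
        unfolding prob_algebra_def using A by (intro measurable_restrict_space1) measurable
      from measurable_compose[OF K this] show ?thesis .
    qed
    have iA: "(\<lambda>\<omega>. indicator A (X (Suc m) \<omega>) :: real) \<in> borel_measurable M"
      using measurable_compose[OF XM borel_measurable_indicator[OF A]] .
    have mK': "(\<lambda>\<omega>. measure (?K (X m \<omega>)) A) \<in> borel_measurable M"
      using measurable_compose[OF XM mK] .
    have K01: "measure (?K x) A \<le> 1" "emeasure (?K x) A = ennreal (measure (?K x) A)" if "x \<in> space S" for x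
    proof -
      interpret Kx: prob_space "?K x"
        using measurable_space[OF K that] by (simp add: space_prob_algebra)
      show "measure (?K x) A \<le> 1" by (rule Kx.prob_le_1)
      show "emeasure (?K x) A = ennreal (measure (?K x) A)" by (rule Kx.emeasure_eq_measure)
    qed
    show ?thesis unfolding FX_def[symmetric]
    proof (rule FX.real_cond_exp_charact)
      show "integrable M (\<lambda>\<omega>. indicator A (X (Suc m) \<omega>) :: real)"
        using iA by (intro integrable_const_bound[of _ 1]) auto
      show "integrable M (\<lambda>\<omega>. measure (?K (X m \<omega>)) A)"
        using mK' K01(1) measurable_space[OF XM] by (intro integrable_const_bound[of _ 1]) auto
      show "(\<lambda>\<omega>. measure (?K (X m \<omega>)) A) \<in> borel_measurable FX"
        using measurable_compose[OF XmFX mK] .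
      fix B assume "B \<in> sets FX"
      then have B: "B \<in> sets (G m)" using FXG by auto
      then have BM: "B \<in> sets M" using subG by (auto simp: subalgebra_def)
      let ?e = "e (Suc m)"
      have re: "?e \<in> M \<rightarrow>\<^sub>M E" using rv by simp
      have "indep_set (sets (generated_algebra M {Suc m} E e)) (sets (G m))"
        unfolding G_def by (rule indep_generated_algebras[OF e]) auto
      \<comment> \<open>The second component is the identity, so any function of the whole past and
        the next innovation can be integrated against a product law.\<close>
      then have dist: "distr M E ?e \<Otimes>\<^sub>M distr M (G m) (\<lambda>\<omega>. \<omega>) = distr M (E \<Otimes>\<^sub>M G m) (\<lambda>\<omega>. (?e \<omega>, \<omega>))"
        using rv by (intro distr_Pair_indep_algebras[of "generated_algebra M {Suc m} E e" "G m"])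
          (auto simp: spG intro: measurable_generated_algebra)
      have idG: "(\<lambda>\<omega>. \<omega>) \<in> M \<rightarrow>\<^sub>M G m"
        using measurable_from_subalg[OF subG, of "\<lambda>\<omega>. \<omega>" m "G m"] by simp
      \<comment> \<open>The event \<open>B\<close> depends on the past only, the next state on the
        past and the fresh innovation \<open>u\<close>; for fixed \<open>\<omega>\<close> the
        integral over \<open>u\<close> is the kernel.\<close>
      define h where "h = (\<lambda>(u, \<omega>). indicator B \<omega> * indicator A (F u (X m \<omega>)) :: ennreal)"
      have h: "h \<in> borel_measurable (E \<Otimes>\<^sub>M G m)"
      proof -
        have "(\<lambda>p. (fst p, X m (snd p))) \<in> E \<Otimes>\<^sub>M G m \<rightarrow>\<^sub>M E \<Otimes>\<^sub>M S"
          using XG[of m m] by measurable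
        from measurable_compose[OF measurable_compose[OF this F] borel_measurable_indicator[OF A]]
        have "(\<lambda>p. indicator A (F (fst p) (X m (snd p))) :: ennreal) \<in> borel_measurable (E \<Otimes>\<^sub>M G m)"
          by (simp add: case_prod_unfold)
        moreover have "(\<lambda>p. indicator B (snd p) :: ennreal) \<in> borel_measurable (E \<Otimes>\<^sub>M G m)"
          using measurable_compose[OF measurable_snd borel_measurable_indicator[OF B]] .
        ultimately show ?thesis
          unfolding h_def case_prod_unfold by (rule borel_measurable_times_ennreal[rotated])
      qed
      interpret De: prob_space "distr M E ?e" by (rule prob_space_distr[OF re])
      interpret DG: prob_space "distr M (G m) (\<lambda>\<omega>. \<omega>)" by (rule prob_space_distr[OF idG])
      interpret P: pair_sigma_finite "distr M E ?e" "distr M (G m) (\<lambda>\<omega>. \<omega>)" ..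
      have "(\<integral>\<^sup>+\<omega>. ennreal (indicator B \<omega> * indicator A (X (Suc m) \<omega>)) \<partial>M) = (\<integral>\<^sup>+\<omega>. h (?e \<omega>, \<omega>) \<partial>M)"
        using X_Suc by (intro nn_integral_cong) (auto simp: h_def indicator_def)
      also have "\<dots> = (\<integral>\<^sup>+p. h p \<partial>distr M (E \<Otimes>\<^sub>M G m) (\<lambda>\<omega>. (?e \<omega>, \<omega>)))"
        using h by (subst nn_integral_distr[OF measurable_Pair[OF re idG]]) auto
      also have "\<dots> = (\<integral>\<^sup>+p. h p \<partial>(distr M E ?e \<Otimes>\<^sub>M distr M (G m) (\<lambda>\<omega>. \<omega>)))"
        unfolding dist ..
      also have "\<dots> = (\<integral>\<^sup>+\<omega>. (\<integral>\<^sup>+u. h (u, \<omega>) \<partial>distr M E ?e) \<partial>distr M (G m) (\<lambda>\<omega>. \<omega>))"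
        using h by (intro P.nn_integral_snd[symmetric]) (simp cong: measurable_cong_sets)
      also have "\<dots> = (\<integral>\<^sup>+\<omega>. indicator B \<omega> * emeasure (?K (X m \<omega>)) A \<partial>distr M (G m) (\<lambda>\<omega>. \<omega>))"
      proof (intro nn_integral_cong)
        fix \<omega> assume "\<omega> \<in> space (distr M (G m) (\<lambda>\<omega>. \<omega>))"
        then have xs: "X m \<omega> \<in> space S" using measurable_space[OF XM] by (simp add: spG)
        have ms: "(\<lambda>u. indicator A (F u (X m \<omega>)) :: ennreal) \<in> borel_measurable E"
          using measurable_compose[OF F1[OF xs] borel_measurable_indicator[OF A]] .
        have "(\<integral>\<^sup>+u. h (u, \<omega>) \<partial>distr M E ?e) = indicator B \<omega> * (\<integral>\<^sup>+u. indicator A (F u (X m \<omega>)) \<partial>distr M E ?e)"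
          unfolding h_def prod.case using ms by (intro nn_integral_cmult) simp
        also have "(\<integral>\<^sup>+u. indicator A (F u (X m \<omega>)) \<partial>distr M E ?e) = (\<integral>\<^sup>+u. indicator A (F u (X m \<omega>)) \<partial>distr M E (e 1))"
          using law[of "Suc m"] by simp
        also have "\<dots> = (\<integral>\<^sup>+\<omega>'. indicator A (F (e 1 \<omega>') (X m \<omega>)) \<partial>M)"
          using ms rv[of 1] by (intro nn_integral_distr) auto
        also have "\<dots> = (\<integral>\<^sup>+x. indicator A x \<partial>?K (X m \<omega>))"
          using A measurable_compose[OF rv[of 1] F1[OF xs]] by (intro nn_integral_distr[symmetric]) auto
        also have "\<dots> = emeasure (?K (X m \<omega>)) A" using A by simp
        finally show "(\<integral>\<^sup>+u. h (u, \<omega>) \<partial>distr M E ?e) = indicator B \<omega> * emeasure (?K (X m \<omega>)) A" .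
      qed
      also have "\<dots> = (\<integral>\<^sup>+\<omega>. indicator B \<omega> * emeasure (?K (X m \<omega>)) A \<partial>M)"
      proof (rule nn_integral_distr[OF idG])
        have "(\<lambda>x. emeasure (?K x) A) \<in> borel_measurable S"
        proof -
          have "(\<lambda>p. emeasure p A) \<in> borel_measurable (prob_algebra S)"
            unfolding prob_algebra_def using A by (intro measurable_restrict_space1) measurable
          from measurable_compose[OF K this] show ?thesis .
        qed
        from measurable_compose[OF XG[OF order_refl] this] B
        show "(\<lambda>\<omega>. indicator B \<omega> * emeasure (?K (X m \<omega>)) A) \<in> borel_measurable (distr M (G m) (\<lambda>\<omega>. \<omega>))"
          by (intro borel_measurable_times_ennreal) auto
      qed
      also have "\<dots> = (\<integral>\<^sup>+\<omega>. ennreal (indicator B \<omega> * measure (?K (X m \<omega>)) A) \<partial>M)"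
        using K01(2) measurable_space[OF XM] by (intro nn_integral_cong) (auto simp: indicator_def)
      finally have "(\<integral>\<^sup>+\<omega>. ennreal (indicator B \<omega> * indicator A (X (Suc m) \<omega>)) \<partial>M)
         = (\<integral>\<^sup>+\<omega>. ennreal (indicator B \<omega> * measure (?K (X m \<omega>)) A) \<partial>M)" .
      then show "(\<integral>\<omega>\<in>B. indicator A (X (Suc m) \<omega>) \<partial>M) = (\<integral>\<omega>\<in>B. measure (?K (X m \<omega>)) A \<partial>M)"
        unfolding set_lebesgue_integral_def using iA mK' BM
        by (subst (1 2) integral_eq_nn_integral) auto
    qed
  qed
  show ?thesis
    unfolding markov_chain_def using prob_space_axioms K XM main by blast
qed

end

section \<open>Innovations of the chain\<close>

definition atoms :: "nat \<Rightarrow> (nat \<Rightarrow> real) \<Rightarrow> (nat \<Rightarrow> 'a::polish_space) \<Rightarrow> 'a measure" where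
  "atoms n w y = measure_of UNIV (sets borel) (\<lambda>A. \<Sum>i=1..n. ennreal (w i) * emeasure (return borel (y i)) A)"

definition is_weight :: "nat \<Rightarrow> (nat \<Rightarrow> real) \<Rightarrow> bool" where
  "is_weight n w \<longleftrightarrow> (\<forall>i\<in>{1..n}. 0 \<le> w i) \<and> (\<Sum>i=1..n. w i) = 1"

lemma sets_atoms [simp]: "sets (atoms n w y) = sets borel"
  using sets.space_closed[of borel] sets.sigma_sets_eq[of borel] by (simp add: atoms_def)

lemma space_atoms [simp]: "space (atoms n w y) = UNIV"
  using sets_eq_imp_space_eq[OF sets_atoms[of n w y]] by simp

lemma emeasure_atoms:
  assumes A: "A \<in> sets borel"
  shows "emeasure (atoms n w y) A = (\<Sum>i=1..n. ennreal (w i) * indicator A (y i))"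
proof -
  have "emeasure (atoms n w y) A = (\<Sum>i=1..n. ennreal (w i) * emeasure (return borel (y i)) A)"
  proof (rule emeasure_measure_of[OF atoms_def])
    show "A \<in> sets (atoms n w y)" using A by simp
    show "countably_additive (sets (atoms n w y)) (\<lambda>A. \<Sum>i=1..n. ennreal (w i) * emeasure (return borel (y i)) A)"
    proof (rule countably_additiveI)
      fix F :: "nat \<Rightarrow> 'a set" assume F: "range F \<subseteq> sets (atoms n w y)" "disjoint_family F"
      then have "(\<Sum>j. emeasure (return borel (y i)) (F j)) = emeasure (return borel (y i)) (\<Union>j. F j)" for i
        by (intro suminf_emeasure) auto
      then show "(\<Sum>j. \<Sum>i=1..n. ennreal (w i) * emeasure (return borel (y i)) (F j))
          = (\<Sum>i=1..n. ennreal (w i) * emeasure (return borel (y i)) (\<Union>j. F j))"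
        by (subst suminf_sum) (auto simp: ennreal_suminf_cmult)
    qed
  qed (auto simp: positive_def)
  then show ?thesis using A by simp
qed

lemma measure_atoms:
  assumes "is_weight n w" and A: "A \<in> sets borel"
  shows "measure (atoms n w y) A = (\<Sum>i=1..n. w i * indicator A (y i))"
proof (rule measure_eq_emeasure_eq_ennreal)
  show "0 \<le> (\<Sum>i=1..n. w i * indicator A (y i))"
    using assms by (intro sum_nonneg) (auto simp: is_weight_def)
  have "(\<Sum>i=1..n. ennreal (w i) * indicator A (y i)) = (\<Sum>i=1..n. ennreal (w i * indicator A (y i)))"
    by (intro sum.cong) (auto simp: indicator_def)
  also have "\<dots> = ennreal (\<Sum>i=1..n. w i * indicator A (y i))"
    using assms by (intro sum_ennreal) (auto simp: is_weight_def)
  finally show "emeasure (atoms n w y) A = ennreal (\<Sum>i=1..n. w i * indicator A (y i))"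
    using A by (simp add: emeasure_atoms)
qed

lemma atoms_in_prob_algebra:
  assumes w: "is_weight n w"
  shows "atoms n w y \<in> space (prob_algebra borel)"
proof -
  have "emeasure (atoms n w y) UNIV = (\<Sum>i=1..n. ennreal (w i))"
    by (simp add: emeasure_atoms)
  also have "\<dots> = ennreal (\<Sum>i=1..n. w i)"
    using w by (intro sum_ennreal) (auto simp: is_weight_def)
  finally have "emeasure (atoms n w y) UNIV = 1" using w by (simp add: is_weight_def)
  then show ?thesis by (auto simp: space_prob_algebra intro!: prob_spaceI)
qed

lemma atoms_cong:
  assumes "\<And>i. i \<in> {1..n} \<Longrightarrow> w i = w' i" "\<And>i. i \<in> {1..n} \<Longrightarrow> y i = y' i"
  shows "atoms n w y = atoms n w' y'"
  unfolding atoms_def using assms by (intro arg_cong[where f="measure_of _ _"] ext sum.cong) auto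

lemma chain_step_eq_mix: "chain_step n t w y p = mix t (atoms n w y) p"
  unfolding chain_step_def mix_def
  using sets.space_closed[of "borel :: 'a measure"] sets.sigma_sets_eq[of "borel :: 'a measure"]
  by (intro measure_of_eq) (auto simp: emeasure_atoms)

definition innovation_space :: "nat \<Rightarrow> (real \<times> (nat \<Rightarrow> real) \<times> (nat \<Rightarrow> 'a::polish_space)) measure" where
  "innovation_space n = borel \<Otimes>\<^sub>M (\<Pi>\<^sub>M i\<in>{1..n}. borel) \<Otimes>\<^sub>M (\<Pi>\<^sub>M i\<in>{1..n}. borel)"

text \<open>The totalisation outside the range of the innovations makes the update measurable on the whole
  product space.\<close>

definition total_update :: "nat \<Rightarrow> real \<times> (nat \<Rightarrow> real) \<times> (nat \<Rightarrow> 'a::polish_space) \<Rightarrow> 'a measure \<Rightarrow> 'a measure" where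
  "total_update n = (\<lambda>(t, w, y) p. mix (max 0 (min 1 t)) (if is_weight n w then atoms n w y else return borel undefined) p)"

lemma measurable_is_weight [measurable]: "Measurable.pred (\<Pi>\<^sub>M i\<in>{1..n}. borel) (is_weight n)"
  unfolding is_weight_def by measurable

text \<open>Evaluated at a Borel set, the measure is a finite sum of products of coordinates on the
  measurable set of weights and a constant elsewhere.\<close>

lemma measurable_total_atoms:
  "(\<lambda>(w, y). if is_weight n w then atoms n w y else return borel undefined)
    \<in> (\<Pi>\<^sub>M i\<in>{1..n}. borel) \<Otimes>\<^sub>M (\<Pi>\<^sub>M i\<in>{1..n}. borel) \<rightarrow>\<^sub>M prob_algebra (borel :: 'a::polish_space measure)"
    (is "?f \<in> ?W \<Otimes>\<^sub>M ?Y \<rightarrow>\<^sub>M _")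
proof (rule measurable_prob_algebraI)
  have sp: "?f x \<in> space (prob_algebra borel)" for x
    using atoms_in_prob_algebra[of n "fst x" "snd x"]
    by (auto simp: case_prod_unfold space_prob_algebra prob_space_return)
  then show "prob_space (?f x)" for x by (auto simp: space_prob_algebra)
  show "?f \<in> ?W \<Otimes>\<^sub>M ?Y \<rightarrow>\<^sub>M subprob_algebra borel"
  proof (rule measurable_subprob_algebra)
    fix x show "subprob_space (?f x)" "sets (?f x) = sets borel"
      using sp[of x] by (auto simp: space_prob_algebra prob_space_imp_subprob_space)
  next
    fix A :: "'a set" assume A[measurable]: "A \<in> sets borel"
    have "(\<lambda>x. if is_weight n (fst x) then (\<Sum>i=1..n. ennreal (fst x i) * indicator A (snd x i)) else indicator A undefined)
       \<in> borel_measurable (?W \<Otimes>\<^sub>M ?Y)" by measurable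
    also have "(\<lambda>x. if is_weight n (fst x) then (\<Sum>i=1..n. ennreal (fst x i) * indicator A (snd x i)) else indicator A undefined)
      = (\<lambda>x. emeasure (?f x) A)"
      using A by (auto simp: fun_eq_iff case_prod_unfold emeasure_atoms)
    finally show "(\<lambda>x. emeasure (?f x) A) \<in> borel_measurable (?W \<Otimes>\<^sub>M ?Y)" .
  qed
qed

lemma measurable_total_update:
  "(\<lambda>(e, p). total_update n e p) \<in> innovation_space n \<Otimes>\<^sub>M prob_measures \<rightarrow>\<^sub>M (prob_measures :: 'a::polish_space measure measure)"
proof -
  let ?E = "innovation_space n \<Otimes>\<^sub>M (prob_measures :: 'a measure measure)"
  have "(\<lambda>x. mix (max 0 (min 1 (fst (fst x)))) (case snd (fst x) of (w, y) \<Rightarrow> if is_weight n w then atoms n w y else return borel undefined) (snd x))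
    \<in> ?E \<rightarrow>\<^sub>M prob_algebra borel"
  proof (rule measurable_mix)
    show "(\<lambda>x. max 0 (min 1 (fst (fst x)))) \<in> borel_measurable ?E"
      unfolding innovation_space_def by measurable
    have "(\<lambda>x. snd (fst x)) \<in> ?E \<rightarrow>\<^sub>M (\<Pi>\<^sub>M i\<in>{1..n}. borel) \<Otimes>\<^sub>M (\<Pi>\<^sub>M i\<in>{1..n}. borel)"
      unfolding innovation_space_def by measurable
    from measurable_compose[OF this measurable_total_atoms]
    show "(\<lambda>x. case snd (fst x) of (w, y) \<Rightarrow> if is_weight n w then atoms n w y else return borel undefined) \<in> ?E \<rightarrow>\<^sub>M prob_algebra borel" .
    have "snd \<in> ?E \<rightarrow>\<^sub>M prob_measures" by measurable
    then show "snd \<in> ?E \<rightarrow>\<^sub>M prob_algebra borel"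
      by (simp cong: measurable_cong_sets add: sets_prob_measures)
  qed auto
  then show ?thesis
    by (simp cong: measurable_cong_sets add: sets_prob_measures total_update_def case_prod_unfold)
qed

lemma total_update_eq:
  assumes "t \<in> {0..1}" "is_weight n w"
  shows "total_update n (t, w, y) p = chain_step n t w y p"
  using assms by (simp add: total_update_def chain_step_eq_mix)

lemma dirichlet_dist_cong:
  assumes "\<And>i. i \<in> I \<Longrightarrow> c i = c' i"
  shows "dirichlet_dist I c = dirichlet_dist I c'"
proof -
  have "(\<Pi>\<^sub>M i\<in>I. gamma_dist (c i)) = (\<Pi>\<^sub>M i\<in>I. gamma_dist (c' i))"
    using assms by (intro PiM_cong) auto
  then show ?thesis by (simp add: dirichlet_dist_def)
qed

text \<open>The Dirichlet distribution solves the fixed point equation of the chain, on the level of moments.\<close>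

lemma dirichlet_innovation_moments:
  fixes \<alpha> :: "'a::polish_space measure" and A :: "(nat \<times> nat) set"
  assumes Z: "polya_sequence N \<alpha> Z" and n: "n \<ge> 1" and K: "finite K" and \<kappa>: "\<kappa> \<in> borel \<rightarrow>\<^sub>M count_space UNIV" "range \<kappa> \<subseteq> K"
    and \<alpha>: "sets \<alpha> = sets borel" "finite_measure \<alpha>" "measure \<alpha> UNIV = a" "a > 0"
    and c: "\<And>k. c k = measure \<alpha> {x. \<kappa> x = k}" and A: "finite A" "fst ` A \<subseteq> K"
  defines "\<mu> \<equiv> beta_dist (real n) a \<Otimes>\<^sub>M (dirichlet_dist {1..n} (\<lambda>_. 1) \<Otimes>\<^sub>M
      distr N (\<Pi>\<^sub>M i\<in>{1..n}. borel) (\<lambda>\<omega>. \<lambda>i\<in>{1..n}. Z i \<omega>))"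
  shows "(\<integral>\<^sup>+(t, w, y). (\<integral>\<^sup>+v. ennreal (\<Prod>x\<in>A. t * label_sum {1..n} (\<lambda>i. \<kappa> (y i)) w (fst x) + (1 - t) * v (fst x)) \<partial>dirichlet_dist K c) \<partial>\<mu>)
    = (\<integral>\<^sup>+v. ennreal (\<Prod>x\<in>A. v (fst x)) \<partial>dirichlet_dist K c)"
    and "(\<lambda>(t, w, y). \<integral>\<^sup>+v. ennreal (\<Prod>x\<in>A. t * label_sum {1..n} (\<lambda>i. \<kappa> (y i)) w (fst x) + (1 - t) * v (fst x)) \<partial>dirichlet_dist K c)
      \<in> borel_measurable (innovation_space n)"
proof -
  let ?PW = "\<Pi>\<^sub>M i\<in>{1..n}. (borel :: real measure)" and ?PY = "\<Pi>\<^sub>M i\<in>{1..n}. (borel :: 'a measure)"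
  let ?PK = "\<Pi>\<^sub>M i\<in>K. (borel :: real measure)"
  let ?Y = "distr N ?PY (\<lambda>\<omega>. \<lambda>i\<in>{1..n}. Z i \<omega>)"
  let ?W = "dirichlet_dist {1..n} (\<lambda>_. 1 :: real)" and ?B = "beta_dist (real n) a"
  interpret N: prob_space N using Z by (simp add: polya_sequence_def)
  interpret \<alpha>: finite_measure \<alpha> by fact
  have Zm: "Z i \<in> borel_measurable N" if "i \<in> {1..n}" for i
    using Z that by (auto simp: polya_sequence_def)
  have Zr: "(\<lambda>\<omega>. \<lambda>i\<in>{1..n}. Z i \<omega>) \<in> N \<rightarrow>\<^sub>M ?PY" using Zm by (intro measurable_restrict)
  have c0: "0 \<le> c k" for k by (simp add: c)
  have sum_c: "(\<Sum>k\<in>K. c k) = a"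
  proof -
    have "(\<Sum>k\<in>K. measure \<alpha> {x. \<kappa> x = k}) = measure \<alpha> (\<Union>k\<in>K. {x. \<kappa> x = k})"
      using K \<alpha>(1) measurable_sets[OF \<kappa>(1), of "{_}"]
      by (intro \<alpha>.finite_measure_finite_Union[symmetric]) (auto simp: disjoint_family_on_def vimage_def)
    also have "(\<Union>k\<in>K. {x. \<kappa> x = k}) = UNIV" using \<kappa>(2) by auto
    finally show ?thesis using \<alpha> by (simp add: c)
  qed
  interpret Y: prob_space ?Y by (rule N.prob_space_distr[OF Zr])
  interpret W: prob_space ?W by (rule prob_space_dirichlet_dist) simp
  interpret B: prob_space ?B using n \<alpha> by (intro prob_space_beta_dist) auto
  interpret D: prob_space "dirichlet_dist K c" by (rule prob_space_dirichlet_dist) (rule c0)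
  interpret WY: pair_prob_space ?W ?Y ..
  interpret BWY: pair_prob_space ?B "?W \<Otimes>\<^sub>M ?Y" ..
  interpret BY: pair_prob_space ?B ?Y ..
  note [measurable] = \<kappa>(1)
  have AK: "fst x \<in> K" if "x \<in> A" for x using A that by auto
  define G where "G = (\<lambda>(t, w, y). \<integral>\<^sup>+v. ennreal (\<Prod>x\<in>A. t * label_sum {1..n} (\<lambda>i. \<kappa> (y i)) w (fst x) + (1 - t) * v (fst x)) \<partial>dirichlet_dist K c)"
  have G: "G \<in> borel_measurable (borel \<Otimes>\<^sub>M ?PW \<Otimes>\<^sub>M ?PY)"
  proof -
    have f: "(\<lambda>(e, v). fst e * label_sum {1..n} (\<lambda>i. \<kappa> (snd (snd e) i)) (fst (snd e)) (fst x) + (1 - fst e) * v (fst x))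
      \<in> borel_measurable ((borel \<Otimes>\<^sub>M ?PW \<Otimes>\<^sub>M ?PY) \<Otimes>\<^sub>M dirichlet_dist K c)" if "x \<in> A" for x
    proof -
      have [simp]: "fst x \<in> K" by (rule AK[OF that])
      show ?thesis unfolding label_sum_def by measurable
    qed
    have "(\<lambda>p. ennreal (\<Prod>x\<in>A. case p of (e, v) \<Rightarrow> fst e * label_sum {1..n} (\<lambda>i. \<kappa> (snd (snd e) i)) (fst (snd e)) (fst x) + (1 - fst e) * v (fst x)))
      \<in> borel_measurable ((borel \<Otimes>\<^sub>M ?PW \<Otimes>\<^sub>M ?PY) \<Otimes>\<^sub>M dirichlet_dist K c)"
      using f by (intro measurable_compose[OF borel_measurable_prod measurable_ennreal])
    then have "(\<lambda>(e, v). ennreal (\<Prod>x\<in>A. fst e * label_sum {1..n} (\<lambda>i. \<kappa> (snd (snd e) i)) (fst (snd e)) (fst x) + (1 - fst e) * v (fst x)))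
      \<in> borel_measurable ((borel \<Otimes>\<^sub>M ?PW \<Otimes>\<^sub>M ?PY) \<Otimes>\<^sub>M dirichlet_dist K c)"
      by (simp add: case_prod_unfold)
    from D.borel_measurable_nn_integral[OF this] show ?thesis
      by (simp add: G_def case_prod_unfold)
  qed
  then show "G \<in> borel_measurable (innovation_space n)" by (simp add: innovation_space_def)
  have sets_\<mu>: "sets \<mu> = sets (borel \<Otimes>\<^sub>M ?PW \<Otimes>\<^sub>M ?PY)"
    unfolding \<mu>_def by (intro sets_pair_measure_cong) auto
  have G\<mu>: "G \<in> borel_measurable \<mu>" using G by (simp cong: measurable_cong_sets add: sets_\<mu>)
  have G2: "(\<lambda>(w, y). G (t, w, y)) \<in> borel_measurable (?W \<Otimes>\<^sub>M ?Y)" for t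
  proof -
    have "(\<lambda>p. (t, p)) \<in> ?W \<Otimes>\<^sub>M ?Y \<rightarrow>\<^sub>M ?B \<Otimes>\<^sub>M (?W \<Otimes>\<^sub>M ?Y)" by measurable
    from measurable_compose[OF this G\<mu>[unfolded \<mu>_def]] show ?thesis by (simp add: case_prod_unfold)
  qed
  \<comment> \<open>The integrals are reordered so that the sample \<open>y\<close> stands
    outermost: the beta-Dirichlet identity needs its labels fixed, and the urn average comes
    last.\<close>
  have "(\<integral>\<^sup>+e. G e \<partial>\<mu>) = (\<integral>\<^sup>+t. (\<integral>\<^sup>+p. G (t, p) \<partial>(?W \<Otimes>\<^sub>M ?Y)) \<partial>?B)"
    unfolding \<mu>_def by (rule WY.P.nn_integral_fst[symmetric]) (use G\<mu> in \<open>simp add: \<mu>_def\<close>)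
  also have "\<dots> = (\<integral>\<^sup>+t. (\<integral>\<^sup>+y. (\<integral>\<^sup>+w. G (t, w, y) \<partial>?W) \<partial>?Y) \<partial>?B)"
    using WY.nn_integral_snd[OF G2] by (intro nn_integral_cong) (simp add: case_prod_unfold)
  also have "\<dots> = (\<integral>\<^sup>+y. (\<integral>\<^sup>+t. (\<integral>\<^sup>+w. G (t, w, y) \<partial>?W) \<partial>?B) \<partial>?Y)"
  proof (rule BY.Fubini'[symmetric])
    have "(\<lambda>p. (fst (fst p), snd p, snd (fst p))) \<in> (?B \<Otimes>\<^sub>M ?Y) \<Otimes>\<^sub>M ?W \<rightarrow>\<^sub>M ?B \<Otimes>\<^sub>M (?W \<Otimes>\<^sub>M ?Y)" by measurable
    from measurable_compose[OF this G\<mu>[unfolded \<mu>_def]]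
    have "(\<lambda>(p, w). G (fst p, w, snd p)) \<in> borel_measurable ((?B \<Otimes>\<^sub>M ?Y) \<Otimes>\<^sub>M ?W)" by (simp add: case_prod_unfold)
    from W.borel_measurable_nn_integral[OF this]
    show "(\<lambda>(t, y). \<integral>\<^sup>+w. G (t, w, y) \<partial>?W) \<in> borel_measurable (?B \<Otimes>\<^sub>M ?Y)" by (simp add: case_prod_unfold)
  qed
  also have "\<dots> = (\<integral>\<^sup>+\<omega>. (\<integral>\<^sup>+t. (\<integral>\<^sup>+w. G (t, w, \<lambda>i\<in>{1..n}. Z i \<omega>) \<partial>?W) \<partial>?B) \<partial>N)"
  proof (rule nn_integral_distr[OF Zr])
    have "(\<lambda>p. (snd (fst p), snd p, fst (fst p))) \<in> (?Y \<Otimes>\<^sub>M ?B) \<Otimes>\<^sub>M ?W \<rightarrow>\<^sub>M ?B \<Otimes>\<^sub>M (?W \<Otimes>\<^sub>M ?Y)" by measurable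
    from measurable_compose[OF this G\<mu>[unfolded \<mu>_def]]
    have "(\<lambda>(p, w). G (snd p, w, fst p)) \<in> borel_measurable ((?Y \<Otimes>\<^sub>M ?B) \<Otimes>\<^sub>M ?W)" by (simp add: case_prod_unfold)
    from W.borel_measurable_nn_integral[OF this]
    have "(\<lambda>(y, t). \<integral>\<^sup>+w. G (t, w, y) \<partial>?W) \<in> borel_measurable (?Y \<Otimes>\<^sub>M ?B)" by (simp add: case_prod_unfold)
    from B.borel_measurable_nn_integral[OF this]
    show "(\<lambda>y. \<integral>\<^sup>+t. (\<integral>\<^sup>+w. G (t, w, y) \<partial>?W) \<partial>?B) \<in> borel_measurable ?Y" .
  qed
  also have "\<dots> = (\<integral>\<^sup>+\<omega>. (\<integral>\<^sup>+v. ennreal (\<Prod>x\<in>A. v (fst x)) \<partial>dirichlet_dist K (\<lambda>k. c k + label_sum {1..n} (\<lambda>i. \<kappa> (Z i \<omega>)) (\<lambda>_. 1) k)) \<partial>N)"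
  \<comment> \<open>For a fixed sample the beta parameters must be the totals of the two Dirichlet
    parameters: \<open>n\<close> is a sum of ones and \<open>a\<close> is the sum of
    \<open>c\<close>.\<close>
  proof (intro nn_integral_cong)
    fix \<omega>
    have "(\<integral>\<^sup>+t. (\<integral>\<^sup>+w. G (t, w, \<lambda>i\<in>{1..n}. Z i \<omega>) \<partial>?W) \<partial>?B)
      = (\<integral>\<^sup>+t. (\<integral>\<^sup>+w. (\<integral>\<^sup>+v. ennreal (\<Prod>x\<in>A. t * label_sum {1..n} (\<lambda>i. \<kappa> (Z i \<omega>)) w (fst x) + (1 - t) * v (fst x)) \<partial>dirichlet_dist K c) \<partial>?W)
          \<partial>beta_dist (\<Sum>i\<in>{1..n}. 1) (\<Sum>k\<in>K. c k))"
    proof -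
      have "label_sum {1..n} (\<lambda>i. \<kappa> ((\<lambda>i\<in>{1..n}. Z i \<omega>) i)) w = label_sum {1..n} (\<lambda>i. \<kappa> (Z i \<omega>)) w" for w
        unfolding label_sum_def by (intro ext sum.cong) auto
      then show ?thesis unfolding G_def prod.case sum_c by simp
    qed
    also have "\<dots> = (\<integral>\<^sup>+v. ennreal (\<Prod>x\<in>A. v (fst x)) \<partial>dirichlet_dist K (\<lambda>k. c k + label_sum {1..n} (\<lambda>i. \<kappa> (Z i \<omega>)) (\<lambda>_. 1) k))"
      using K A n \<kappa>(2) c0 sum_c \<alpha> by (intro beta_dirichlet_mixture_moments) auto
    finally show "(\<integral>\<^sup>+t. (\<integral>\<^sup>+w. G (t, w, \<lambda>i\<in>{1..n}. Z i \<omega>) \<partial>?W) \<partial>?B)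
      = (\<integral>\<^sup>+v. ennreal (\<Prod>x\<in>A. v (fst x)) \<partial>dirichlet_dist K (\<lambda>k. c k + label_sum {1..n} (\<lambda>i. \<kappa> (Z i \<omega>)) (\<lambda>_. 1) k))" .
  qed
  also have "\<dots> = (\<integral>\<^sup>+v. ennreal (\<Prod>x\<in>A. v (fst x)) \<partial>dirichlet_dist K c)"
    using \<alpha>(3,4) by (intro polya_dirichlet_moments[OF Z K \<kappa> \<alpha>(1,2) _ c A]) simp
  finally show "(\<integral>\<^sup>+e. G e \<partial>\<mu>) = (\<integral>\<^sup>+v. ennreal (\<Prod>x\<in>A. v (fst x)) \<partial>dirichlet_dist K c)" .
qed

theorem theorem3:
  fixes M :: "'w measure" and N :: "'v measure"
    and \<alpha> :: "'a::polish_space measure" and a :: real and n :: nat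
    and \<theta> :: "nat \<Rightarrow> 'w \<Rightarrow> real"
    and q :: "nat \<Rightarrow> nat \<Rightarrow> 'w \<Rightarrow> real"
    and Y :: "nat \<Rightarrow> nat \<Rightarrow> 'w \<Rightarrow> 'a"
    and Z :: "nat \<Rightarrow> 'v \<Rightarrow> 'a"
  assumes alpha: "sets \<alpha> = sets borel" "finite_measure \<alpha>" "measure \<alpha> UNIV = a" "a > 0"
    and n: "n \<ge> 1"
    and M: "prob_space M"
    and theta_indep: "prob_space.indep_vars M (\<lambda>_. borel) \<theta> {1..}"
    and theta_law: "\<And>m. m \<ge> 1 \<Longrightarrow> distr M borel (\<theta> m) = beta_dist (real n) a"
    and theta_range: "\<And>m \<omega>. m \<ge> 1 \<Longrightarrow> \<omega> \<in> space M \<Longrightarrow> \<theta> m \<omega> \<in> {0..1}"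
    and q_indep: "prob_space.indep_vars M (\<lambda>_. \<Pi>\<^sub>M i\<in>{1..n}. borel)
        (\<lambda>m \<omega>. \<lambda>i\<in>{1..n}. q m i \<omega>) {1..}"
    and q_law: "\<And>m. m \<ge> 1 \<Longrightarrow>
        distr M (\<Pi>\<^sub>M i\<in>{1..n}. borel) (\<lambda>\<omega>. \<lambda>i\<in>{1..n}. q m i \<omega>) = dirichlet_dist {1..n} (\<lambda>_. 1)"
    and q_nonneg: "\<And>m i \<omega>. m \<ge> 1 \<Longrightarrow> i \<in> {1..n} \<Longrightarrow> \<omega> \<in> space M \<Longrightarrow> q m i \<omega> \<ge> 0"
    and q_sum: "\<And>m \<omega>. m \<ge> 1 \<Longrightarrow> \<omega> \<in> space M \<Longrightarrow> (\<Sum>i=1..n. q m i \<omega>) = 1"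
    and Z_polya: "polya_sequence N \<alpha> Z"
    and Y_indep: "prob_space.indep_vars M (\<lambda>_. \<Pi>\<^sub>M i\<in>{1..n}. borel)
        (\<lambda>m \<omega>. \<lambda>i\<in>{1..n}. Y m i \<omega>) {1..}"
    and Y_law: "\<And>m. m \<ge> 1 \<Longrightarrow>
        distr M (\<Pi>\<^sub>M i\<in>{1..n}. borel) (\<lambda>\<omega>. \<lambda>i\<in>{1..n}. Y m i \<omega>)
        = distr N (\<Pi>\<^sub>M i\<in>{1..n}. borel) (\<lambda>\<omega>. \<lambda>i\<in>{1..n}. Z i \<omega>)"
    and mutual_indep: "prob_space.indep_sets M
        (nth [sets (generated_algebra M {1..} borel \<theta>),
              sets (generated_algebra M {1..} (\<Pi>\<^sub>M i\<in>{1..n}. borel) (\<lambda>m \<omega>. \<lambda>i\<in>{1..n}. q m i \<omega>)),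
              sets (generated_algebra M {1..} (\<Pi>\<^sub>M i\<in>{1..n}. borel) (\<lambda>m \<omega>. \<lambda>i\<in>{1..n}. Y m i \<omega>))])
        {..<3}"
  shows "(\<forall>p\<in>space prob_measures.
            markov_chain M prob_measures (chain_kernel M n \<theta> q Y) (measure_chain n \<theta> q Y p)) \<and>
         (\<exists>!Q. invariant_measure prob_measures (chain_kernel M n \<theta> q Y) Q) \<and>
         (\<forall>Q. invariant_measure prob_measures (chain_kernel M n \<theta> q Y) Q
            \<longrightarrow> dirichlet_process_law \<alpha> Q)"
proof -
  interpret M: prob_space M by fact
  let ?w = "\<lambda>m \<omega>. \<lambda>i\<in>{1..n}. q m i \<omega>" and ?y = "\<lambda>m \<omega>. \<lambda>i\<in>{1..n}. Y m i \<omega>"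
  \<comment> \<open>All randomness of one step in a single variable; the restrictions to
    \<open>{1..n}\<close> make it an element of the product space.\<close>
  define e where "e m \<omega> = (\<theta> m \<omega>, ?w m \<omega>, ?y m \<omega>)" for m \<omega>
  let ?\<mu> = "beta_dist (real n) a \<Otimes>\<^sub>M (dirichlet_dist {1..n} (\<lambda>_. 1) \<Otimes>\<^sub>M
      distr N (\<Pi>\<^sub>M i\<in>{1..n}. borel) (\<lambda>\<omega>. \<lambda>i\<in>{1..n}. Z i \<omega>))"
  note triple = M.indep_vars_triple[OF theta_indep q_indep Y_indep mutual_indep]
  have e_indep: "M.indep_vars (\<lambda>_. innovation_space n) e {1..}"
    using triple(1) unfolding e_def[abs_def] innovation_space_def .
  have e_law: "distr M (innovation_space n) (e m) = ?\<mu>" if "m \<ge> 1" for m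
    using triple(2)[of m] that theta_law[OF that] q_law[OF that] Y_law[OF that]
    unfolding e_def[abs_def] innovation_space_def by simp
  have e_rv: "e m \<in> M \<rightarrow>\<^sub>M innovation_space n" if "m \<ge> 1" for m
    using e_indep that by (auto simp: M.indep_vars_def)
  have weight: "is_weight n (?w m \<omega>)" if "m \<ge> 1" "\<omega> \<in> space M" for m \<omega>
    using q_nonneg[OF that(1) _ that(2)] q_sum[OF that] by (simp add: is_weight_def)
  define D where "D \<omega> = atoms n (?w 1 \<omega>) (?y 1 \<omega>)" for \<omega>
  have step: "chain_step n (\<theta> m \<omega>) (\<lambda>i. q m i \<omega>) (\<lambda>i. Y m i \<omega>) p = total_update n (e m \<omega>) p"
    if "m \<ge> 1" "\<omega> \<in> space M" for m \<omega> p
    using theta_range[OF that] weight[OF that] atoms_cong[of n "\<lambda>i. q m i \<omega>" "?w m \<omega>" "\<lambda>i. Y m i \<omega>" "?y m \<omega>"]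
    by (simp add: e_def total_update_eq chain_step_eq_mix)
  have step1: "chain_step n (\<theta> 1 \<omega>) (\<lambda>i. q 1 i \<omega>) (\<lambda>i. Y 1 i \<omega>) p = mix (\<theta> 1 \<omega>) (D \<omega>) p" for \<omega> p
    unfolding chain_step_eq_mix D_def by (intro arg_cong[where f="\<lambda>d. mix _ d _"] atoms_cong) auto
  have \<theta>1: "\<theta> 1 \<in> borel_measurable M" using theta_indep by (auto simp: M.indep_vars_def)
  \<comment> \<open>The kernel is defined by the first step of the chain, so the pair
    \<open>\<theta> 1\<close>, \<open>D\<close> is the random mixture behind it.\<close>
  interpret random_mixture M "\<theta> 1" D
  proof unfold_locales
    show "\<theta> 1 \<in> borel_measurable M" by fact
    show "\<And>\<omega>. \<omega> \<in> space M \<Longrightarrow> \<theta> 1 \<omega> \<in> {0..1}" by (rule theta_range) auto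
    have "snd \<in> innovation_space n \<rightarrow>\<^sub>M (\<Pi>\<^sub>M i\<in>{1..n}. (borel :: real measure)) \<Otimes>\<^sub>M (\<Pi>\<^sub>M i\<in>{1..n}. (borel :: 'a measure))"
      unfolding innovation_space_def by measurable
    from measurable_compose[OF measurable_compose[OF e_rv[of 1] this] measurable_total_atoms]
    show "D \<in> M \<rightarrow>\<^sub>M prob_algebra borel"
      using weight[of 1] by (subst measurable_cong[where g="\<lambda>\<omega>. case snd (e 1 \<omega>) of (w, y) \<Rightarrow> if is_weight n w then atoms n w y else return borel undefined"])
        (auto simp: D_def e_def)
    interpret B: prob_space "beta_dist (real n) a" using n alpha by (intro prob_space_beta_dist) auto
    \<comment> \<open>The mean \<open>n / (n + a)\<close> of the beta law is the size-bias constant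
      for the function \<open>1\<close>.\<close>
    have "(\<integral>\<^sup>+\<omega>. ennreal (\<theta> 1 \<omega>) \<partial>M) = (\<integral>\<^sup>+t. ennreal t * 1 \<partial>distr M borel (\<theta> 1))"
      using \<theta>1 by (simp add: nn_integral_distr)
    also have "\<dots> = ennreal (real n / (real n + a))"
      unfolding theta_law[OF order_refl] using n alpha B.emeasure_space_1
      by (subst beta_dist_size_bias(1)) (auto simp: prob_space.emeasure_space_1[OF prob_space_beta_dist, simplified])
    finally have "(\<integral>\<^sup>+\<omega>. ennreal (\<theta> 1 \<omega>) \<partial>M) = ennreal (real n / (real n + a))" .
    then have "(\<integral>\<omega>. \<theta> 1 \<omega> \<partial>M) = real n / (real n + a)"
      using \<theta>1 theta_range[of 1] alpha by (subst integral_eq_nn_integral) auto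
    then show "(\<integral>\<omega>. \<theta> 1 \<omega> \<partial>M) > 0" using n alpha by simp
  qed
  \<comment> \<open>The kernel is written in two ways: as a random mixture, which has the unique
    invariant law, and through the totalised update, which is jointly measurable in innovation and
    state and gives the Markov property.\<close>
  have kernel_eq: "chain_kernel M n \<theta> q Y = kernel"
    unfolding chain_kernel_def[abs_def] kernel_def[abs_def] by (simp add: step1[unfolded One_nat_def])
  have kernel_eq': "chain_kernel M n \<theta> q Y = (\<lambda>p. distr M prob_measures (\<lambda>\<omega>. total_update n (e 1 \<omega>) p))"
    unfolding chain_kernel_def[abs_def] using step[of 1] by (intro ext distr_cong) auto
  have "markov_chain M prob_measures (chain_kernel M n \<theta> q Y) (measure_chain n \<theta> q Y p)" if "p \<in> space prob_measures" for p
    unfolding kernel_eq'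
    using e_law step that
    by (intro M.random_recursion_markov_chain[OF e_indep _ measurable_total_update that]) auto
  moreover have "\<exists>!Q. invariant_measure prob_measures (chain_kernel M n \<theta> q Y) Q"
    unfolding kernel_eq using invariant_exists invariant_unique by blast
  moreover have "dirichlet_process_law \<alpha> Q" if Q: "invariant_measure prob_measures (chain_kernel M n \<theta> q Y) Q" for Q
  proof -
    have Q': "prob_space Q" "sets Q = sets prob_measures" using Q by (auto simp: invariant_measure_def)
    have "distr Q (\<Pi>\<^sub>M i\<in>{1..k}. borel) (\<lambda>p. \<lambda>i\<in>{1..k}. measure p (B i)) = dirichlet_dist {1..k} (\<lambda>i. measure \<alpha> (B i))"
      if B: "\<forall>i\<in>{1..k}. B i \<in> sets borel" "disjoint_family_on B {1..k}" "(\<Union>i\<in>{1..k}. B i) = UNIV" for k :: nat and B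
    proof -
      \<comment> \<open>\<open>\<kappa>\<close> sends a point to the index of its block; the
        partition becomes a measurable labelling, the form in which the urn identities are
        stated.\<close>
      define \<kappa> where "\<kappa> z = (THE j. j \<in> {1..k} \<and> z \<in> B j)" for z
      have \<kappa>: "\<kappa> z \<in> {1..k} \<and> z \<in> B (\<kappa> z)" for z
      proof -
        have "z \<in> (\<Union>i\<in>{1..k}. B i)" unfolding B(3) by simp
        then obtain j where "j \<in> {1..k}" "z \<in> B j" by blast
        moreover have "j' = j" if "j' \<in> {1..k} \<and> z \<in> B j'" for j'
          using B(2) that calculation unfolding disjoint_family_on_def by blast
        ultimately have "\<exists>!j. j \<in> {1..k} \<and> z \<in> B j" by blast
        then show ?thesis unfolding \<kappa>_def by (rule theI')
      qed
      have \<kappa>_iff: "\<kappa> z = j \<longleftrightarrow> z \<in> B j" if "j \<in> {1..k}" for z j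
        using \<kappa>[of z] B(2) that unfolding disjoint_family_on_def by blast
      \<comment> \<open>Labels outside \<open>{1..k}\<close> have empty fibres. So every fibre is
        measurable, and \<open>c\<close> can be given at every natural number by the mass of a
        fibre, as the urn identities expect.\<close>
      have \<kappa>_set: "{z. \<kappa> z = j} = (if j \<in> {1..k} then B j else {})" for j
        using \<kappa>_iff[of j] \<kappa> by auto
      have \<kappa>m: "\<kappa> \<in> borel \<rightarrow>\<^sub>M count_space UNIV"
        using B(1) by (subst measurable_count_space_eq2_countable) (auto simp: vimage_def \<kappa>_set)
      define c where "c j = measure \<alpha> {z. \<kappa> z = j}" for j
      have Dir: "dirichlet_dist {1..k} (\<lambda>i. measure \<alpha> (B i)) = dirichlet_dist {1..k} c"
        by (rule dirichlet_dist_cong) (simp add: c_def \<kappa>_set)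
      have cpos: "(\<Sum>j\<in>{1..k}. c j) > 0"
      proof -
        interpret \<alpha>: finite_measure \<alpha> by fact
        have "(\<Sum>j\<in>{1..k}. c j) = (\<Sum>j\<in>{1..k}. measure \<alpha> (B j))" by (intro sum.cong) (auto simp: c_def \<kappa>_set)
        also have "\<dots> = measure \<alpha> (\<Union>j\<in>{1..k}. B j)"
          using B alpha(1) by (intro \<alpha>.finite_measure_finite_Union[symmetric]) auto
        finally show ?thesis using B(3) alpha by simp
      qed
      have c0: "0 \<le> c j" for j by (simp add: c_def)
      show ?thesis unfolding Dir
      proof (rule invariant_masses_eq[OF Q[unfolded kernel_eq]])
        show "B i \<in> sets borel" if "i \<in> {1..k}" for i using B(1) that by blast
        show "prob_space (dirichlet_dist {1..k} c)" by (rule prob_space_dirichlet_dist) (rule c0)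
        show "AE v in dirichlet_dist {1..k} c. v i \<in> {0..1}" if "i \<in> {1..k}" for i
        proof -
          have "AE v in dirichlet_dist {1..k} c. (\<forall>i\<in>{1..k}. v i \<in> {0..1}) \<and> (\<Sum>i\<in>{1..k}. v i) = 1"
            using c0 cpos by (intro AE_dirichlet_dist) auto
          then show ?thesis by eventually_elim (use that in blast)
        qed
        fix A :: "(nat \<times> nat) set" assume A: "finite A" "fst ` A \<subseteq> {1..k}"
        define G where "G = (\<lambda>(t, w, y). \<integral>\<^sup>+v. ennreal (\<Prod>x\<in>A. t * label_sum {1..n} (\<lambda>i. \<kappa> (y i)) w (fst x) + (1 - t) * v (fst x)) \<partial>dirichlet_dist {1..k} c)"
        have \<kappa>r: "range \<kappa> \<subseteq> {1..k}" using \<kappa> by blast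
        note inn = dirichlet_innovation_moments[OF Z_polya n _ \<kappa>m \<kappa>r alpha c_def A, folded G_def]
        have "(\<integral>\<^sup>+v. ennreal (\<Prod>x\<in>A. v (fst x)) \<partial>dirichlet_dist {1..k} c) = (\<integral>\<^sup>+u. G u \<partial>?\<mu>)"
          using inn(1) by simp
        also have "\<dots> = (\<integral>\<^sup>+\<omega>. G (e 1 \<omega>) \<partial>M)"
          unfolding e_law[OF order_refl, symmetric] using inn(2) by (intro nn_integral_distr e_rv) auto
        also have "\<dots> = (\<integral>\<^sup>+\<omega>. (\<integral>\<^sup>+v. ennreal (\<Prod>x\<in>A. \<theta> 1 \<omega> * measure (D \<omega>) (B (fst x)) + (1 - \<theta> 1 \<omega>) * v (fst x)) \<partial>dirichlet_dist {1..k} c) \<partial>M)"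
        proof (rule nn_integral_cong)
          fix \<omega> assume \<omega>: "\<omega> \<in> space M"
          \<comment> \<open>Under the labelling \<open>\<kappa>\<close> the label sum of the weights
            is the mass of the block under the sampled discrete measure; this turns the Dirichlet
            identity into the fixed point equation of the mixture.\<close>
          have "label_sum {1..n} (\<lambda>i. \<kappa> (?y 1 \<omega> i)) (?w 1 \<omega>) (fst x) = measure (D \<omega>) (B (fst x))" if "x \<in> A" for x
          proof -
            have x: "fst x \<in> {1..k}" using A that by auto
            have "measure (D \<omega>) (B (fst x)) = (\<Sum>i=1..n. ?w 1 \<omega> i * indicator (B (fst x)) (?y 1 \<omega> i))"
              unfolding D_def using B(1) x weight[OF order_refl \<omega>] by (intro measure_atoms) auto
            also have "\<dots> = label_sum {1..n} (\<lambda>i. \<kappa> (?y 1 \<omega> i)) (?w 1 \<omega>) (fst x)"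
              unfolding label_sum_def \<kappa>_iff[OF x] by (intro sum.cong) (auto simp: indicator_def)
            finally show ?thesis by simp
          qed
          then show "G (e 1 \<omega>) = (\<integral>\<^sup>+v. ennreal (\<Prod>x\<in>A. \<theta> 1 \<omega> * measure (D \<omega>) (B (fst x)) + (1 - \<theta> 1 \<omega>) * v (fst x)) \<partial>dirichlet_dist {1..k} c)"
            unfolding G_def e_def prod.case by (intro nn_integral_cong arg_cong[where f=ennreal] prod.cong refl) simp
        qed
        finally show "(\<integral>\<^sup>+v. ennreal (\<Prod>x\<in>A. v (fst x)) \<partial>dirichlet_dist {1..k} c)
          = (\<integral>\<^sup>+\<omega>. (\<integral>\<^sup>+v. ennreal (\<Prod>x\<in>A. \<theta> 1 \<omega> * measure (D \<omega>) (B (fst x)) + (1 - \<theta> 1 \<omega>) * v (fst x)) \<partial>dirichlet_dist {1..k} c) \<partial>M)" .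
      qed simp
    qed
    moreover have "(\<lambda>p. p) \<in> Q \<rightarrow>\<^sub>M prob_measures"
      by (simp cong: measurable_cong_sets add: Q'(2))
    \<comment> \<open>The invariant law itself is the probability space and the identity the random
      measure; its type is the one that \<open>dirichlet_process_law\<close> quantifies
      over.\<close>
    ultimately have "dirichlet_process Q \<alpha> (\<lambda>p. p)"
      unfolding dirichlet_process_def using Q'(1) by blast
    moreover have "Q = distr Q prob_measures (\<lambda>p. p)"
      using Q'(2) by (simp add: distr_id2)
    ultimately show ?thesis unfolding dirichlet_process_law_def by blast
  qed
  ultimately show ?thesis by blast
qed

end
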